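(* Let $(\mathfrak g,P)$ be an admissible pair and suppose that $\partial^*$ is a codifferential for $(\mathfrak g,P)$. Then $\mathcal N:=\ker(\partial^* )\subset L(\Lambda^2(\mathfrak g/\mathfrak p),\mathfrak g)$ is a normalization condition for $(\mathfrak g,P)$ and $\widetilde{\mathcal N}:=\operatorname{im}(\partial^* )\subset\mathcal N$ (the image of $\partial^*:L(\Lambda^3(\mathfrak g/\mathfrak p),\mathfrak g)\to L(\Lambda^2(\mathfrak g/\mathfrak p),\mathfrak g)$) is a maximal negligible submodule.
   Context: All Lie algebras are real and finite dimensional. **Admissible pairs.** A filtered Lie algebra is a Lie algebra $\mathfrak g$ with linear subspaces $\mathfrak g=\mathfrak g^{-\mu}\supset\dots\supset\mathfrak g^{-1}\supset\mathfrak g^0\supset\mathfrak g^1\supset\dots\supset\mathfrak g^\nu$ such that $[\mathfrak g^i,\mathfrak g^j]\subset\mathfrak g^{i+j}$ for all $i,j$, where $\mathfrak g^\ell=\mathfrak g$ for $\ell<-\mu$ and $\mathfrak g^\ell=\{0\}$ for $\ell>\nu$. $\operatorname{Aut}_f(\mathfrak g)$ is the group of Lie algebra automorphisms preserving each $\mathfrak g^i$, and $\mathfrak{der}_f(\mathfrak g)$ the Lie algebra of derivations preserving each $\mathfrak g^i$. An admissible pair $(\mathfrak g,P)$ consists of (i) such a filtered Lie algebra $\mathfrak g$; (ii) a Lie group $P$ with Lie algebra $\mathfrak p:=\mathfrak g^0$; (iii) a (smooth) homomorphism $\operatorname{Ad}:P\to\operatorname{Aut}_f(\mathfrak g)$ with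 derivative $\operatorname{ad}|_{\mathfrak g^0}:\mathfrak g^0\to\mathfrak{der}_f(\mathfrak g)$; such that (A) there is no nonzero ideal of $\mathfrak g$ contained in $\mathfrak g^0$; (B) if $A\in\mathfrak g^0$ satisfies $\operatorname{ad}(A)(\mathfrak g^i)\subset\mathfrak g^{i+1}$ for all $i=-\mu,\dots,-1$, then $A\in\mathfrak g^1$. **Associated graded.** $\operatorname{gr}_i(\mathfrak g)=\mathfrak g^i/\mathfrak g^{i+1}$, $\operatorname{gr}(\mathfrak g)=\bigoplus_i\operatorname{gr}_i(\mathfrak g)$ with the induced graded Lie bracket, and $\mathfrak m=\bigoplus_{i=-\mu}^{-1}\operatorname{gr}_i(\mathfrak g)$ with $\mathfrak m_i=\operatorname{gr}_i(\mathfrak g)$. $C^k(\mathfrak m,\operatorname{gr}(\mathfrak g))=L(\Lambda^k\mathfrak m,\operatorname{gr}(\mathfrak g))$ is the space of alternating $k$-linear maps, and $C^k(\mathfrak m,\operatorname{gr}(\mathfrak g))_\ell$ the subspace of maps sending $\mathfrak m_{i_1}\times\dots\times\mathfrak m_{i_k}$ to $\operatorname{gr}_{i_1+\dots+i_k+\ell}(\mathfrak g)$. The differential $\partial:C^k(\mathfrak m,\operatorname{gr}(\mathfrak g))\to C^{k+1}(\mathfrak m,\operatorname{gr}(\mathfrak g))$, which preserves the degree $\ell$, is $$\partial\varphi(X_0,\dots,X_k)=\sum_{i}(-1)^i[X_i,\varphi(X_0,\dots,\widehat{X_i},\dots,X_k)]+\sum_{i<j}(-1)^{i+j}\varphi([X_i,X_j],X_0,\dots,\widehat{X_i},\dots,\widehat{X_j},\dots,X_k).$$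 **Filtered multilinear maps.** $L(\Lambda^k(\mathfrak g/\mathfrak p),\mathfrak g)$ is the space of alternating $k$-linear maps $(\mathfrak g/\mathfrak p)^k\to\mathfrak g$, with its natural $P$-action induced by $\operatorname{Ad}$. $L(\Lambda^k(\mathfrak g/\mathfrak p),\mathfrak g)^\ell$ is the subspace of maps $\alpha$ that are homogeneous of degree $\ge\ell$, i.e. $\alpha(X_1+\mathfrak p,\dots,X_k+\mathfrak p)\in\mathfrak g^{i_1+\dots+i_k+\ell}$ for all $X_j\in\mathfrak g^{i_j}$, $i_j<0$. These form a filtration. The linear map $\operatorname{gr}_\ell:L(\Lambda^k(\mathfrak g/\mathfrak p),\mathfrak g)^\ell\to C^k(\mathfrak m,\operatorname{gr}(\mathfrak g))_\ell$, sending $\alpha$ to the map taking the classes of $X_j\in\mathfrak g^{i_j}$ to the class of $\alpha(X_1+\mathfrak p,\dots,X_k+\mathfrak p)$ in $\operatorname{gr}_{i_1+\dots+i_k+\ell}(\mathfrak g)$, induces an isomorphism of the $\ell$-th associated graded component with $C^k(\mathfrak m,\operatorname{gr}(\mathfrak g))_\ell$. For a subspace $E\subset L(\Lambda^k(\mathfrak g/\mathfrak p),\mathfrak g)$ put $E^\ell=E\cap L(\Lambda^k(\mathfrak g/\mathfrak p),\mathfrak g)^\ell$ and $\operatorname{gr}_\ell(E):=\operatorname{gr}_\ell(E^\ell)$. **Normalization condition:** a $P$-invariant linear subspace $\mathcal N\subset L(\Lambda^2(\mathfrak g/\mathfrak p),\mathfrak g)$ such that for each $\ell>0$ the subspace $\operatorname{gr}_\ell(\mathcal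 N)\subset C^2(\mathfrak m,\operatorname{gr}(\mathfrak g))_\ell$ is complementary to the image of $\partial:C^1(\mathfrak m,\operatorname{gr}(\mathfrak g))_\ell\to C^2(\mathfrak m,\operatorname{gr}(\mathfrak g))_\ell$. **Negligible submodule** in $\mathcal N$: a $P$-invariant subspace $\widetilde{\mathcal N}\subset\mathcal N$ such that for each $\ell>0$, $\operatorname{gr}_\ell(\widetilde{\mathcal N})\cap\ker(\partial)=\{0\}$ in $C^2(\mathfrak m,\operatorname{gr}(\mathfrak g))_\ell$. It is maximal if $\operatorname{gr}_\ell(\widetilde{\mathcal N})$ is complementary to $\ker(\partial)$ in $C^2(\mathfrak m,\operatorname{gr}(\mathfrak g))_\ell$ for all $\ell$. **Image-homogeneous.** A filtration preserving linear map $\Phi:V\to W$ between filtered vector spaces is image-homogeneous if $\operatorname{im}(\Phi)\cap W^i=\Phi(V^i)$ for all $i$. A filtration preserving map $\Phi$ induces $\operatorname{gr}_0(\Phi):\operatorname{gr}(V)\to\operatorname{gr}(W)$. **Codifferential** for $(\mathfrak g,P)$: linear maps $\partial^*:L(\Lambda^k(\mathfrak g/\mathfrak p),\mathfrak g)\to L(\Lambda^{k-1}(\mathfrak g/\mathfrak p),\mathfrak g)$ for $k=2,3$ such that (a) both maps are $P$-equivariant, compatible with homogeneities (i.e. filtration preserving) and image-homogeneous, and $\partial^*\circ\partial^*=0$; (b) the induced maps $\operatorname{gr}_0(\partial^* ):C^k(\mathfrak m,\operatorname{gr}(\mathfrak g))\to C^{k-1}(\mathfrak m,\operatorname{gr}(\mathfrak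 g))$ are disjoint to $\partial$: in $C^k(\mathfrak m,\operatorname{gr}(\mathfrak g))$ one has $\ker(\operatorname{gr}_0(\partial^* ))\cap\operatorname{im}(\partial)=\{0\}$ for $k=2,3$ and $\operatorname{im}(\operatorname{gr}_0(\partial^* ))\cap\ker(\partial)=\{0\}$ for $k=1,2$. Here $\ker(\partial^* )$ in the claim is the kernel of $\partial^*$ on $L(\Lambda^2(\mathfrak g/\mathfrak p),\mathfrak g)$. *)

theory Defs
  imports "HOL-Analysis.Analysis" "HOL-Algebra.AbelCoset" "HOL-Algebra.Module"
begin

section \<open>Real vector spaces as modules with explicit carriers\<close>

text \<open>
  Quotients, associated graded spaces and spaces of multilinear maps are modules in the sense of
  \<open>HOL-Algebra\<close> over the following ring.  The ring components \<open>mult\<close> and \<open>one\<close> of a module record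
  carry no information and are left undefined.
\<close>

definition real_ring :: "real ring" where
  "real_ring = \<lparr>carrier = UNIV, mult = (*), one = 1, zero = 0, add = (+)\<rparr>"

definition type_space :: "(real, 'a::real_vector) module" where
  "type_space = \<lparr>carrier = UNIV, mult = undefined, one = undefined, zero = 0, add = (+),
     smult = (*\<^sub>R)\<rparr>"

definition quot_space :: "'a::real_vector set \<Rightarrow> 'a set \<Rightarrow> (real, 'a set) module" where
  "quot_space V W = \<lparr>carrier = {x +o W | x. x \<in> V}, mult = undefined, one = undefined,
     zero = W, add = (+), smult = (\<lambda>r A. (*\<^sub>R) r ` A + W)\<rparr>"
  \<comment> \<open>adding \<open>W\<close> after scaling matters only for \<open>r = 0\<close>\<close>

definition linear_maps :: "(real, 'a) module \<Rightarrow> (real, 'b) module \<Rightarrow> ('a \<Rightarrow> 'b) set" where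
  "linear_maps V W = {f \<in> carrier V \<rightarrow>\<^sub>E carrier W. \<forall>x\<in>carrier V. \<forall>y\<in>carrier V. \<forall>r s.
     f (r \<odot>\<^bsub>V\<^esub> x \<oplus>\<^bsub>V\<^esub> s \<odot>\<^bsub>V\<^esub> y) = r \<odot>\<^bsub>W\<^esub> f x \<oplus>\<^bsub>W\<^esub> s \<odot>\<^bsub>W\<^esub> f y}"

definition complementary :: "(real, 'a) module \<Rightarrow> 'a set \<Rightarrow> 'a set \<Rightarrow> bool" where
  "complementary M U W \<longleftrightarrow> submodule U real_ring M \<and> submodule W real_ring M \<and>
     U \<inter> W = {\<zero>\<^bsub>M\<^esub>} \<and> U <+>\<^bsub>M\<^esub> W = carrier M"

text \<open>A \<open>k\<close>-linear map is a function on lists of length \<open>k\<close>, extensional outside its domain.\<close>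

definition tuples :: "nat \<Rightarrow> (real, 'a) module \<Rightarrow> 'a list set" where
  "tuples k V = {xs. length xs = k \<and> set xs \<subseteq> carrier V}"

definition alt_maps ::
    "nat \<Rightarrow> (real, 'a) module \<Rightarrow> (real, 'b) module \<Rightarrow> ('a list \<Rightarrow> 'b) set" where
  "alt_maps k V W = {f \<in> tuples k V \<rightarrow>\<^sub>E carrier W.
     (\<forall>xs\<in>tuples k V. \<forall>i<k. \<forall>x\<in>carrier V. \<forall>y\<in>carrier V. \<forall>r s.
        f (xs[i := r \<odot>\<^bsub>V\<^esub> x \<oplus>\<^bsub>V\<^esub> s \<odot>\<^bsub>V\<^esub> y])
          = r \<odot>\<^bsub>W\<^esub> f (xs[i := x]) \<oplus>\<^bsub>W\<^esub> s \<odot>\<^bsub>W\<^esub> f (xs[i := y])) \<and>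
     (\<forall>xs\<in>tuples k V. \<forall>i<k. \<forall>j<k. i \<noteq> j \<and> xs ! i = xs ! j \<longrightarrow> f xs = \<zero>\<^bsub>W\<^esub>)}"

definition alt_space ::
    "nat \<Rightarrow> (real, 'a) module \<Rightarrow> (real, 'b) module \<Rightarrow> (real, 'a list \<Rightarrow> 'b) module" where
  "alt_space k V W = \<lparr>carrier = alt_maps k V W, mult = undefined, one = undefined,
     zero = (\<lambda>xs\<in>tuples k V. \<zero>\<^bsub>W\<^esub>),
     add = (\<lambda>f g. \<lambda>xs\<in>tuples k V. f xs \<oplus>\<^bsub>W\<^esub> g xs),
     smult = (\<lambda>r f. \<lambda>xs\<in>tuples k V. r \<odot>\<^bsub>W\<^esub> f xs)\<rparr>"


section \<open>Lie groups\<close>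

text \<open>
  Smoothness on a relatively open subset \<open>S\<close> of a finite-dimensional subspace \<open>V\<close>: all iterated
  directional derivatives along \<open>V\<close> exist and are continuous.
\<close>

primrec Ck_on :: "nat \<Rightarrow> 'v::real_normed_vector set \<Rightarrow> 'v set \<Rightarrow>
    ('v \<Rightarrow> 'b::real_normed_vector) \<Rightarrow> bool" where
  "Ck_on 0 V S f \<longleftrightarrow> continuous_on S f"
| "Ck_on (Suc n) V S f \<longleftrightarrow> continuous_on S f \<and>
     (\<exists>D. \<forall>v\<in>V. (\<forall>x\<in>S. ((\<lambda>t. f (x + t *\<^sub>R v)) has_vector_derivative D v x) (at 0)) \<and>
                Ck_on n V S (D v))"

definition smooth_on :: "'v::real_normed_vector set \<Rightarrow> 'v set \<Rightarrow>
    ('v \<Rightarrow> 'b::real_normed_vector) \<Rightarrow> bool" where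
  "smooth_on V S f \<longleftrightarrow> (\<forall>n. Ck_on n V S f)"

record ('p, 'v) lie_grp = "'p monoid" +
  top_of :: "'p topology"
  charts :: "('p set \<times> ('p \<Rightarrow> 'v)) set"

text \<open>
  The model space is a subspace \<open>V\<close> of \<open>'v\<close> rather than a type, so that zero-dimensional (discrete)
  groups are included.  The atlas need not be maximal.
\<close>

locale lie_group = group P
  for V :: "'v::real_normed_vector set" and P :: "('p, 'v) lie_grp" (structure) +
  assumes model_subspace: "subspace V"
    and model_finite_dim: "\<exists>B. finite B \<and> V \<subseteq> span B"
    and topspace_eq: "topspace (top_of P) = carrier P"
    and hausdorff: "Hausdorff_space (top_of P)"
    and second_countable: "second_countable (top_of P)"
    and chart_open: "(U, c) \<in> charts P \<Longrightarrow> openin (top_of P) U"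
    and chart_image_open: "(U, c) \<in> charts P \<Longrightarrow> openin (top_of_set V) (c ` U)"
    and chart_homeo: "(U, c) \<in> charts P \<Longrightarrow>
          homeomorphic_map (subtopology (top_of P) U) (top_of_set (c ` U)) c"
    and charts_cover: "(\<Union>(U, c)\<in>charts P. U) = carrier P"
    and charts_compatible: "(U, c) \<in> charts P \<Longrightarrow> (U', c') \<in> charts P \<Longrightarrow>
          smooth_on V (c ` (U \<inter> U')) (c' \<circ> inv_into U c)"
    and mult_continuous:
      "continuous_map (prod_topology (top_of P) (top_of P)) (top_of P) (\<lambda>(x, y). x \<otimes> y)"
    and mult_smooth: "(U, c) \<in> charts P \<Longrightarrow> (U', c') \<in> charts P \<Longrightarrow> (U'', c'') \<in> charts P \<Longrightarrow>
          smooth_on (V \<times> V) {(c x, c' y) | x y. x \<in> U \<and> y \<in> U' \<and> x \<otimes> y \<in> U''}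
            (\<lambda>(a, b). c'' (inv_into U c a \<otimes> inv_into U' c' b))"
    and inverse_continuous: "continuous_map (top_of P) (top_of P) (\<lambda>x. m_inv P x)"
    and inverse_smooth: "(U, c) \<in> charts P \<Longrightarrow> (U', c') \<in> charts P \<Longrightarrow>
          smooth_on V {c x | x. x \<in> U \<and> m_inv P x \<in> U'} (\<lambda>a. c' (m_inv P (inv_into U c a)))"

definition smooth_map_on_group :: "'v::real_normed_vector set \<Rightarrow> ('p, 'v) lie_grp \<Rightarrow>
    ('p \<Rightarrow> 'b::real_normed_vector) \<Rightarrow> bool" where
  "smooth_map_on_group V P f \<longleftrightarrow> (\<forall>(U, c)\<in>charts P. smooth_on V (c ` U) (f \<circ> inv_into U c))"

definition smooth_functions ::
    "'v::real_normed_vector set \<Rightarrow> ('p, 'v) lie_grp \<Rightarrow> ('p \<Rightarrow> real) set" where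
  "smooth_functions V P = {f \<in> extensional (carrier P). smooth_map_on_group V P f}"

text \<open>
  The Lie algebra of \<open>P\<close>: left-invariant vector fields, a vector field being a derivation of the
  algebra of smooth functions.
\<close>

definition left_invariant_fields :: "'v::real_normed_vector set \<Rightarrow> ('p, 'v) lie_grp \<Rightarrow>
    (('p \<Rightarrow> real) \<Rightarrow> ('p \<Rightarrow> real)) set" where
  "left_invariant_fields V P = {D \<in> smooth_functions V P \<rightarrow>\<^sub>E smooth_functions V P.
     (\<forall>f\<in>smooth_functions V P. \<forall>h\<in>smooth_functions V P. \<forall>r s. \<forall>x\<in>carrier P.
        D (\<lambda>y\<in>carrier P. r * f y + s * h y) x = r * D f x + s * D h x) \<and>
     (\<forall>f\<in>smooth_functions V P. \<forall>h\<in>smooth_functions V P. \<forall>x\<in>carrier P.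
        D (\<lambda>y\<in>carrier P. f y * h y) x = D f x * h x + f x * D h x) \<and>
     (\<forall>f\<in>smooth_functions V P. \<forall>q\<in>carrier P. \<forall>x\<in>carrier P.
        D (\<lambda>y\<in>carrier P. f (q \<otimes>\<^bsub>P\<^esub> y)) x = D f (q \<otimes>\<^bsub>P\<^esub> x))}"

text \<open>\<open>\<iota>\<close> identifies the Lie algebra \<open>V\<close> (with bracket \<open>br\<close>) with the Lie algebra of \<open>P\<close>.\<close>

definition is_lie_algebra_of :: "('v::real_normed_vector \<Rightarrow> 'v \<Rightarrow> 'v) \<Rightarrow> 'v set \<Rightarrow>
    ('p, 'v) lie_grp \<Rightarrow> ('v \<Rightarrow> ('p \<Rightarrow> real) \<Rightarrow> ('p \<Rightarrow> real)) \<Rightarrow> bool" where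
  "is_lie_algebra_of br V P \<iota> \<longleftrightarrow> bij_betw \<iota> V (left_invariant_fields V P) \<and>
     (\<forall>A\<in>V. \<forall>B\<in>V. \<forall>f\<in>smooth_functions V P. \<forall>x\<in>carrier P.
        (\<forall>r s. \<iota> (r *\<^sub>R A + s *\<^sub>R B) f x = r * \<iota> A f x + s * \<iota> B f x) \<and>
        \<iota> (br A B) f x = \<iota> A (\<iota> B f) x - \<iota> B (\<iota> A f) x)"


section \<open>Filtered Lie algebras and admissible pairs\<close>

record 'g filtered_lie =
  bracket :: "'g \<Rightarrow> 'g \<Rightarrow> 'g"
  fil :: "int \<Rightarrow> 'g set"
  depth :: nat
  height :: nat

text \<open>
  The norm serves only to provide the canonical topology of a finite-dimensional space.
  \<open>depth\<close> and \<open>height\<close> are the integers \<open>\<mu>\<close> and \<open>\<nu>\<close>; the filtration is indexed by all integers,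
  with the convention for indices outside \<open>{-\<mu>..\<nu>}\<close> built in.
\<close>

locale filtered_lie_algebra =
  fixes \<gg> :: "'g::real_normed_vector filtered_lie"
  assumes finite_dim: "\<exists>B::'g set. finite B \<and> span B = UNIV"
    and bracket_bilinear: "bilinear (bracket \<gg>)"
    and bracket_self: "bracket \<gg> x x = 0"
    and jacobi: "bracket \<gg> x (bracket \<gg> y z) + bracket \<gg> y (bracket \<gg> z x)
                   + bracket \<gg> z (bracket \<gg> x y) = 0"
    and fil_subspace: "subspace (fil \<gg> i)"
    and fil_decreasing: "fil \<gg> (i + 1) \<subseteq> fil \<gg> i"
    and fil_bottom: "i \<le> - int (depth \<gg>) \<Longrightarrow> fil \<gg> i = UNIV"
    and fil_top: "int (height \<gg>) < i \<Longrightarrow> fil \<gg> i = {0}"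
    and fil_bracket: "x \<in> fil \<gg> i \<Longrightarrow> y \<in> fil \<gg> j \<Longrightarrow> bracket \<gg> x y \<in> fil \<gg> (i + j)"

definition aut_f :: "'g::real_normed_vector filtered_lie \<Rightarrow> ('g \<Rightarrow> 'g) monoid" where
  "aut_f \<gg> = \<lparr>carrier = {\<phi>. linear \<phi> \<and> bij \<phi> \<and>
       (\<forall>x y. \<phi> (bracket \<gg> x y) = bracket \<gg> (\<phi> x) (\<phi> y)) \<and> (\<forall>i. \<phi> ` fil \<gg> i \<subseteq> fil \<gg> i)},
     mult = (\<circ>), one = id\<rparr>"

text \<open>
  Smoothness and derivative of \<open>Ad\<close> are those of a map into the normed space of endomorphisms of
  the Lie algebra; the derivative at the identity is taken by applying the left-invariant
  vector field \<open>\<iota> A\<close> to \<open>h \<circ> Ad\<close>, for \<open>h\<close> an arbitrary linear functional on endomorphisms.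
\<close>

locale admissible_pair =
  filtered_lie_algebra \<gg> + lie_group "fil \<gg> 0" P
  for \<gg> :: "'g::real_normed_vector filtered_lie" and P :: "('p, 'g) lie_grp" +
  fixes \<iota> :: "'g \<Rightarrow> ('p \<Rightarrow> real) \<Rightarrow> ('p \<Rightarrow> real)"
    and Ad :: "'p \<Rightarrow> 'g \<Rightarrow> 'g"
  assumes lie_algebra: "is_lie_algebra_of (bracket \<gg>) (fil \<gg> 0) P \<iota>"
    and Ad_hom: "Ad \<in> hom P (aut_f \<gg>)"
    and Ad_smooth: "smooth_map_on_group (fil \<gg> 0) P (\<lambda>p. Blinfun (Ad p))"
    and Ad_derivative: "A \<in> fil \<gg> 0 \<Longrightarrow> bounded_linear h \<Longrightarrow>
          \<iota> A (\<lambda>p\<in>carrier P. h (Blinfun (Ad p))) \<one>\<^bsub>P\<^esub> = h (Blinfun (bracket \<gg> A))"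
    and effective: "subspace I \<Longrightarrow> (\<And>x y. y \<in> I \<Longrightarrow> bracket \<gg> x y \<in> I) \<Longrightarrow>
          I \<subseteq> fil \<gg> 0 \<Longrightarrow> I = {0}"
    and raising: "A \<in> fil \<gg> 0 \<Longrightarrow>
          (\<And>i x. - int (depth \<gg>) \<le> i \<Longrightarrow> i \<le> -1 \<Longrightarrow> x \<in> fil \<gg> i \<Longrightarrow>
             bracket \<gg> A x \<in> fil \<gg> (i + 1)) \<Longrightarrow> A \<in> fil \<gg> 1"


section \<open>Associated graded Lie algebra and its cochains\<close>

definition gr_comp :: "'g::real_normed_vector filtered_lie \<Rightarrow> int \<Rightarrow> (real, 'g set) module" where
  "gr_comp \<gg> i = quot_space (fil \<gg> i) (fil \<gg> (i + 1))"

text \<open>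
  Elements of the direct sum are families of cosets.  Finite support is automatic, since
  \<open>gr_comp \<gg> i\<close> is trivial for \<open>i\<close> outside \<open>{-\<mu>..\<nu>}\<close>.
\<close>

definition gr_space :: "'g::real_normed_vector filtered_lie \<Rightarrow> (real, int \<Rightarrow> 'g set) module" where
  "gr_space \<gg> = \<lparr>carrier = {a. \<forall>i. a i \<in> carrier (gr_comp \<gg> i)}, mult = undefined, one = undefined,
     zero = (\<lambda>i. \<zero>\<^bsub>gr_comp \<gg> i\<^esub>),
     add = (\<lambda>a b i. a i \<oplus>\<^bsub>gr_comp \<gg> i\<^esub> b i),
     smult = (\<lambda>r a i. r \<odot>\<^bsub>gr_comp \<gg> i\<^esub> a i)\<rparr>"

definition gr_homog :: "'g::real_normed_vector filtered_lie \<Rightarrow> int \<Rightarrow> (int \<Rightarrow> 'g set) set" where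
  "gr_homog \<gg> i = {a \<in> carrier (gr_space \<gg>). \<forall>j. j \<noteq> i \<longrightarrow> a j = \<zero>\<^bsub>gr_comp \<gg> j\<^esub>}"

text \<open>The class of \<open>X \<in> fil \<gg> i\<close> in the \<open>i\<close>-th component, as an element of the direct sum.\<close>

definition gr_class :: "'g::real_normed_vector filtered_lie \<Rightarrow> int \<Rightarrow> 'g \<Rightarrow> (int \<Rightarrow> 'g set)" where
  "gr_class \<gg> i X = (\<lambda>j. if j = i then X +o fil \<gg> (i + 1) else \<zero>\<^bsub>gr_comp \<gg> j\<^esub>)"

text \<open>
  For cosets \<open>a\<close>, \<open>b\<close> in components \<open>i\<close>, \<open>j\<close> the cosets in the union below all coincide.
\<close>

definition gr_bracket_comp ::
    "'g::real_normed_vector filtered_lie \<Rightarrow> int \<Rightarrow> int \<Rightarrow> 'g set \<Rightarrow> 'g set \<Rightarrow> 'g set" where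
  "gr_bracket_comp \<gg> i j a b = (\<Union>x\<in>a. \<Union>y\<in>b. bracket \<gg> x y +o fil \<gg> (i + j + 1))"

definition gr_bracket :: "'g::real_normed_vector filtered_lie \<Rightarrow>
    (int \<Rightarrow> 'g set) \<Rightarrow> (int \<Rightarrow> 'g set) \<Rightarrow> (int \<Rightarrow> 'g set)" where
  "gr_bracket \<gg> a b = (\<lambda>n. finsum (gr_comp \<gg> n) (\<lambda>i. gr_bracket_comp \<gg> i (n - i) (a i) (b (n - i)))
     {i \<in> {- int (depth \<gg>)..int (height \<gg>)}. n - i \<in> {- int (depth \<gg>)..int (height \<gg>)}})"

definition neg_space :: "'g::real_normed_vector filtered_lie \<Rightarrow> (real, int \<Rightarrow> 'g set) module" where
  "neg_space \<gg> = (gr_space \<gg>)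
     \<lparr>carrier := {a \<in> carrier (gr_space \<gg>). \<forall>i\<ge>0. a i = \<zero>\<^bsub>gr_comp \<gg> i\<^esub>}\<rparr>"

type_synonym 'g cochain = "(int \<Rightarrow> 'g set) list \<Rightarrow> (int \<Rightarrow> 'g set)"

definition cochains ::
    "'g::real_normed_vector filtered_lie \<Rightarrow> nat \<Rightarrow> (real, 'g cochain) module" where
  "cochains \<gg> k = alt_space k (neg_space \<gg>) (gr_space \<gg>)"

definition cochains_deg ::
    "'g::real_normed_vector filtered_lie \<Rightarrow> nat \<Rightarrow> int \<Rightarrow> (real, 'g cochain) module" where
  "cochains_deg \<gg> k l = (cochains \<gg> k)\<lparr>carrier := {\<phi> \<in> carrier (cochains \<gg> k).
     \<forall>is as. length is = k \<and> length as = k \<and> (\<forall>j<k. is ! j < 0 \<and> as ! j \<in> gr_homog \<gg> (is ! j))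
       \<longrightarrow> \<phi> as \<in> gr_homog \<gg> (sum_list is + l)}\<rparr>"

definition omit :: "nat \<Rightarrow> 'a list \<Rightarrow> 'a list" where
  "omit i xs = take i xs @ drop (Suc i) xs"

definition differential ::
    "'g::real_normed_vector filtered_lie \<Rightarrow> nat \<Rightarrow> 'g cochain \<Rightarrow> 'g cochain" where
  "differential \<gg> k \<phi> = (\<lambda>as\<in>tuples (Suc k) (neg_space \<gg>).
     finsum (gr_space \<gg>)
       (\<lambda>i. (-1) ^ i \<odot>\<^bsub>gr_space \<gg>\<^esub> gr_bracket \<gg> (as ! i) (\<phi> (omit i as))) {..k}
     \<oplus>\<^bsub>gr_space \<gg>\<^esub>
     finsum (gr_space \<gg>)
       (\<lambda>(i, j). (-1) ^ (i + j) \<odot>\<^bsub>gr_space \<gg>\<^esub>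
          \<phi> (gr_bracket \<gg> (as ! i) (as ! j) # omit i (omit j as))) {(i, j). i < j \<and> j \<le> k})"


section \<open>Filtered multilinear maps\<close>

type_synonym 'g multimap = "'g set list \<Rightarrow> 'g"

definition maps :: "'g::real_normed_vector filtered_lie \<Rightarrow> nat \<Rightarrow> (real, 'g multimap) module" where
  "maps \<gg> k = alt_space k (quot_space UNIV (fil \<gg> 0)) type_space"

definition P_act :: "'g::real_normed_vector filtered_lie \<Rightarrow> ('p, 'g) lie_grp \<Rightarrow>
    ('p \<Rightarrow> 'g \<Rightarrow> 'g) \<Rightarrow> nat \<Rightarrow> 'p \<Rightarrow> 'g multimap \<Rightarrow> 'g multimap" where
  "P_act \<gg> P Ad k p \<alpha> = (\<lambda>xs\<in>tuples k (quot_space UNIV (fil \<gg> 0)).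
     Ad p (\<alpha> (map (\<lambda>C. Ad (m_inv P p) ` C) xs)))"

definition P_submodule :: "'g::real_normed_vector filtered_lie \<Rightarrow> ('p, 'g) lie_grp \<Rightarrow>
    ('p \<Rightarrow> 'g \<Rightarrow> 'g) \<Rightarrow> nat \<Rightarrow> 'g multimap set \<Rightarrow> bool" where
  "P_submodule \<gg> P Ad k E \<longleftrightarrow> submodule E real_ring (maps \<gg> k) \<and>
     (\<forall>p\<in>carrier P. \<forall>\<alpha>\<in>E. P_act \<gg> P Ad k p \<alpha> \<in> E)"

definition maps_fil ::
    "'g::real_normed_vector filtered_lie \<Rightarrow> nat \<Rightarrow> int \<Rightarrow> 'g multimap set" where
  "maps_fil \<gg> k l = {\<alpha> \<in> carrier (maps \<gg> k).
     \<forall>is Xs. length is = k \<and> length Xs = k \<and> (\<forall>j<k. is ! j < 0 \<and> Xs ! j \<in> fil \<gg> (is ! j))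
       \<longrightarrow> \<alpha> (map (\<lambda>X. X +o fil \<gg> 0) Xs) \<in> fil \<gg> (sum_list is + l)}"

text \<open>
  \<open>gr_map \<gg> k l\<close> is only meaningful on \<open>maps_fil \<gg> k l\<close>, where the defining property
  determines a unique cochain because \<open>neg_space\<close> is spanned by the classes involved.
\<close>

definition gr_map ::
    "'g::real_normed_vector filtered_lie \<Rightarrow> nat \<Rightarrow> int \<Rightarrow> 'g multimap \<Rightarrow> 'g cochain" where
  "gr_map \<gg> k l \<alpha> = (THE \<phi>. \<phi> \<in> carrier (cochains_deg \<gg> k l) \<and>
     (\<forall>is Xs. length is = k \<and> length Xs = k \<and> (\<forall>j<k. is ! j < 0 \<and> Xs ! j \<in> fil \<gg> (is ! j))
        \<longrightarrow> \<phi> (map2 (gr_class \<gg>) is Xs)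
            = gr_class \<gg> (sum_list is + l) (\<alpha> (map (\<lambda>X. X +o fil \<gg> 0) Xs))))"

definition gr_sub ::
    "'g::real_normed_vector filtered_lie \<Rightarrow> nat \<Rightarrow> int \<Rightarrow> 'g multimap set \<Rightarrow> 'g cochain set" where
  "gr_sub \<gg> k l E = gr_map \<gg> k l ` (E \<inter> maps_fil \<gg> k l)"

text \<open>
  The map induced on associated graded spaces by a filtration preserving linear map \<open>\<Phi>\<close>.  As
  \<open>cochains \<gg> k\<close> is the direct sum of the images \<open>gr_map \<gg> k l ` maps_fil \<gg> k l\<close>, the defining
  property determines a unique linear map.
\<close>

definition gr0 :: "'g::real_normed_vector filtered_lie \<Rightarrow> nat \<Rightarrow> nat \<Rightarrow>
    ('g multimap \<Rightarrow> 'g multimap) \<Rightarrow> 'g cochain \<Rightarrow> 'g cochain" where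
  "gr0 \<gg> k k' \<Phi> = (THE \<Psi>. \<Psi> \<in> linear_maps (cochains \<gg> k) (cochains \<gg> k') \<and>
     (\<forall>l. \<forall>\<alpha>\<in>maps_fil \<gg> k l. \<Psi> (gr_map \<gg> k l \<alpha>) = gr_map \<gg> k' l (\<Phi> \<alpha>)))"


section \<open>Normalization conditions, negligible submodules, codifferentials\<close>

definition normalization_condition :: "'g::real_normed_vector filtered_lie \<Rightarrow>
    ('p, 'g) lie_grp \<Rightarrow> ('p \<Rightarrow> 'g \<Rightarrow> 'g) \<Rightarrow> 'g multimap set \<Rightarrow> bool" where
  "normalization_condition \<gg> P Ad N \<longleftrightarrow> P_submodule \<gg> P Ad 2 N \<and>
     (\<forall>l>0. complementary (cochains_deg \<gg> 2 l) (gr_sub \<gg> 2 l N)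
              (differential \<gg> 1 ` carrier (cochains_deg \<gg> 1 l)))"

definition negligible_submodule :: "'g::real_normed_vector filtered_lie \<Rightarrow>
    ('p, 'g) lie_grp \<Rightarrow> ('p \<Rightarrow> 'g \<Rightarrow> 'g) \<Rightarrow> 'g multimap set \<Rightarrow> 'g multimap set \<Rightarrow> bool" where
  "negligible_submodule \<gg> P Ad N N' \<longleftrightarrow> P_submodule \<gg> P Ad 2 N' \<and> N' \<subseteq> N \<and>
     (\<forall>l>0. gr_sub \<gg> 2 l N' \<inter> a_kernel (cochains_deg \<gg> 2 l) (cochains_deg \<gg> 3 l) (differential \<gg> 2)
              = {\<zero>\<^bsub>cochains_deg \<gg> 2 l\<^esub>})"

definition maximal_negligible_submodule :: "'g::real_normed_vector filtered_lie \<Rightarrow>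
    ('p, 'g) lie_grp \<Rightarrow> ('p \<Rightarrow> 'g \<Rightarrow> 'g) \<Rightarrow> 'g multimap set \<Rightarrow> 'g multimap set \<Rightarrow> bool" where
  "maximal_negligible_submodule \<gg> P Ad N N' \<longleftrightarrow> negligible_submodule \<gg> P Ad N N' \<and>
     (\<forall>l. complementary (cochains_deg \<gg> 2 l) (gr_sub \<gg> 2 l N')
            (a_kernel (cochains_deg \<gg> 2 l) (cochains_deg \<gg> 3 l) (differential \<gg> 2)))"

text \<open>\<open>\<delta> k\<close> is the component of the codifferential defined on \<open>k\<close>-linear maps, for \<open>k = 2, 3\<close>.\<close>

locale codifferential =
  fixes \<gg> :: "'g::real_normed_vector filtered_lie"
    and P :: "('p, 'g) lie_grp"
    and Ad :: "'p \<Rightarrow> 'g \<Rightarrow> 'g"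
    and \<delta> :: "nat \<Rightarrow> 'g multimap \<Rightarrow> 'g multimap"
  assumes codiff_linear: "k \<in> {2, 3} \<Longrightarrow> \<delta> k \<in> linear_maps (maps \<gg> k) (maps \<gg> (k - 1))"
    and equivariant: "k \<in> {2, 3} \<Longrightarrow> p \<in> carrier P \<Longrightarrow> \<alpha> \<in> carrier (maps \<gg> k) \<Longrightarrow>
          \<delta> k (P_act \<gg> P Ad k p \<alpha>) = P_act \<gg> P Ad (k - 1) p (\<delta> k \<alpha>)"
    and filtration_preserving: "k \<in> {2, 3} \<Longrightarrow> \<delta> k ` maps_fil \<gg> k l \<subseteq> maps_fil \<gg> (k - 1) l"
    and image_homogeneous: "k \<in> {2, 3} \<Longrightarrow>
          \<delta> k ` carrier (maps \<gg> k) \<inter> maps_fil \<gg> (k - 1) l = \<delta> k ` maps_fil \<gg> k l"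
    and codiff_codiff: "\<alpha> \<in> carrier (maps \<gg> 3) \<Longrightarrow> \<delta> 2 (\<delta> 3 \<alpha>) = \<zero>\<^bsub>maps \<gg> 1\<^esub>"
    and disjoint_ker_im: "k \<in> {2, 3} \<Longrightarrow>
          a_kernel (cochains \<gg> k) (cochains \<gg> (k - 1)) (gr0 \<gg> k (k - 1) (\<delta> k))
            \<inter> differential \<gg> (k - 1) ` carrier (cochains \<gg> (k - 1)) = {\<zero>\<^bsub>cochains \<gg> k\<^esub>}"
    and disjoint_im_ker: "k \<in> {1, 2} \<Longrightarrow>
          gr0 \<gg> (k + 1) k (\<delta> (k + 1)) ` carrier (cochains \<gg> (k + 1))
            \<inter> a_kernel (cochains \<gg> k) (cochains \<gg> (k + 1)) (differential \<gg> k)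
            = {\<zero>\<^bsub>cochains \<gg> k\<^esub>}"

end

theory Submission
  imports Defs "HOL-Library.Function_Algebras"
begin

text \<open>
  Write \<open>C\<^sup>k\<close> for the \<open>k\<close>-cochains of a fixed degree \<open>l\<close>, \<open>d\<close> for the differential and \<open>d'\<close> for the
  map that the codifferential \<open>\<delta>\<close> induces on cochains.  The argument has two parts.

  Linear algebra (\<open>complementary_image_kernel\<close>): between \<open>C\<^sup>2\<close> and \<open>C\<^sup>3\<close>, disjointness says that \<open>d'\<close> is
  injective on the image of \<open>d\<close> and that \<open>d\<close> is injective on the image of \<open>d'\<close>.  Hence \<open>d' \<circ> d\<close> is
  injective on the image of \<open>d'\<close>, and by finite dimension it maps this image onto itself.  This
  gives \<open>C\<^sup>2 = im d' \<oplus> ker d\<close>.  The same argument between \<open>C\<^sup>1\<close> and \<open>C\<^sup>2\<close>, with \<open>d\<close> and \<open>d'\<close> exchanged,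
  gives \<open>C\<^sup>2 = im d \<oplus> ker d'\<close>.

  Passage to the associated graded (\<open>gr_sub_image\<close>, \<open>gr_sub_kernel\<close>): image-homogeneity of \<open>\<delta>\<close>
  yields \<open>gr (im \<delta>) = im d'\<close> and \<open>gr (ker \<delta>) = ker d'\<close>.  For the kernel, if \<open>d' (gr \<alpha>) = 0\<close>, then
  \<open>\<delta> \<alpha>\<close> has homogeneity at least \<open>l + 1\<close>, so \<open>\<delta> \<alpha> = \<delta> \<beta>\<close> with \<open>\<beta>\<close> of homogeneity at least \<open>l + 1\<close>, and
  \<open>\<alpha> - \<beta> \<in> ker \<delta>\<close> has the same class as \<open>\<alpha>\<close>.

  To reason about these spaces, a basis adapted to the filtration is chosen
  (\<open>graded_splitting_exists\<close>).  It identifies the associated graded space with \<open>\<gg>\<close>, and both the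
  filtered multilinear maps and the cochains with one space \<open>forms k\<close> of alternating maps on lists
  of vectors.  In these coordinates \<open>gr_map\<close> is the projection \<open>hcomp\<close> to the homogeneous component
  of degree \<open>l\<close> (\<open>gr_map_hcomp\<close>), which also shows that the definite descriptions in the
  definitions of \<open>gr_map\<close> and \<open>gr0\<close> are proper.  Multilinear statements are verified on homogeneous
  arguments (\<open>homog_neg_induct\<close>).
\<close>

section \<open>Linear algebra on subspaces and on modules with carriers\<close>

text \<open>
  Functions into a real vector space form a real vector space pointwise, so that \<^const>\<open>span\<close>,
  \<^const>\<open>linear\<close> and sums are available for multilinear maps.
\<close>

instantiation "fun" :: (type, real_vector) real_vector
begin

definition scaleR_fun :: "real \<Rightarrow> ('a \<Rightarrow> 'b) \<Rightarrow> 'a \<Rightarrow> 'b"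
  where "scaleR_fun r f = (\<lambda>x. r *\<^sub>R f x)"

instance
  by standard (simp_all add: scaleR_fun_def fun_eq_iff scaleR_add_right scaleR_add_left)

end

lemma scaleR_fun_apply [simp]: "(r *\<^sub>R f) x = r *\<^sub>R f x"
  by (simp add: scaleR_fun_def)

lemma sum_fun_apply: "(\<Sum>i\<in>I. f i) x = (\<Sum>i\<in>I. f i x)"
  by (induction I rule: infinite_finite_induct) simp_all

text \<open>
  The subset \<open>A\<close> lies in a finite-dimensional subspace.  The ambient space may be infinite
  dimensional, as it is for spaces of functions.
\<close>

definition fin_gen :: "'a::real_vector set \<Rightarrow> bool" where
  "fin_gen A \<longleftrightarrow> (\<exists>K. finite K \<and> A \<subseteq> span K)"

text \<open>
  Linearity of a map that is only meaningful on the subspace \<open>A\<close>.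
\<close>

definition lin_on :: "'a::real_vector set \<Rightarrow> ('a \<Rightarrow> 'b::real_vector) \<Rightarrow> bool" where
  "lin_on A f \<longleftrightarrow> (\<forall>x\<in>A. \<forall>y\<in>A. \<forall>r s. f (r *\<^sub>R x + s *\<^sub>R y) = r *\<^sub>R f x + s *\<^sub>R f y)"

lemma lin_onD: "lin_on A f \<Longrightarrow> x \<in> A \<Longrightarrow> y \<in> A \<Longrightarrow> f (r *\<^sub>R x + s *\<^sub>R y) = r *\<^sub>R f x + s *\<^sub>R f y"
  by (simp add: lin_on_def)

lemma lin_on_add: "lin_on A f \<Longrightarrow> x \<in> A \<Longrightarrow> y \<in> A \<Longrightarrow> f (x + y) = f x + f y"
  using lin_onD[of A f x y 1 1] by simp

lemma lin_on_scale: "lin_on A f \<Longrightarrow> x \<in> A \<Longrightarrow> f (r *\<^sub>R x) = r *\<^sub>R f x"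
  using lin_onD[of A f x x r 0] by simp

lemma lin_on_zero: "lin_on A f \<Longrightarrow> subspace A \<Longrightarrow> f 0 = 0"
  using lin_on_scale[of A f 0 0] by (simp add: subspace_0)

lemma lin_on_diff: "lin_on A f \<Longrightarrow> x \<in> A \<Longrightarrow> y \<in> A \<Longrightarrow> f (x - y) = f x - f y"
  using lin_onD[of A f x y 1 "-1"] by simp

lemma lin_on_sum:
  assumes "lin_on A f" "subspace A" "\<And>i. i \<in> I \<Longrightarrow> x i \<in> A"
  shows "f (\<Sum>i\<in>I. x i) = (\<Sum>i\<in>I. f (x i))"
  using assms(3)
proof (induction I rule: infinite_finite_induct)
  case (insert i I)
  then show ?case
    using lin_on_add[OF assms(1), of "x i" "\<Sum>i\<in>I. x i"] assms(2) by (simp add: subspace_sum)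
qed (simp_all add: lin_on_zero[OF assms(1,2)])

lemma lin_on_extend:
  assumes "subspace A" "lin_on A f"
  obtains g where "linear g" "\<And>x. x \<in> A \<Longrightarrow> g x = f x"
proof -
  obtain B where B: "B \<subseteq> A" "independent B" "A \<subseteq> span B"
    using maximal_independent_subset[of A] by blast
  obtain g where g: "linear g" "\<forall>x\<in>B. g x = f x"
    using linear_independent_extend[OF B(2), of f] by blast
  have "g x = f x" if "x \<in> A" for x
  proof -
    have sub: "span B \<subseteq> A"
      using B(1) assms(1) by (rule span_minimal)
    have "x \<in> span B" using that B by blast
    then have "x \<in> {x \<in> span B. g x = f x}"
    proof (rule span_subspace_induct)
      show "subspace {x \<in> span B. g x = f x}"
      proof (rule subspaceI)
        show "0 \<in> {x \<in> span B. g x = f x}"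
          using g(1) lin_on_zero[OF assms(2,1)] by (simp add: span_zero linear_0)
      next
        fix x y assume "x \<in> {x \<in> span B. g x = f x}" "y \<in> {x \<in> span B. g x = f x}"
        then show "x + y \<in> {x \<in> span B. g x = f x}"
          using sub lin_on_add[OF assms(2), of x y, symmetric] g(1)
          by (simp add: span_add linear_add subset_iff)
      next
        fix r x assume "x \<in> {x \<in> span B. g x = f x}"
        then show "r *\<^sub>R x \<in> {x \<in> span B. g x = f x}"
          using sub lin_on_scale[OF assms(2), of x r, symmetric] g(1)
          by (simp add: span_scale linear_scale subset_iff)
      qed
    next
      fix y assume "y \<in> B"
      then show "y \<in> {x \<in> span B. g x = f x}" using g(2) by (simp add: span_base)
    qed
    then show ?thesis by simp
  qed
  then show ?thesis using g(1) that by blast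
qed

lemma fin_gen_subset: "fin_gen A \<Longrightarrow> B \<subseteq> A \<Longrightarrow> fin_gen B"
  unfolding fin_gen_def by blast

text \<open>An injective endomorphism of a finite-dimensional space is surjective.\<close>

lemma fin_gen_inj_surj:
  assumes A: "subspace A" "fin_gen A" and f: "lin_on A f" "f ` A \<subseteq> A" "inj_on f A"
  shows "f ` A = A"
proof -
  obtain g where g: "linear g" "\<And>x. x \<in> A \<Longrightarrow> g x = f x"
    using lin_on_extend[OF A(1) f(1)] by blast
  obtain B where B: "B \<subseteq> A" "independent B" "A \<subseteq> span B"
    using maximal_independent_subset[of A] by blast
  have span_B: "span B = A"
    using B span_minimal[OF B(1) A(1)] by blast
  have inj: "inj_on g A"
    using f(3) g(2) by (metis inj_on_cong)
  obtain K where K: "finite K" "A \<subseteq> span K" using A(2) by (auto simp: fin_gen_def)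
  have finB: "finite B"
    using independent_span_bound[OF K(1) B(2)] B(1) K(2) by blast
  have ind: "independent (g ` B)"
    using linear_independent_injective_image[OF g(1) B(2)] inj span_B by simp
  have gB: "g ` B \<subseteq> A" using B(1) g(2) f(2) by fastforce
  have card_gB: "card (g ` B) = card B"
    using inj B(1) by (meson card_image inj_on_subset)
  have "A \<subseteq> span (g ` B)"
  proof (rule ccontr)
    assume "\<not> ?thesis"
    then obtain x where x: "x \<in> A" "x \<notin> span (g ` B)" by blast
    then have "independent (insert x (g ` B))"
      using ind independent_insert by metis
    then have "card (insert x (g ` B)) \<le> card B"
      using independent_span_bound[OF finB] x(1) gB span_B by blast
    moreover have "x \<notin> g ` B" using x(2) span_base[of x "g ` B"] by (rule contrapos_nn)
    ultimately show False using card_gB finB by simp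
  qed
  also have "span (g ` B) = g ` A"
    using linear_span_image[OF g(1), of B] span_B by simp
  also have "\<dots> = f ` A" using g(2) by simp
  finally show ?thesis using f(2) by blast
qed

lemma fin_gen_inj_image:
  assumes "linear f" "subspace A" "inj_on f A" "fin_gen (f ` A)"
  shows "fin_gen A"
proof -
  obtain B where B: "B \<subseteq> A" "independent B" "A \<subseteq> span B"
    using maximal_independent_subset[of A] by blast
  have span_B: "span B = A"
    using B span_minimal[OF B(1) assms(2)] by blast
  obtain K where K: "finite K" "f ` A \<subseteq> span K" using assms(4) by (auto simp: fin_gen_def)
  have "independent (f ` B)"
    using linear_independent_injective_image[OF assms(1) B(2)] assms(3) span_B by simp
  then have "finite (f ` B)"
    using independent_span_bound[OF K(1)] B(1) K(2) by blast
  then have "finite B" using assms(3) B(1) by (meson finite_imageD inj_on_subset)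
  then show ?thesis using B(3) by (auto simp: fin_gen_def)
qed

lemma real_ring_simps [simp]:
  "carrier real_ring = UNIV" "r \<otimes>\<^bsub>real_ring\<^esub> s = r * s" "\<one>\<^bsub>real_ring\<^esub> = 1"
  "\<zero>\<^bsub>real_ring\<^esub> = 0" "r \<oplus>\<^bsub>real_ring\<^esub> s = r + s"
  by (simp_all add: real_ring_def)

lemma cring_real_ring: "cring real_ring"
proof (rule cringI)
  show "abelian_group real_ring"
    by (rule abelian_groupI) (auto simp: algebra_simps intro: exI[of _ "- _"])
  show "comm_monoid real_ring"
    by (rule comm_monoidI) (auto simp: algebra_simps)
qed (auto simp: algebra_simps)

text \<open>
  Coordinates on a module \<open>M\<close> with explicit carrier: a linear bijection \<open>e\<close> onto a subspace
  \<open>S\<close> of a real vector space.  The module axioms for \<open>M\<close> are transported from \<open>S\<close>.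
\<close>

locale lin_coords =
  fixes M :: "(real, 'a) module" and S :: "'b::real_vector set" and e :: "'a \<Rightarrow> 'b"
  assumes bij: "bij_betw e (carrier M) S"
    and subsp: "subspace S"
    and add_closed: "x \<in> carrier M \<Longrightarrow> y \<in> carrier M \<Longrightarrow> x \<oplus>\<^bsub>M\<^esub> y \<in> carrier M"
    and e_add: "x \<in> carrier M \<Longrightarrow> y \<in> carrier M \<Longrightarrow> e (x \<oplus>\<^bsub>M\<^esub> y) = e x + e y"
    and smult_closed: "x \<in> carrier M \<Longrightarrow> r \<odot>\<^bsub>M\<^esub> x \<in> carrier M"
    and e_smult: "x \<in> carrier M \<Longrightarrow> e (r \<odot>\<^bsub>M\<^esub> x) = r *\<^sub>R e x"
    and zero_closed: "\<zero>\<^bsub>M\<^esub> \<in> carrier M"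
    and e_zero: "e \<zero>\<^bsub>M\<^esub> = 0"
begin

lemma e_closed: "x \<in> carrier M \<Longrightarrow> e x \<in> S"
  using bij bij_betwE by blast

lemma e_eq_iff: "x \<in> carrier M \<Longrightarrow> y \<in> carrier M \<Longrightarrow> e x = e y \<longleftrightarrow> x = y"
  using bij by (metis bij_betw_def inj_on_eq_iff)

lemma e_eq_zero_iff: "x \<in> carrier M \<Longrightarrow> e x = 0 \<longleftrightarrow> x = \<zero>\<^bsub>M\<^esub>"
  using e_eq_iff zero_closed e_zero by metis

lemmas closed = add_closed smult_closed zero_closed e_closed

lemma module: "module real_ring M"
proof (rule moduleI)
  show "cring real_ring" by (rule cring_real_ring)
  show "abelian_group M"
  proof (rule abelian_groupI)
    fix x assume "x \<in> carrier M"
    then show "\<exists>y\<in>carrier M. y \<oplus>\<^bsub>M\<^esub> x = \<zero>\<^bsub>M\<^esub>"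
      by (intro bexI[of _ "(-1) \<odot>\<^bsub>M\<^esub> x"])
        (simp_all add: e_eq_iff[symmetric] closed e_add e_smult e_zero)
  qed (simp_all add: e_eq_iff[symmetric] closed e_add e_smult e_zero algebra_simps)
qed (simp_all add: e_eq_iff[symmetric] closed e_add e_smult e_zero algebra_simps)

lemma e_uminus: assumes "y \<in> carrier M"
  shows "e (\<ominus>\<^bsub>M\<^esub> y) = - e y"
proof -
  interpret module real_ring M by (rule module)
  have "e (\<ominus>\<^bsub>M\<^esub> y \<oplus>\<^bsub>M\<^esub> y) = 0" using assms by (simp add: l_neg e_zero)
  then show ?thesis using assms e_add[of "\<ominus>\<^bsub>M\<^esub> y" y]
    by (simp add: add_eq_0_iff2)
qed

lemma e_minus: assumes "x \<in> carrier M" "y \<in> carrier M"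
  shows "e (x \<ominus>\<^bsub>M\<^esub> y) = e x - e y"
proof -
  interpret module real_ring M by (rule module)
  show ?thesis using assms e_add[of x "\<ominus>\<^bsub>M\<^esub> y"] by (simp add: a_minus_def e_uminus)
qed

lemma e_finsum: assumes "finite F" "f \<in> F \<rightarrow> carrier M"
  shows "e (finsum M f F) = (\<Sum>i\<in>F. e (f i))"
proof -
  interpret module real_ring M by (rule module)
  show ?thesis using assms
    by (induction F rule: finite_induct) (auto simp: e_zero finsum_insert e_add Pi_iff)
qed

abbreviation e_inv :: "'b \<Rightarrow> 'a" where "e_inv \<equiv> inv_into (carrier M) e"

lemma e_e_inv: "v \<in> S \<Longrightarrow> e (e_inv v) = v"
  using bij by (simp add: bij_betw_def f_inv_into_f)

lemma e_inv_closed: "v \<in> S \<Longrightarrow> e_inv v \<in> carrier M"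
  using bij by (simp add: bij_betw_def inv_into_into)

lemma e_inv_e: "x \<in> carrier M \<Longrightarrow> e_inv (e x) = x"
  using bij by (simp add: bij_betw_def)

text \<open>Coordinates on a submodule, cut out by a subspace of \<open>S\<close>.\<close>

lemma restrict:
  assumes "U \<subseteq> carrier M" "subspace T" "T \<subseteq> S" "\<And>x. x \<in> carrier M \<Longrightarrow> x \<in> U \<longleftrightarrow> e x \<in> T"
  shows "lin_coords (M\<lparr>carrier := U\<rparr>) T e"
proof
  have img: "e ` U = T"
  proof (intro subset_antisym subsetI)
    fix v assume v: "v \<in> T"
    then have "e_inv v \<in> U" "e (e_inv v) = v"
      using assms e_inv_closed[of v] e_e_inv[of v] by auto
    then show "v \<in> e ` U" by (metis imageI)
  qed (use assms in auto)
  then show "bij_betw e (carrier (M\<lparr>carrier := U\<rparr>)) T"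
    using bij assms(1) by (auto simp: bij_betw_def intro: inj_on_subset)
  show "\<zero>\<^bsub>M\<lparr>carrier := U\<rparr>\<^esub> \<in> carrier (M\<lparr>carrier := U\<rparr>)"
    using assms by (simp add: zero_closed e_zero subspace_0)
next
  fix x y assume "x \<in> carrier (M\<lparr>carrier := U\<rparr>)" "y \<in> carrier (M\<lparr>carrier := U\<rparr>)"
  then have xy: "x \<in> carrier M" "y \<in> carrier M" "e x \<in> T" "e y \<in> T" using assms by auto
  then show "x \<oplus>\<^bsub>M\<lparr>carrier := U\<rparr>\<^esub> y \<in> carrier (M\<lparr>carrier := U\<rparr>)"
    "e (x \<oplus>\<^bsub>M\<lparr>carrier := U\<rparr>\<^esub> y) = e x + e y"
    using assms(2,4) by (simp_all add: closed e_add subspace_add)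
next
  fix x r assume "x \<in> carrier (M\<lparr>carrier := U\<rparr>)"
  then have xy: "x \<in> carrier M" "e x \<in> T" using assms by auto
  then show "r \<odot>\<^bsub>M\<lparr>carrier := U\<rparr>\<^esub> x \<in> carrier (M\<lparr>carrier := U\<rparr>)"
    "e (r \<odot>\<^bsub>M\<lparr>carrier := U\<rparr>\<^esub> x) = r *\<^sub>R e x"
    using assms(2,4) by (simp_all add: closed e_smult subspace_scale)
qed (use assms in \<open>auto simp: e_zero\<close>)

lemma submoduleI: assumes "U \<subseteq> carrier M" "\<zero>\<^bsub>M\<^esub> \<in> U"
    "\<And>x y r s. x \<in> U \<Longrightarrow> y \<in> U \<Longrightarrow> r \<odot>\<^bsub>M\<^esub> x \<oplus>\<^bsub>M\<^esub> s \<odot>\<^bsub>M\<^esub> y \<in> U"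
  shows "submodule U real_ring M"
proof -
  interpret module real_ring M by (rule module)
  have smult: "r \<odot>\<^bsub>M\<^esub> x \<in> U" if "x \<in> U" for r x
  proof -
    have "r \<odot>\<^bsub>M\<^esub> x \<oplus>\<^bsub>M\<^esub> 0 \<odot>\<^bsub>M\<^esub> x = r \<odot>\<^bsub>M\<^esub> x"
      using that assms(1) by (simp add: subset_iff e_eq_iff[symmetric] closed e_add e_smult)
    then show ?thesis using assms(3)[OF that that, of r 0] by simp
  qed
  show ?thesis
  proof (rule submoduleI)
    fix x assume x: "x \<in> U"
    have "\<ominus>\<^bsub>M\<^esub> x = (-1) \<odot>\<^bsub>M\<^esub> x"
      using x assms(1) by (simp add: subset_iff e_eq_iff[symmetric] closed e_uminus e_smult)
    then show "\<ominus>\<^bsub>M\<^esub> x \<in> U" using smult[OF x] by simp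
  next
    fix x y assume xy: "x \<in> U" "y \<in> U"
    have "1 \<odot>\<^bsub>M\<^esub> x \<oplus>\<^bsub>M\<^esub> 1 \<odot>\<^bsub>M\<^esub> y = x \<oplus>\<^bsub>M\<^esub> y"
      using xy assms(1) by (simp add: subset_iff e_eq_iff[symmetric] closed e_add e_smult)
    then show "x \<oplus>\<^bsub>M\<^esub> y \<in> U" using assms(3)[OF xy, of 1 1] by simp
  qed (use assms smult in auto)
qed

end

lemma linear_mapsD:
  assumes "D \<in> linear_maps M N"
  shows "x \<in> carrier M \<Longrightarrow> D x \<in> carrier N"
    and "x \<in> carrier M \<Longrightarrow> y \<in> carrier M \<Longrightarrow>
      D (r \<odot>\<^bsub>M\<^esub> x \<oplus>\<^bsub>M\<^esub> s \<odot>\<^bsub>M\<^esub> y) = r \<odot>\<^bsub>N\<^esub> D x \<oplus>\<^bsub>N\<^esub> s \<odot>\<^bsub>N\<^esub> D y"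
  using assms by (auto simp: linear_maps_def)

text \<open>
  In contrast to \<^const>\<open>linear_maps\<close>, the map need not be extensional outside the carrier, so
  that restrictions to submodules remain instances.
\<close>

definition linear_between :: "(real, 'a) module \<Rightarrow> (real, 'b) module \<Rightarrow> ('a \<Rightarrow> 'b) \<Rightarrow> bool" where
  "linear_between M N f \<longleftrightarrow> f ` carrier M \<subseteq> carrier N \<and>
     (\<forall>x\<in>carrier M. \<forall>y\<in>carrier M. \<forall>r s.
       f (r \<odot>\<^bsub>M\<^esub> x \<oplus>\<^bsub>M\<^esub> s \<odot>\<^bsub>M\<^esub> y) = r \<odot>\<^bsub>N\<^esub> f x \<oplus>\<^bsub>N\<^esub> s \<odot>\<^bsub>N\<^esub> f y)"

lemma linear_betweenD:
  assumes "linear_between M N D"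
  shows "x \<in> carrier M \<Longrightarrow> D x \<in> carrier N"
    and "x \<in> carrier M \<Longrightarrow> y \<in> carrier M \<Longrightarrow>
      D (r \<odot>\<^bsub>M\<^esub> x \<oplus>\<^bsub>M\<^esub> s \<odot>\<^bsub>M\<^esub> y) = r \<odot>\<^bsub>N\<^esub> D x \<oplus>\<^bsub>N\<^esub> s \<odot>\<^bsub>N\<^esub> D y"
  using assms by (auto simp: linear_between_def)

lemma linear_maps_linear_between: "D \<in> linear_maps M N \<Longrightarrow> linear_between M N D"
  by (auto simp: linear_between_def linear_mapsD)

locale lin_coords_pair = M: lin_coords M S e + N: lin_coords N S' e'
  for M :: "(real, 'a) module" and S :: "'b::real_vector set" and e
    and N :: "(real, 'c) module" and S' :: "'d::real_vector set" and e'
begin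

lemma linear_zero: assumes "linear_between M N D" shows "D \<zero>\<^bsub>M\<^esub> = \<zero>\<^bsub>N\<^esub>"
proof -
  have "0 \<odot>\<^bsub>M\<^esub> \<zero>\<^bsub>M\<^esub> \<oplus>\<^bsub>M\<^esub> 0 \<odot>\<^bsub>M\<^esub> \<zero>\<^bsub>M\<^esub> = \<zero>\<^bsub>M\<^esub>"
    by (simp add: M.e_eq_iff[symmetric] M.closed M.e_add M.e_smult M.e_zero)
  then have "D \<zero>\<^bsub>M\<^esub> = 0 \<odot>\<^bsub>N\<^esub> D \<zero>\<^bsub>M\<^esub> \<oplus>\<^bsub>N\<^esub> 0 \<odot>\<^bsub>N\<^esub> D \<zero>\<^bsub>M\<^esub>"
    using linear_betweenD(2)[OF assms M.zero_closed M.zero_closed, of 0 0] by simp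
  also have "\<dots> = \<zero>\<^bsub>N\<^esub>"
    using linear_betweenD(1)[OF assms M.zero_closed]
    by (simp add: N.e_eq_iff[symmetric] N.closed N.e_add N.e_smult N.e_zero)
  finally show ?thesis .
qed

lemma linear_minus:
  assumes "linear_between M N D" "x \<in> carrier M" "y \<in> carrier M"
  shows "D (x \<ominus>\<^bsub>M\<^esub> y) = D x \<ominus>\<^bsub>N\<^esub> D y"
proof -
  interpret M': module real_ring M by (rule M.module)
  interpret N': module real_ring N by (rule N.module)
  have "x \<ominus>\<^bsub>M\<^esub> y = 1 \<odot>\<^bsub>M\<^esub> x \<oplus>\<^bsub>M\<^esub> (-1) \<odot>\<^bsub>M\<^esub> y"
    using assms(2,3)
    by (simp add: M.e_eq_iff[symmetric] M.closed M.e_add M.e_smult M.e_zero M.e_minus)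
  moreover have "D x \<ominus>\<^bsub>N\<^esub> D y = 1 \<odot>\<^bsub>N\<^esub> D x \<oplus>\<^bsub>N\<^esub> (-1) \<odot>\<^bsub>N\<^esub> D y"
    using assms(2,3) linear_betweenD(1)[OF assms(1)]
    by (simp add: N.e_eq_iff[symmetric] N.closed N.e_add N.e_smult N.e_zero N.e_minus)
  ultimately show ?thesis using linear_betweenD(2)[OF assms, of 1 "-1"] by simp
qed

lemma lin_on_coords:
  assumes "linear_between M N D"
  shows "lin_on S (\<lambda>v. e' (D (M.e_inv v)))"
  unfolding lin_on_def
proof (intro ballI allI)
  fix v w r s assume vw: "v \<in> S" "w \<in> S"
  let ?x = "M.e_inv v" and ?y = "M.e_inv w"
  have xy: "?x \<in> carrier M" "?y \<in> carrier M" using vw by (simp_all add: M.e_inv_closed)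
  have "M.e_inv (r *\<^sub>R v + s *\<^sub>R w) = M.e_inv (e (r \<odot>\<^bsub>M\<^esub> ?x \<oplus>\<^bsub>M\<^esub> s \<odot>\<^bsub>M\<^esub> ?y))"
    using vw xy by (simp add: M.e_add M.e_smult M.smult_closed M.e_e_inv)
  also have "\<dots> = r \<odot>\<^bsub>M\<^esub> ?x \<oplus>\<^bsub>M\<^esub> s \<odot>\<^bsub>M\<^esub> ?y"
    using xy by (intro M.e_inv_e) (simp add: M.add_closed M.smult_closed)
  finally have "D (M.e_inv (r *\<^sub>R v + s *\<^sub>R w)) = r \<odot>\<^bsub>N\<^esub> D ?x \<oplus>\<^bsub>N\<^esub> s \<odot>\<^bsub>N\<^esub> D ?y"
    using linear_betweenD(2)[OF assms xy] by simp
  then show "e' (D (M.e_inv (r *\<^sub>R v + s *\<^sub>R w))) = r *\<^sub>R e' (D ?x) + s *\<^sub>R e' (D ?y)"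
    using linear_betweenD(1)[OF assms] xy by (simp add: N.e_add N.e_smult N.smult_closed)
qed

lemma linear_between_coords:
  assumes "lin_on S f" "f ` S \<subseteq> S'"
  shows "linear_between M N (\<lambda>x. N.e_inv (f (e x)))"
proof -
  have fe: "f (e x) \<in> S'" if "x \<in> carrier M" for x using that assms(2) M.e_closed by blast
  show ?thesis
    unfolding linear_between_def
  proof (intro conjI ballI allI)
    show "(\<lambda>x. N.e_inv (f (e x))) ` carrier M \<subseteq> carrier N"
      using fe N.e_inv_closed by blast
    fix x y r s assume xy: "x \<in> carrier M" "y \<in> carrier M"
    have c: "N.e_inv (f (e x)) \<in> carrier N" "N.e_inv (f (e y)) \<in> carrier N"
      using xy fe N.e_inv_closed by auto
    have "f (e (r \<odot>\<^bsub>M\<^esub> x \<oplus>\<^bsub>M\<^esub> s \<odot>\<^bsub>M\<^esub> y)) = r *\<^sub>R f (e x) + s *\<^sub>R f (e y)"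
      using xy by (simp add: M.e_add M.e_smult M.smult_closed M.e_closed lin_onD[OF assms(1)])
    also have "\<dots> = e' (r \<odot>\<^bsub>N\<^esub> N.e_inv (f (e x)) \<oplus>\<^bsub>N\<^esub> s \<odot>\<^bsub>N\<^esub> N.e_inv (f (e y)))"
      using c by (simp add: N.e_add N.e_smult N.smult_closed N.e_e_inv fe xy)
    finally show "N.e_inv (f (e (r \<odot>\<^bsub>M\<^esub> x \<oplus>\<^bsub>M\<^esub> s \<odot>\<^bsub>M\<^esub> y))) =
        r \<odot>\<^bsub>N\<^esub> N.e_inv (f (e x)) \<oplus>\<^bsub>N\<^esub> s \<odot>\<^bsub>N\<^esub> N.e_inv (f (e y))"
      using c by (simp only: N.e_inv_e N.add_closed N.smult_closed)
  qed
qed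

lemma submodule_kernel:
  assumes "linear_between M N D"
  shows "submodule (a_kernel M N D) real_ring M"
proof (rule M.submoduleI)
  show "\<zero>\<^bsub>M\<^esub> \<in> a_kernel M N D"
    by (simp add: a_kernel_def' M.zero_closed linear_zero[OF assms])
next
  fix x y r s assume "x \<in> a_kernel M N D" "y \<in> a_kernel M N D"
  then show "r \<odot>\<^bsub>M\<^esub> x \<oplus>\<^bsub>M\<^esub> s \<odot>\<^bsub>M\<^esub> y \<in> a_kernel M N D"
    by (simp add: a_kernel_def' M.closed linear_betweenD(2)[OF assms]
        N.e_eq_iff[symmetric] N.closed N.e_add N.e_smult N.e_zero)
qed (auto simp: a_kernel_def')

lemma submodule_image:
  assumes "linear_between M N D"
  shows "submodule (D ` carrier M) real_ring N"
proof (rule N.submoduleI)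
  show "D ` carrier M \<subseteq> carrier N" using linear_betweenD(1)[OF assms] by blast
  show "\<zero>\<^bsub>N\<^esub> \<in> D ` carrier M"
    using linear_zero[OF assms] M.zero_closed by (metis imageI)
next
  fix x y r s assume "x \<in> D ` carrier M" "y \<in> D ` carrier M"
  then obtain u v where "u \<in> carrier M" "v \<in> carrier M" "x = D u" "y = D v" by blast
  then have "r \<odot>\<^bsub>N\<^esub> x \<oplus>\<^bsub>N\<^esub> s \<odot>\<^bsub>N\<^esub> y = D (r \<odot>\<^bsub>M\<^esub> u \<oplus>\<^bsub>M\<^esub> s \<odot>\<^bsub>M\<^esub> v)"
    by (simp add: linear_betweenD(2)[OF assms])
  then show "r \<odot>\<^bsub>N\<^esub> x \<oplus>\<^bsub>N\<^esub> s \<odot>\<^bsub>N\<^esub> y \<in> D ` carrier M"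
    using \<open>u \<in> carrier M\<close> \<open>v \<in> carrier M\<close> by (simp add: M.closed)
qed

end

text \<open>
  The linear algebra behind the theorem.  For \<open>R = im D'\<close>, disjointness makes \<open>D' \<circ> D\<close> injective
  on \<open>R\<close>, hence onto \<open>R\<close>.  For every \<open>z\<close> there is therefore \<open>x \<in> R\<close> with \<open>D' (D x) = D' (D z)\<close>,
  and then \<open>z - x \<in> ker D\<close>, again by disjointness.  The other splitting results from exchanging
  \<open>D\<close> and \<open>D'\<close>.
\<close>

lemma complementary_image_kernel:
  assumes coords: "lin_coords M S e" "lin_coords N S' e'" and fin: "fin_gen S"
    and D: "linear_between M N D" and D': "linear_between N M D'"
    and disj: "D' ` carrier N \<inter> a_kernel M N D = {\<zero>\<^bsub>M\<^esub>}"
    and disj': "D ` carrier M \<inter> a_kernel N M D' = {\<zero>\<^bsub>N\<^esub>}"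
  shows "complementary M (D' ` carrier N) (a_kernel M N D)"
proof -
  interpret M: lin_coords M S e by fact
  interpret N: lin_coords N S' e' by fact
  interpret MN: lin_coords_pair M S e N S' e' using coords by (rule lin_coords_pair.intro)
  interpret NM: lin_coords_pair N S' e' M S e using coords(2,1) by (rule lin_coords_pair.intro)
  interpret M': module real_ring M by (rule M.module)
  interpret N': module real_ring N by (rule N.module)
  note Dc = linear_betweenD(1)[OF D] and D'c = linear_betweenD(1)[OF D']
  define T where "T x = D' (D x)" for x
  define R where "R = D' ` carrier N"
  have subR: "submodule R real_ring M"
    unfolding R_def by (rule NM.submodule_image[OF D'])
  have RM: "R \<subseteq> carrier M" using D'c by (auto simp: R_def)
  have Tlin: "T (r \<odot>\<^bsub>M\<^esub> x \<oplus>\<^bsub>M\<^esub> s \<odot>\<^bsub>M\<^esub> y) = r \<odot>\<^bsub>M\<^esub> T x \<oplus>\<^bsub>M\<^esub> s \<odot>\<^bsub>M\<^esub> T y"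
    if "x \<in> carrier M" "y \<in> carrier M" for x y r s
    using that by (simp add: T_def linear_betweenD[OF D] linear_betweenD[OF D'])
  have T_ker: "D x = \<zero>\<^bsub>N\<^esub>" if "x \<in> carrier M" "T x = \<zero>\<^bsub>M\<^esub>" for x
    using that disj' Dc by (auto simp: T_def a_kernel_def')
  have Tminus: "T (x \<ominus>\<^bsub>M\<^esub> y) = T x \<ominus>\<^bsub>M\<^esub> T y" if "x \<in> carrier M" "y \<in> carrier M" for x y
    using that by (simp add: T_def MN.linear_minus[OF D] NM.linear_minus[OF D'] Dc)
  have diffR: "x \<ominus>\<^bsub>M\<^esub> y \<in> R" if "x \<in> R" "y \<in> R" for x y
    using that M'.submoduleE(3,5)[OF subR] by (simp add: a_minus_def)
  have Tinj: "x = y" if "x \<in> R" "y \<in> R" "T x = T y" for x y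
  proof -
    have xy: "x \<in> carrier M" "y \<in> carrier M" using that RM by auto
    have Txy: "T x \<in> carrier M" using xy by (simp add: T_def Dc D'c)
    have "T (x \<ominus>\<^bsub>M\<^esub> y) = \<zero>\<^bsub>M\<^esub>" using Tminus[OF xy] that(3) Txy by (simp add: M'.r_neg a_minus_def)
    then have "D (x \<ominus>\<^bsub>M\<^esub> y) = \<zero>\<^bsub>N\<^esub>" using T_ker xy by simp
    then have "x \<ominus>\<^bsub>M\<^esub> y = \<zero>\<^bsub>M\<^esub>"
      using diffR[OF that(1,2)] disj xy unfolding R_def a_kernel_def' by auto
    then have "e x - e y = 0" using M.e_minus[OF xy] M.e_zero by simp
    then show ?thesis using xy by (simp add: M.e_eq_iff)
  qed
  \<comment> \<open>finite dimension enters here, through the coordinates of \<open>R\<close>\<close>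
  have TR: "T ` R = R"
  proof -
    define A where "A = e ` R"
    define f where "f v = e (T (inv_into (carrier M) e v))" for v
    have f_e: "f (e x) = e (T x)" if "x \<in> carrier M" for x
      using M.bij that by (simp add: f_def bij_betw_inv_into_left)
    have comb: "r \<odot>\<^bsub>M\<^esub> x \<oplus>\<^bsub>M\<^esub> s \<odot>\<^bsub>M\<^esub> y \<in> R" if "x \<in> R" "y \<in> R" for x y r s
      using that M'.submoduleE(4,5)[OF subR] by simp
    have e_comb: "e (r \<odot>\<^bsub>M\<^esub> x \<oplus>\<^bsub>M\<^esub> s \<odot>\<^bsub>M\<^esub> y) = r *\<^sub>R e x + s *\<^sub>R e y"
      if "x \<in> carrier M" "y \<in> carrier M" for x y r s
      using that by (simp add: M.closed M.e_add M.e_smult)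
    have "A = f ` A"
    proof (rule fin_gen_inj_surj[symmetric])
      show "subspace A"
      proof (rule subspaceI)
        have "\<zero>\<^bsub>M\<^esub> \<in> R"
          using disj unfolding R_def by blast
        then show "0 \<in> A" unfolding A_def using M.e_zero by (metis imageI)
      next
        fix x y assume "x \<in> A" "y \<in> A"
        then obtain u v where "u \<in> R" "v \<in> R" "x = e u" "y = e v" by (auto simp: A_def)
        then have "x + y = e (1 \<odot>\<^bsub>M\<^esub> u \<oplus>\<^bsub>M\<^esub> 1 \<odot>\<^bsub>M\<^esub> v)"
          using e_comb[of u v 1 1] RM by (simp add: subset_iff)
        then show "x + y \<in> A"
          using comb[OF \<open>u \<in> R\<close> \<open>v \<in> R\<close>] by (simp add: A_def)
      next
        fix r x assume "x \<in> A"
        then obtain u where "u \<in> R" "x = e u" by (auto simp: A_def)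
        then have "r *\<^sub>R x = e (r \<odot>\<^bsub>M\<^esub> u \<oplus>\<^bsub>M\<^esub> 0 \<odot>\<^bsub>M\<^esub> u)"
          using e_comb[of u u r 0] RM by (simp add: subset_iff)
        then show "r *\<^sub>R x \<in> A"
          using comb[OF \<open>u \<in> R\<close> \<open>u \<in> R\<close>] by (simp add: A_def)
      qed
      show "fin_gen A"
        using fin by (rule fin_gen_subset) (use RM M.e_closed in \<open>auto simp: A_def\<close>)
      show "lin_on A f"
        unfolding lin_on_def
      proof (intro ballI allI)
        fix x y r s assume "x \<in> A" "y \<in> A"
        then obtain u v where uv: "u \<in> carrier M" "v \<in> carrier M" "x = e u" "y = e v"
          using RM by (auto simp: A_def)
        have "f (r *\<^sub>R x + s *\<^sub>R y) = f (e (r \<odot>\<^bsub>M\<^esub> u \<oplus>\<^bsub>M\<^esub> s \<odot>\<^bsub>M\<^esub> v))"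
          using uv by (simp add: e_comb)
        also have "\<dots> = e (r \<odot>\<^bsub>M\<^esub> T u \<oplus>\<^bsub>M\<^esub> s \<odot>\<^bsub>M\<^esub> T v)"
          using uv by (simp add: f_e Tlin M.closed)
        also have "\<dots> = r *\<^sub>R f x + s *\<^sub>R f y"
          using uv by (subst e_comb) (simp_all add: f_e T_def Dc D'c)
        finally show "f (r *\<^sub>R x + s *\<^sub>R y) = r *\<^sub>R f x + s *\<^sub>R f y" .
      qed
      show "f ` A \<subseteq> A"
        using RM f_e Dc unfolding A_def T_def R_def by (auto simp: subset_iff)
      show "inj_on f A"
      proof (rule inj_onI)
        fix x y assume "x \<in> A" "y \<in> A" "f x = f y"
        moreover then obtain u v where uv: "u \<in> R" "v \<in> R" "x = e u" "y = e v"
          by (auto simp: A_def)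
        ultimately have "T u = T v"
          using RM by (simp add: f_e subset_iff M.e_eq_iff T_def Dc D'c)
        then show "x = y" using Tinj uv by blast
      qed
    qed
    also have "f ` A = e ` (T ` R)"
      unfolding A_def image_image using f_e RM by (auto intro!: image_cong)
    finally have eq: "e ` (T ` R) = e ` R" by (simp only: A_def)
    have "T ` R \<subseteq> carrier M" using RM Dc D'c by (auto simp: T_def)
    moreover have "inj_on e (carrier M)" using M.bij by (simp add: bij_betw_def)
    ultimately show ?thesis using inj_on_image_eq_iff[of e "carrier M" "T ` R" R] RM eq by metis
  qed
  have ker: "submodule (a_kernel M N D) real_ring M" by (rule MN.submodule_kernel[OF D])
  have "z \<in> R <+>\<^bsub>M\<^esub> a_kernel M N D" if z: "z \<in> carrier M" for z
  proof -
    have "T z \<in> R" using z Dc by (auto simp: T_def R_def)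
    then obtain x where x: "x \<in> R" "T x = T z" using TR by (metis imageE)
    have xM: "x \<in> carrier M" using x RM by auto
    have "T z \<in> carrier M" using z by (simp add: T_def Dc D'c)
    then have "T z \<ominus>\<^bsub>M\<^esub> T z = \<zero>\<^bsub>M\<^esub>"
      by (simp add: a_minus_def M'.r_neg)
    then have "T (z \<ominus>\<^bsub>M\<^esub> x) = \<zero>\<^bsub>M\<^esub>"
      using Tminus[OF z xM] x(2) by simp
    then have "z \<ominus>\<^bsub>M\<^esub> x \<in> a_kernel M N D"
      using T_ker[of "z \<ominus>\<^bsub>M\<^esub> x"] z xM by (simp add: a_kernel_def')
    moreover have "z = x \<oplus>\<^bsub>M\<^esub> (z \<ominus>\<^bsub>M\<^esub> x)"
      using z xM by (simp add: M.e_eq_iff[symmetric] M.closed M.e_add M.e_minus)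
    ultimately show ?thesis using x(1) unfolding set_add_def' by blast
  qed
  moreover have "R <+>\<^bsub>M\<^esub> a_kernel M N D \<subseteq> carrier M"
    using RM M.closed by (auto simp: set_add_def' a_kernel_def')
  ultimately show ?thesis
    unfolding complementary_def using subR ker disj by (auto simp: R_def)
qed

lemma linear_between_restrict:
  assumes "linear_between M N D" "U \<subseteq> carrier M" "D ` U \<subseteq> U'"
  shows "linear_between (M\<lparr>carrier := U\<rparr>) (N\<lparr>carrier := U'\<rparr>) D"
  using assms unfolding linear_between_def by (auto simp: subset_iff)

lemma complementary_commute:
  assumes "lin_coords M S e" "complementary M U W"
  shows "complementary M W U"
proof -
  interpret M: lin_coords M S e by fact
  interpret M': module real_ring M by (rule M.module)
  have "W <+>\<^bsub>M\<^esub> U = U <+>\<^bsub>M\<^esub> W"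
  proof -
    have "U \<subseteq> carrier M" "W \<subseteq> carrier M"
      using assms(2) M'.submoduleE(1) by (auto simp: complementary_def)
    then have "x \<oplus>\<^bsub>M\<^esub> y = y \<oplus>\<^bsub>M\<^esub> x" if "x \<in> U" "y \<in> W" for x y
      using that by (intro M'.a_comm) auto
    then show ?thesis unfolding set_add_def' by fastforce
  qed
  then show ?thesis using assms(2) by (auto simp: complementary_def)
qed

section \<open>Splitting of the filtration\<close>

lemma (in filtered_lie_algebra) fil_antimono: "i \<le> j \<Longrightarrow> fil \<gg> j \<subseteq> fil \<gg> i"
proof (induction rule: int_ge_induct)
  case (step j)
  then show ?case using fil_decreasing[of j] by blast
qed simp

text \<open>
  A basis of the Lie algebra containing a basis of each filtration component, obtained by
  descending through the filtration and extending the basis found so far.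
\<close>

lemma (in filtered_lie_algebra) adapted_basis:
  obtains B where "finite B" "independent B" "\<And>i. span (B \<inter> fil \<gg> i) = fil \<gg> i"
proof -
  let ?h = "int (height \<gg>) + 1"
  have "\<exists>B. B \<subseteq> fil \<gg> (?h - int n) \<and> independent B \<and> (\<forall>j\<ge>?h - int n. fil \<gg> j \<subseteq> span (B \<inter> fil \<gg> j))"
    for n
  proof (induction n)
    case 0
    show ?case using fil_top by (intro exI[of _ "{}"]) (auto simp: independent_empty)
  next
    case (Suc n)
    then obtain B where B: "B \<subseteq> fil \<gg> (?h - int n)" "independent B"
      "\<And>j. j \<ge> ?h - int n \<Longrightarrow> fil \<gg> j \<subseteq> span (B \<inter> fil \<gg> j)" by blast
    have "B \<subseteq> fil \<gg> (?h - int (Suc n))"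
      using B(1) fil_antimono[of "?h - int (Suc n)" "?h - int n"] by auto
    from maximal_independent_subset_extend[OF this B(2)] obtain C where C: "B \<subseteq> C"
      "C \<subseteq> fil \<gg> (?h - int (Suc n))" "independent C" "fil \<gg> (?h - int (Suc n)) \<subseteq> span C"
      by blast
    have "fil \<gg> j \<subseteq> span (C \<inter> fil \<gg> j)" if "j \<ge> ?h - int (Suc n)" for j
    proof (cases "j \<ge> ?h - int n")
      case True
      then show ?thesis using B(3) C(1) span_mono[of "B \<inter> fil \<gg> j" "C \<inter> fil \<gg> j"] by blast
    next
      case False
      then have "j = ?h - int (Suc n)" using that by simp
      then show ?thesis using C(2,4) by (simp add: inf.absorb1)
    qed
    then show ?case using C(2,3) by blast
  qed
  from this[of "height \<gg> + 1 + depth \<gg>"] obtain B where B: "independent B"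
    "\<And>j. j \<ge> - int (depth \<gg>) \<Longrightarrow> fil \<gg> j \<subseteq> span (B \<inter> fil \<gg> j)" by auto
  have "span (B \<inter> fil \<gg> i) = fil \<gg> i" for i
  proof
    show "span (B \<inter> fil \<gg> i) \<subseteq> fil \<gg> i" by (rule span_minimal) (auto simp: fil_subspace)
    show "fil \<gg> i \<subseteq> span (B \<inter> fil \<gg> i)"
    proof (cases "i \<ge> - int (depth \<gg>)")
      case False
      then show ?thesis using B(2)[of "- int (depth \<gg>)"] by (simp add: fil_bottom)
    qed (rule B(2))
  qed
  moreover have "finite B"
  proof -
    obtain K :: "'g set" where "finite K" "span K = UNIV" using finite_dim by blast
    then show ?thesis using independent_span_bound[of K B] B(1) by blast
  qed
  ultimately show ?thesis using B(1) that by blast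
qed

text \<open>
  Projections onto the components of a vector space grading that induces the filtration:
  \<open>fil \<gg> i\<close> is the sum of the components of degree at least \<open>i\<close>.  Compatibility with the bracket
  is not required.
\<close>

locale graded_splitting = filtered_lie_algebra \<gg> for \<gg> :: "'g::real_normed_vector filtered_lie" +
  fixes pr :: "int \<Rightarrow> 'g \<Rightarrow> 'g"
  assumes pr_linear: "linear (pr i)"
    and pr_pr: "pr i (pr j x) = (if i = j then pr i x else 0)"
    and fil_iff: "x \<in> fil \<gg> i \<longleftrightarrow> (\<forall>j<i. pr j x = 0)"
    and pr_sum: "(\<Sum>i\<in>{- int (depth \<gg>)..int (height \<gg>)}. pr i x) = x"

lemma (in filtered_lie_algebra) graded_splitting_exists:
  obtains pr where "graded_splitting \<gg> pr"
proof -
  obtain B where B: "finite B" "independent B" "\<And>i. span (B \<inter> fil \<gg> i) = fil \<gg> i"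
    using adapted_basis by blast
  have span_B: "x \<in> span B" for x
    using B(3)[of "- int (depth \<gg>)"] by (simp add: fil_bottom)
  \<comment> \<open>the basis vectors of degree exactly \<open>i\<close>, and the projection onto their span\<close>
  define Bi where "Bi i = B \<inter> fil \<gg> i - fil \<gg> (i + 1)" for i
  define pr where "pr i x = (\<Sum>b\<in>Bi i. representation B x b *\<^sub>R b)" for i x
  have fin: "finite (Bi i)" for i using B(1) by (simp add: Bi_def)
  have disj: "Bi i \<inter> Bi j = {}" if "i \<noteq> j" for i j
    using that
  proof (induction i j rule: linorder_wlog)
    case (le i j)
    then show ?case using fil_antimono[of "i + 1" j] by (auto simp: Bi_def)
  qed auto
  have union: "(\<Union>i\<in>{- int (depth \<gg>)..int (height \<gg>)}. Bi i) = B"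
  proof
    show "B \<subseteq> (\<Union>i\<in>{- int (depth \<gg>)..int (height \<gg>)}. Bi i)"
    proof
      fix b assume b: "b \<in> B"
      show "b \<in> (\<Union>i\<in>{- int (depth \<gg>)..int (height \<gg>)}. Bi i)"
      proof (rule ccontr)
        assume *: "\<not> ?thesis"
        have "i \<le> int (height \<gg>) + 1 \<longrightarrow> b \<in> fil \<gg> i" if "- int (depth \<gg>) \<le> i" for i
          using that
        proof (induction rule: int_ge_induct)
          case base
          then show ?case by (simp add: fil_bottom)
        next
          case (step i)
          then show ?case using * b by (auto simp: Bi_def)
        qed
        then have "b \<in> fil \<gg> (int (height \<gg>) + 1)" by simp
        then have "b = 0" using fil_top[of "int (height \<gg>) + 1"] by simp
        then show False using b B(2) dependent_zero by blast
      qed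
    qed
  qed (auto simp: Bi_def)
  have rep_pr: "representation B (pr i x) b = (if b \<in> Bi i then representation B x b else 0)" for i x b
  proof -
    have "representation B (pr i x) b = (\<Sum>c\<in>Bi i. if c = b then representation B x c else 0)"
      unfolding pr_def
      by (subst representation_sum[OF B(2)])
        (auto simp: span_B representation_scale[OF B(2)] representation_basis[OF B(2)] Bi_def
          intro!: sum.cong)
    then show ?thesis using fin[of i] by simp
  qed
  have pr_fil: "pr i x \<in> fil \<gg> i" for i x
    unfolding pr_def using fil_subspace[of i]
    by (intro subspace_sum subspace_scale) (auto simp: Bi_def)
  have sum: "(\<Sum>i\<in>{- int (depth \<gg>)..int (height \<gg>)}. pr i x) = x" for x
  proof -
    have "(\<Sum>i\<in>{- int (depth \<gg>)..int (height \<gg>)}. pr i x) = (\<Sum>b\<in>B. representation B x b *\<^sub>R b)"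
      unfolding pr_def using disj fin by (subst union[symmetric], subst sum.UNION_disjoint) auto
    then show ?thesis using sum_representation_eq[OF B(2) span_B B(1)] by simp
  qed
  have "graded_splitting \<gg> pr"
  proof (rule graded_splitting.intro[OF filtered_lie_algebra_axioms], rule graded_splitting_axioms.intro)
    show "linear (pr i)" for i
      unfolding pr_def
      by (rule linearI) (simp_all add: representation_add[OF B(2)] representation_scale[OF B(2)]
          span_B sum.distrib scaleR_add_left scaleR_sum_right)
    show "pr i (pr j x) = (if i = j then pr i x else 0)" for i j x
    proof -
      have "pr i (pr j x) = (\<Sum>b\<in>Bi i. (if b \<in> Bi j then representation B x b else 0) *\<^sub>R b)"
        by (subst pr_def) (simp add: rep_pr)
      moreover have "b \<in> Bi j \<longleftrightarrow> i = j" if "b \<in> Bi i" for b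
        using that disj[of i j] by auto
      ultimately show ?thesis by (simp add: pr_def)
    qed
    show "x \<in> fil \<gg> i \<longleftrightarrow> (\<forall>j<i. pr j x = 0)" for x i
    proof
      assume "x \<in> fil \<gg> i"
      then have x: "x \<in> span (B \<inter> fil \<gg> i)" using B(3) by simp
      have "representation B x b = 0" if "b \<in> Bi j" "j < i" for b j
      proof -
        have "representation B x = representation (B \<inter> fil \<gg> i) x"
          by (rule representation_extend[OF B(2) x]) simp
        moreover have "b \<notin> fil \<gg> i" using that fil_antimono[of "j + 1" i] by (auto simp: Bi_def)
        ultimately show ?thesis using representation_ne_zero[of "B \<inter> fil \<gg> i" x b] by auto
      qed
      then show "\<forall>j<i. pr j x = 0" by (auto simp: pr_def intro!: sum.neutral)
    next
      assume *: "\<forall>j<i. pr j x = 0"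
      have "pr j x \<in> fil \<gg> i" for j
        using * pr_fil[of j x] fil_antimono[of i j] subspace_0[OF fil_subspace[of i]]
        by (cases "j < i") auto
      then have "(\<Sum>j\<in>{- int (depth \<gg>)..int (height \<gg>)}. pr j x) \<in> fil \<gg> i"
        by (intro subspace_sum fil_subspace)
      then show "x \<in> fil \<gg> i" by (simp add: sum)
    qed
    show "(\<Sum>i\<in>{- int (depth \<gg>)..int (height \<gg>)}. pr i x) = x" for x by (rule sum)
  qed
  then show ?thesis using that by blast
qed

section \<open>Cosets and quotient spaces\<close>

lemma coset_mem: "subspace W \<Longrightarrow> x \<in> x +o W"
  by (force simp: elt_set_plus_def subspace_0)

lemma coset_eq_iff: assumes "subspace (W::'a::real_vector set)"
  shows "x +o W = y +o W \<longleftrightarrow> x - y \<in> W"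
proof
  assume "x +o W = y +o W"
  then have "x \<in> y +o W" using coset_mem[OF assms, of x] by simp
  then show "x - y \<in> W" by (auto simp: elt_set_plus_def)
next
  assume *: "x - y \<in> W"
  have sub: "x +o W \<subseteq> y +o W" if "x - y \<in> W" for x y
  proof
    fix z assume "z \<in> x +o W"
    then obtain w where "w \<in> W" "z = x + w" by (auto simp: elt_set_plus_def)
    then show "z \<in> y +o W"
      using subspace_add[OF assms that, of w]
      by (auto simp: elt_set_plus_def intro!: bexI[of _ "x - y + w"])
  qed
  show "x +o W = y +o W"
    using sub[OF *] sub[of y x] subspace_neg[OF assms *] by simp
qed

lemma coset_add: assumes "subspace (W::'a::real_vector set)"
  shows "(x +o W) + (y +o W) = (x + y) +o W"
proof -
  have "W + W = W"
    using assms subspace_0[OF assms] by (force simp: set_plus_def subspace_add)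
  then show ?thesis by (simp add: set_plus_rearrange)
qed

lemma coset_scale: assumes "subspace (W::'a::real_vector set)"
  shows "(*\<^sub>R) r ` (x +o W) + W = (r *\<^sub>R x) +o W"
proof (intro subset_antisym subsetI)
  fix z assume "z \<in> (*\<^sub>R) r ` (x +o W) + W"
  then obtain v w where "v \<in> W" "w \<in> W" "z = r *\<^sub>R (x + v) + w"
    by (auto simp: set_plus_def elt_set_plus_def)
  then show "z \<in> (r *\<^sub>R x) +o W"
    using assms by (auto simp: elt_set_plus_def scaleR_add_right add.assoc subspace_add subspace_scale
        intro!: bexI[of _ "r *\<^sub>R v + w"])
next
  fix z assume "z \<in> (r *\<^sub>R x) +o W"
  then obtain w where "w \<in> W" "z = r *\<^sub>R x + w" by (auto simp: elt_set_plus_def)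
  then show "z \<in> (*\<^sub>R) r ` (x +o W) + W"
    using set_plus_intro[OF imageI[OF coset_mem[OF assms, of x], of "(*\<^sub>R) r"]] by simp
qed

lemma coset_zero: "subspace W \<Longrightarrow> x \<in> W \<Longrightarrow> x +o W = (W::'a::real_vector set)"
  using coset_eq_iff[of W x 0] by simp

lemma quot_space_simps [simp]:
  "\<zero>\<^bsub>quot_space V W\<^esub> = W" "A \<oplus>\<^bsub>quot_space V W\<^esub> B = A + B"
  "r \<odot>\<^bsub>quot_space V W\<^esub> A = (*\<^sub>R) r ` A + W"
  "carrier (quot_space V W) = {x +o W | x. x \<in> V}"
  by (simp_all add: quot_space_def)

lemma type_space_simps [simp]:
  "\<zero>\<^bsub>type_space\<^esub> = 0" "x \<oplus>\<^bsub>type_space\<^esub> y = x + y" "r \<odot>\<^bsub>type_space\<^esub> x = r *\<^sub>R x"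
  "carrier type_space = UNIV"
  by (simp_all add: type_space_def)

lemma lin_coords_type_space: "lin_coords type_space UNIV id"
  by unfold_locales auto

section \<open>Coordinates on the associated graded space\<close>

context graded_splitting
begin

text \<open>The degrees that can occur in the grading.\<close>

definition degs :: "int set" where "degs = {- int (depth \<gg>)..int (height \<gg>)}"

lemma finite_degs [simp]: "finite degs" by (simp add: degs_def)

lemma pr_sum_degs: "(\<Sum>i\<in>degs. pr i x) = x" using pr_sum by (simp add: degs_def)

lemma pr_simps [simp]: "pr i 0 = 0" "pr i (x + y) = pr i x + pr i y" "pr i (x - y) = pr i x - pr i y"
  "pr i (r *\<^sub>R x) = r *\<^sub>R pr i x" "pr i (- x) = - pr i x" "pr i (sum f A) = (\<Sum>a\<in>A. pr i (f a))"
  using pr_linear[of i]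
  by (simp_all add: linear_0 linear_add linear_diff linear_scale linear_neg linear_sum)

lemma pr_idem [simp]: "pr i (pr i x) = pr i x" by (simp add: pr_pr)

lemma pr_in_fil: "pr i x \<in> fil \<gg> i" by (simp add: fil_iff pr_pr)

lemma pr_outside: assumes "i \<notin> degs" shows "pr i x = 0"
proof (cases "i < - int (depth \<gg>)")
  case True
  then show ?thesis using fil_iff[of x "- int (depth \<gg>)"] by (simp add: fil_bottom)
next
  case False
  then show ?thesis using assms pr_in_fil[of i x] fil_top[of i] by (simp add: degs_def)
qed

lemma vec_eqI: assumes "\<And>i. pr i x = pr i y" shows "x = y"
proof -
  have "(\<Sum>i\<in>degs. pr i x) = (\<Sum>i\<in>degs. pr i y)" by (simp only: assms)
  then show ?thesis by (simp only: pr_sum_degs)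
qed

lemma pr_fil_eq: "x \<in> fil \<gg> i \<Longrightarrow> x - pr i x \<in> fil \<gg> (i + 1)"
  by (auto simp: fil_iff pr_pr)

lemma pr_fil_zero: "x \<in> fil \<gg> j \<Longrightarrow> i < j \<Longrightarrow> pr i x = 0"
  by (simp add: fil_iff)

text \<open>
  The mutually inverse identifications of the associated graded space with \<open>\<gg>\<close> given by the
  splitting.  In \<open>of_gr\<close> the choice of representative is immaterial, because \<open>pr i\<close> vanishes on
  \<open>fil \<gg> (i + 1)\<close>.
\<close>

definition of_gr :: "(int \<Rightarrow> 'g set) \<Rightarrow> 'g" where
  "of_gr a = (\<Sum>i\<in>degs. pr i (SOME x. x \<in> a i))"

definition to_gr :: "'g \<Rightarrow> (int \<Rightarrow> 'g set)" where
  "to_gr x = (\<lambda>i. pr i x +o fil \<gg> (i + 1))"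

lemma pr_coset: assumes "a = x +o fil \<gg> (i + 1)" "y \<in> a" shows "pr i y = pr i x"
proof -
  obtain w where "w \<in> fil \<gg> (i + 1)" "y = x + w" using assms by (auto simp: elt_set_plus_def)
  then show ?thesis by (simp add: pr_fil_zero)
qed

lemma pr_some_coset: "pr i (SOME y. y \<in> x +o fil \<gg> (i + 1)) = pr i x"
  using pr_coset[OF refl] someI[of "\<lambda>y. y \<in> x +o fil \<gg> (i + 1)" x] coset_mem[OF fil_subspace] by blast

lemma gr_comp_simps [simp]:
  "\<zero>\<^bsub>gr_comp \<gg> i\<^esub> = fil \<gg> (i + 1)" "A \<oplus>\<^bsub>gr_comp \<gg> i\<^esub> B = A + B"
  "r \<odot>\<^bsub>gr_comp \<gg> i\<^esub> A = (*\<^sub>R) r ` A + fil \<gg> (i + 1)"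
  "carrier (gr_comp \<gg> i) = {x +o fil \<gg> (i + 1) | x. x \<in> fil \<gg> i}"
  by (simp_all add: gr_comp_def)

lemma gr_space_simps [simp]:
  "\<zero>\<^bsub>gr_space \<gg>\<^esub> = (\<lambda>i. fil \<gg> (i + 1))" "a \<oplus>\<^bsub>gr_space \<gg>\<^esub> b = (\<lambda>i. a i + b i)"
  "r \<odot>\<^bsub>gr_space \<gg>\<^esub> a = (\<lambda>i. (*\<^sub>R) r ` a i + fil \<gg> (i + 1))"
  "carrier (gr_space \<gg>) = {a. \<forall>i. a i \<in> {x +o fil \<gg> (i + 1) | x. x \<in> fil \<gg> i}}"
  by (simp_all add: gr_space_def)

lemma to_gr_closed: "to_gr x \<in> carrier (gr_space \<gg>)"
  by (auto simp: to_gr_def pr_in_fil)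

lemma of_gr_to_gr [simp]: "of_gr (to_gr x) = x"
  by (simp add: of_gr_def to_gr_def pr_some_coset pr_sum_degs)

lemma to_gr_of_gr: assumes "a \<in> carrier (gr_space \<gg>)" shows "to_gr (of_gr a) = a"
proof
  fix i
  obtain x where x: "x \<in> fil \<gg> i" "a i = x +o fil \<gg> (i + 1)" using assms by fastforce
  have "pr i (of_gr a) = (if i \<in> degs then pr i (SOME x. x \<in> a i) else 0)"
    by (simp add: of_gr_def pr_pr sum.delta)
  also have "\<dots> = pr i x" using pr_outside[of i] by (simp add: x(2) pr_some_coset)
  finally have "to_gr (of_gr a) i = pr i x +o fil \<gg> (i + 1)" by (simp add: to_gr_def)
  also have "\<dots> = x +o fil \<gg> (i + 1)"
    using pr_fil_eq[OF x(1)] coset_eq_iff[OF fil_subspace] by metis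
  finally show "to_gr (of_gr a) i = a i" by (simp add: x(2))
qed

lemma to_gr_eq_iff [simp]: "to_gr x = to_gr y \<longleftrightarrow> x = y"
  by (metis of_gr_to_gr)

lemma gr_space_cases: assumes "a \<in> carrier (gr_space \<gg>)" obtains x where "a = to_gr x"
  using to_gr_of_gr[OF assms] by metis

lemma to_gr_add: "to_gr x \<oplus>\<^bsub>gr_space \<gg>\<^esub> to_gr y = to_gr (x + y)"
  by (simp add: to_gr_def coset_add fil_subspace)

lemma to_gr_smult: "r \<odot>\<^bsub>gr_space \<gg>\<^esub> to_gr x = to_gr (r *\<^sub>R x)"
  by (simp add: to_gr_def coset_scale fil_subspace)

lemma to_gr_zero: "\<zero>\<^bsub>gr_space \<gg>\<^esub> = to_gr 0"
  by (simp add: to_gr_def coset_zero fil_subspace subspace_0)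

lemma lin_coords_gr_space: "lin_coords (gr_space \<gg>) UNIV of_gr"
proof
  show "bij_betw of_gr (carrier (gr_space \<gg>)) UNIV"
    by (rule bij_betw_byWitness[of _ to_gr]) (use to_gr_of_gr to_gr_closed in auto)
  show "of_gr \<zero>\<^bsub>gr_space \<gg>\<^esub> = 0" using to_gr_zero by simp
  show "\<zero>\<^bsub>gr_space \<gg>\<^esub> \<in> carrier (gr_space \<gg>)" using to_gr_zero to_gr_closed by metis
next
  fix a b r assume "a \<in> carrier (gr_space \<gg>)" "b \<in> carrier (gr_space \<gg>)"
  then obtain x y where xy: "a = to_gr x" "b = to_gr y" using gr_space_cases by metis
  show "a \<oplus>\<^bsub>gr_space \<gg>\<^esub> b \<in> carrier (gr_space \<gg>)" "of_gr (a \<oplus>\<^bsub>gr_space \<gg>\<^esub> b) = of_gr a + of_gr b"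
    unfolding xy to_gr_add by (simp_all only: to_gr_closed of_gr_to_gr)
next
  fix a r assume "a \<in> carrier (gr_space \<gg>)"
  then obtain x where xy: "a = to_gr x" using gr_space_cases by metis
  show "r \<odot>\<^bsub>gr_space \<gg>\<^esub> a \<in> carrier (gr_space \<gg>)" "of_gr (r \<odot>\<^bsub>gr_space \<gg>\<^esub> a) = r *\<^sub>R of_gr a"
    unfolding xy to_gr_smult by (simp_all only: to_gr_closed of_gr_to_gr)
qed simp

lemma to_gr_comp_zero_iff: "to_gr x i = \<zero>\<^bsub>gr_comp \<gg> i\<^esub> \<longleftrightarrow> pr i x = 0"
proof -
  have "to_gr x i = \<zero>\<^bsub>gr_comp \<gg> i\<^esub> \<longleftrightarrow> pr i x \<in> fil \<gg> (i + 1)"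
    using coset_eq_iff[OF fil_subspace, of "pr i x" "i + 1" 0] by (simp add: to_gr_def)
  then show ?thesis
    using pr_fil_zero[of "pr i x" "i + 1" i] fil_subspace[of "i + 1"] by (auto simp: subspace_0)
qed

lemma to_gr_homog_iff: "to_gr x \<in> gr_homog \<gg> i \<longleftrightarrow> pr i x = x"
proof -
  have "to_gr x \<in> gr_homog \<gg> i \<longleftrightarrow> (\<forall>j. j \<noteq> i \<longrightarrow> pr j x = 0)"
    unfolding gr_homog_def mem_Collect_eq to_gr_comp_zero_iff using to_gr_closed by blast
  also have "\<dots> \<longleftrightarrow> pr i x = x"
  proof
    assume "\<forall>j. j \<noteq> i \<longrightarrow> pr j x = 0"
    then show "pr i x = x" by - (rule vec_eqI, simp add: pr_pr)
  next
    assume "pr i x = x"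
    then show "\<forall>j. j \<noteq> i \<longrightarrow> pr j x = 0" using pr_pr[of _ i x] by metis
  qed
  finally show ?thesis .
qed

lemma gr_class_eq: assumes "x \<in> fil \<gg> i" shows "gr_class \<gg> i x = to_gr (pr i x)"
proof
  fix j
  have "x +o fil \<gg> (i + 1) = pr i x +o fil \<gg> (i + 1)"
    using pr_fil_eq[OF assms] coset_eq_iff[OF fil_subspace] by metis
  then show "gr_class \<gg> i x j = to_gr (pr i x) j"
    by (simp add: gr_class_def to_gr_def pr_pr coset_zero fil_subspace subspace_0)
qed

text \<open>The projection onto the sum of the components of negative degree, with kernel \<open>fil \<gg> 0\<close>.\<close>

definition neg :: "'g \<Rightarrow> 'g" where "neg x = (\<Sum>i\<in>degs \<inter> {..<0}. pr i x)"

lemma pr_neg: "pr i (neg x) = (if i < 0 then pr i x else 0)"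
  using pr_outside[of i] by (auto simp: neg_def pr_pr sum.delta)

lemma neg_linear: "linear neg"
  unfolding neg_def by (intro linear_compose_sum ballI pr_linear)

lemma neg_eq_iff: "neg x = neg y \<longleftrightarrow> x - y \<in> fil \<gg> 0"
proof
  assume "neg x = neg y"
  then show "x - y \<in> fil \<gg> 0" unfolding fil_iff by (metis eq_iff_diff_eq_0 pr_neg pr_simps(3))
next
  assume "x - y \<in> fil \<gg> 0"
  then show "neg x = neg y" by - (rule vec_eqI, simp add: pr_neg fil_iff)
qed

lemma neg_neg [simp]: "neg (neg x) = neg x" by (rule vec_eqI) (simp add: pr_neg)

lemma neg_fixed_iff: "neg x = x \<longleftrightarrow> (\<forall>i\<ge>0. pr i x = 0)"
proof
  assume "neg x = x"
  then show "\<forall>i\<ge>0. pr i x = 0" using pr_neg[of _ x] by (metis linorder_not_le)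
next
  assume "\<forall>i\<ge>0. pr i x = 0"
  then show "neg x = x" by - (rule vec_eqI, simp add: pr_neg)
qed

lemma to_gr_neg_space_iff: "to_gr x \<in> carrier (neg_space \<gg>) \<longleftrightarrow> neg x = x"
proof -
  have "to_gr x \<in> carrier (neg_space \<gg>) \<longleftrightarrow> (\<forall>i\<ge>0. pr i x = 0)"
    unfolding neg_space_def using to_gr_closed[of x] to_gr_comp_zero_iff[of x] by auto
  then show ?thesis by (simp add: neg_fixed_iff)
qed

lemma neg_space_cases: assumes "a \<in> carrier (neg_space \<gg>)" obtains x where "a = to_gr (neg x)"
proof -
  have "a \<in> carrier (gr_space \<gg>)" using assms by (simp add: neg_space_def)
  then obtain x where "a = to_gr x" by (rule gr_space_cases)
  then show ?thesis using assms that to_gr_neg_space_iff by metis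
qed

section \<open>The graded bracket\<close>

text \<open>
  The bracket of the associated graded Lie algebra, transported to \<open>\<gg>\<close>: in general it differs
  from the bracket of \<open>\<gg>\<close>, of which it keeps the homogeneous part of degree \<open>0\<close>.
\<close>

definition grb :: "'g \<Rightarrow> 'g \<Rightarrow> 'g" where
  "grb x y = (\<Sum>i\<in>degs. \<Sum>j\<in>degs. pr (i + j) (bracket \<gg> (pr i x) (pr j y)))"

lemma bracket_simps [simp]:
  "bracket \<gg> (x + x') y = bracket \<gg> x y + bracket \<gg> x' y"
  "bracket \<gg> x (y + y') = bracket \<gg> x y + bracket \<gg> x y'"
  "bracket \<gg> (r *\<^sub>R x) y = r *\<^sub>R bracket \<gg> x y"
  "bracket \<gg> x (r *\<^sub>R y) = r *\<^sub>R bracket \<gg> x y"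
  "bracket \<gg> 0 y = 0" "bracket \<gg> x 0 = 0"
  using bracket_bilinear
  by (simp_all add: bilinear_ladd bilinear_radd bilinear_lmul bilinear_rmul bilinear_lzero bilinear_rzero)

lemma bracket_skew: "bracket \<gg> x y = - bracket \<gg> y x"
proof -
  have "bracket \<gg> (x + y) (x + y) = bracket \<gg> x y + bracket \<gg> y x"
    unfolding bracket_simps(1,2) by (simp add: bracket_self add.commute)
  then show ?thesis by (simp add: bracket_self eq_neg_iff_add_eq_0)
qed

lemma grb_bilinear: "bilinear grb"
  unfolding bilinear_def grb_def
  by (auto intro!: linearI simp: sum.distrib scaleR_sum_right)

lemma grb_simps [simp]:
  "grb (x + x') y = grb x y + grb x' y"
  "grb x (y + y') = grb x y + grb x y'"
  "grb (r *\<^sub>R x) y = r *\<^sub>R grb x y"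
  "grb x (r *\<^sub>R y) = r *\<^sub>R grb x y"
  "grb 0 y = 0" "grb x 0 = 0"
  using grb_bilinear
  by (simp_all add: bilinear_ladd bilinear_radd bilinear_lmul bilinear_rmul bilinear_lzero bilinear_rzero)

lemma grb_skew: "grb x y = - grb y x"
proof -
  have "grb x y = (\<Sum>j\<in>degs. \<Sum>i\<in>degs. pr (i + j) (bracket \<gg> (pr i x) (pr j y)))"
    unfolding grb_def by (rule sum.swap)
  also have "\<dots> = (\<Sum>j\<in>degs. \<Sum>i\<in>degs. - pr (j + i) (bracket \<gg> (pr j y) (pr i x)))"
    by (subst bracket_skew) (simp add: add.commute)
  finally show ?thesis by (simp add: grb_def sum_negf)
qed

lemma grb_self [simp]: "grb x x = 0"
  using grb_skew[of x x] by (simp add: real_vector.scale_eq_0_iff eq_neg_iff_add_eq_0 scaleR_2[symmetric])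

lemma grb_homog: assumes "pr i x = x" "pr j y = y"
  shows "pr (i + j) (grb x y) = grb x y"
proof -
  have "pr (i' + j') (bracket \<gg> (pr i' x) (pr j' y)) =
      (if i' = i \<and> j' = j then pr (i + j) (bracket \<gg> x y) else 0)" for i' j'
    using pr_pr[of i' i x] pr_pr[of j' j y] assms by auto
  then have "grb x y = (\<Sum>i'\<in>degs. \<Sum>j'\<in>degs. if i' = i \<and> j' = j then pr (i + j) (bracket \<gg> x y) else 0)"
    unfolding grb_def by simp
  then show ?thesis by (auto simp: pr_pr if_distrib intro!: sum.cong)
qed

lemma pr_grb: "pr n (grb x y) =
    (\<Sum>i\<in>{i\<in>degs. n - i \<in> degs}. pr n (bracket \<gg> (pr i x) (pr (n - i) y)))"
proof -
  have "(\<Sum>j\<in>degs. pr n (pr (i + j) (bracket \<gg> (pr i x) (pr j y)))) =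
      (if n - i \<in> degs then pr n (bracket \<gg> (pr i x) (pr (n - i) y)) else 0)" for i
  proof -
    have "pr n (pr (i + j) (bracket \<gg> (pr i x) (pr j y))) =
        (if j = n - i then pr n (bracket \<gg> (pr i x) (pr (n - i) y)) else 0)" for j
      by (auto simp: pr_pr)
    then show ?thesis by simp
  qed
  then have "pr n (grb x y) =
      (\<Sum>i\<in>degs. if n - i \<in> degs then pr n (bracket \<gg> (pr i x) (pr (n - i) y)) else 0)"
    by (simp add: grb_def)
  then show ?thesis by (simp add: sum.inter_filter)
qed

lemma lin_coords_gr_comp:
  "lin_coords (gr_comp \<gg> n) (range (pr n)) (\<lambda>a. pr n (SOME x. x \<in> a))"
proof
  show "bij_betw (\<lambda>a. pr n (SOME x. x \<in> a)) (carrier (gr_comp \<gg> n)) (range (pr n))"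
  proof (rule bij_betw_byWitness[of _ "\<lambda>x. x +o fil \<gg> (n + 1)"])
    have "pr n x +o fil \<gg> (n + 1) = x +o fil \<gg> (n + 1)" if "x \<in> fil \<gg> n" for x
      using pr_fil_eq[OF that] coset_eq_iff[OF fil_subspace, of x "n + 1" "pr n x"] by simp
    then show "\<forall>a\<in>carrier (gr_comp \<gg> n). pr n (SOME x. x \<in> a) +o fil \<gg> (n + 1) = a"
      by (auto simp only: pr_some_coset gr_comp_simps mem_Collect_eq)
  qed (auto simp: pr_some_coset pr_in_fil)
  show "subspace (range (pr n))" using pr_linear subspace_UNIV by (rule linear_subspace_image)
  show "\<zero>\<^bsub>gr_comp \<gg> n\<^esub> \<in> carrier (gr_comp \<gg> n)"
    using coset_zero[OF fil_subspace] subspace_0[OF fil_subspace] by fastforce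
  show "pr n (SOME x. x \<in> \<zero>\<^bsub>gr_comp \<gg> n\<^esub>) = 0"
    using pr_some_coset[of n 0] by (simp add: coset_zero fil_subspace subspace_0)
next
  fix a b assume "a \<in> carrier (gr_comp \<gg> n)" "b \<in> carrier (gr_comp \<gg> n)"
  then obtain x y where xy: "x \<in> fil \<gg> n" "y \<in> fil \<gg> n" "a = x +o fil \<gg> (n + 1)" "b = y +o fil \<gg> (n + 1)"
    by auto
  then have "a \<oplus>\<^bsub>gr_comp \<gg> n\<^esub> b = (x + y) +o fil \<gg> (n + 1)" "x + y \<in> fil \<gg> n"
    by (simp_all add: coset_add fil_subspace subspace_add)
  then show "a \<oplus>\<^bsub>gr_comp \<gg> n\<^esub> b \<in> carrier (gr_comp \<gg> n)"
    "pr n (SOME x. x \<in> a \<oplus>\<^bsub>gr_comp \<gg> n\<^esub> b) = pr n (SOME x. x \<in> a) + pr n (SOME x. x \<in> b)"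
    unfolding xy by (auto simp only: gr_comp_simps pr_some_coset pr_simps)
next
  fix a r assume "a \<in> carrier (gr_comp \<gg> n)"
  then obtain x where x: "x \<in> fil \<gg> n" "a = x +o fil \<gg> (n + 1)" by auto
  then have "r \<odot>\<^bsub>gr_comp \<gg> n\<^esub> a = (r *\<^sub>R x) +o fil \<gg> (n + 1)" "r *\<^sub>R x \<in> fil \<gg> n"
    by (simp_all add: coset_scale fil_subspace subspace_scale)
  then show "r \<odot>\<^bsub>gr_comp \<gg> n\<^esub> a \<in> carrier (gr_comp \<gg> n)"
    "pr n (SOME x. x \<in> r \<odot>\<^bsub>gr_comp \<gg> n\<^esub> a) = r *\<^sub>R pr n (SOME x. x \<in> a)"
    unfolding x by (auto simp only: gr_comp_simps pr_some_coset pr_simps)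
qed

lemma gr_bracket_comp_eq:
  "gr_bracket_comp \<gg> i j (to_gr x i) (to_gr y j)
     = pr (i + j) (bracket \<gg> (pr i x) (pr j y)) +o fil \<gg> (i + j + 1)"
proof -
  let ?c = "pr (i + j) (bracket \<gg> (pr i x) (pr j y)) +o fil \<gg> (i + j + 1)"
  have "bracket \<gg> u v +o fil \<gg> (i + j + 1) = ?c" if uv: "u \<in> to_gr x i" "v \<in> to_gr y j" for u v
  proof -
    obtain w where w: "w \<in> fil \<gg> (i + 1)" "u = pr i x + w"
      using uv(1) by (auto simp: to_gr_def elt_set_plus_def)
    obtain z where z: "z \<in> fil \<gg> (j + 1)" "v = pr j y + z"
      using uv(2) by (auto simp: to_gr_def elt_set_plus_def)
    have w': "w \<in> fil \<gg> i" using w(1) fil_antimono[of i "i + 1"] by auto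
    have "bracket \<gg> (pr i x) z \<in> fil \<gg> (i + j + 1)" "bracket \<gg> w (pr j y) \<in> fil \<gg> (i + j + 1)"
      "bracket \<gg> w z \<in> fil \<gg> (i + j + 1)"
      using fil_bracket[OF pr_in_fil[of i x] z(1)] fil_bracket[OF w(1) pr_in_fil[of j y]]
        fil_bracket[OF w' z(1)] by (simp_all add: ac_simps)
    moreover have "bracket \<gg> (pr i x) (pr j y) - pr (i + j) (bracket \<gg> (pr i x) (pr j y)) \<in> fil \<gg> (i + j + 1)"
      by (intro pr_fil_eq fil_bracket pr_in_fil)
    ultimately have "bracket \<gg> (pr i x) z + bracket \<gg> w (pr j y) + bracket \<gg> w z +
      (bracket \<gg> (pr i x) (pr j y) - pr (i + j) (bracket \<gg> (pr i x) (pr j y))) \<in> fil \<gg> (i + j + 1)"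
      by (intro subspace_add fil_subspace)
    then show ?thesis
      by (subst coset_eq_iff[OF fil_subspace]) (simp add: w(2) z(2) algebra_simps)
  qed
  moreover have "pr i x \<in> to_gr x i" "pr j y \<in> to_gr y j"
    by (simp_all add: to_gr_def coset_mem fil_subspace)
  ultimately show ?thesis unfolding gr_bracket_comp_def by blast
qed

lemma gr_bracket_to_gr: "gr_bracket \<gg> (to_gr x) (to_gr y) = to_gr (grb x y)"
proof
  fix n
  interpret C: lin_coords "gr_comp \<gg> n" "range (pr n)" "\<lambda>a. pr n (SOME x. x \<in> a)"
    by (rule lin_coords_gr_comp)
  interpret CM: module real_ring "gr_comp \<gg> n" by (rule C.module)
  let ?I = "{i \<in> degs. n - i \<in> degs}"
  let ?f = "\<lambda>i. pr n (bracket \<gg> (pr i x) (pr (n - i) y)) +o fil \<gg> (n + 1)"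
  have f: "?f \<in> ?I \<rightarrow> carrier (gr_comp \<gg> n)" by (auto simp: pr_in_fil)
  have eq: "gr_bracket \<gg> (to_gr x) (to_gr y) n = finsum (gr_comp \<gg> n) ?f ?I"
    unfolding gr_bracket_def degs_def[symmetric]
    using gr_bracket_comp_eq[of _ "n - _" x y] by simp
  have "finsum (gr_comp \<gg> n) ?f ?I = to_gr (grb x y) n"
  proof (subst C.e_eq_iff[symmetric])
    show "finsum (gr_comp \<gg> n) ?f ?I \<in> carrier (gr_comp \<gg> n)"
      using f by (rule CM.finsum_closed)
    show "to_gr (grb x y) n \<in> carrier (gr_comp \<gg> n)"
      using to_gr_closed by simp
    show "pr n (SOME x. x \<in> finsum (gr_comp \<gg> n) ?f ?I) = pr n (SOME z. z \<in> to_gr (grb x y) n)"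
      by (subst C.e_finsum[OF _ f]) (simp_all add: pr_some_coset to_gr_def pr_grb)
  qed
  then show "gr_bracket \<gg> (to_gr x) (to_gr y) n = to_gr (grb x y) n" using eq by simp
qed

end

section \<open>Alternating maps on lists of vectors\<close>

lemma linear_iff_comb: fixes f :: "_ \<Rightarrow> _" shows "linear f \<longleftrightarrow> (\<forall>x y r s. f (r *\<^sub>R x + s *\<^sub>R y) = r *\<^sub>R f x + s *\<^sub>R f y)"
proof
  assume *: "\<forall>x y r s. f (r *\<^sub>R x + s *\<^sub>R y) = r *\<^sub>R f x + s *\<^sub>R f y"
  show "linear f"
  proof (rule linearI)
    show "f (x + y) = f x + f y" for x y using *[rule_format, of 1 x 1 y] by simp
    show "f (r *\<^sub>R x) = r *\<^sub>R f x" for r x using *[rule_format, of r x 0 x] by simp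
  qed
qed (simp add: linear_add linear_scale)

text \<open>
  Maps on lists of length \<open>k\<close> that are linear in each entry.
\<close>

definition multilinear :: "nat \<Rightarrow> ('a::real_vector list \<Rightarrow> 'b::real_vector) \<Rightarrow> bool" where
  "multilinear k f \<longleftrightarrow> (\<forall>xs i. length xs = k \<longrightarrow> i < k \<longrightarrow> linear (\<lambda>x. f (xs[i := x])))"

lemma multilinearD: "multilinear k f \<Longrightarrow> length xs = k \<Longrightarrow> i < k \<Longrightarrow> linear (\<lambda>x. f (xs[i := x]))"
  by (simp add: multilinear_def)

text \<open>
  A multilinear map takes values in the subspace \<open>W\<close> as soon as it does so on arguments from
  spanning sets \<open>S i\<close>.
\<close>

lemma multilinear_span:
  assumes f: "multilinear k f" and W: "subspace W"
    and base: "\<And>xs. length xs = k \<Longrightarrow> (\<And>i. i < k \<Longrightarrow> xs ! i \<in> S i) \<Longrightarrow> f xs \<in> W"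
    and xs: "length xs = k" "\<And>i. i < k \<Longrightarrow> xs ! i \<in> span (S i)"
  shows "f xs \<in> W"
proof -
  have "f xs \<in> W" if "m \<le> k" "length xs = k"
    "\<And>i. i < k \<Longrightarrow> xs ! i \<in> (if i < m then span (S i) else S i)" for m xs
    using that
  proof (induction m arbitrary: xs)
    case 0
    then show ?case by (intro base) auto
  next
    case (Suc m)
    have "xs ! m \<in> span (S m)" using Suc.prems(3)[of m] Suc.prems(1) by simp
    then have "xs ! m \<in> {x. f (xs[m := x]) \<in> W}"
    proof (rule span_subspace_induct)
      have "linear (\<lambda>x. f (xs[m := x]))" using multilinearD[OF f] Suc.prems by simp
      then show "subspace {x. f (xs[m := x]) \<in> W}"
        using linear_subspace_vimage[OF _ W] by (simp add: vimage_def)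
    next
      fix x assume "x \<in> S m"
      then have "xs[m := x] ! i \<in> (if i < m then span (S i) else S i)" if "i < k" for i
        using Suc.prems(3)[OF that] Suc.prems(2) that by (auto simp: nth_list_update split: if_splits)
      then have "f (xs[m := x]) \<in> W"
        using Suc.prems by (intro Suc.IH) auto
      then show "x \<in> {x. f (xs[m := x]) \<in> W}" by simp
    qed
    then show ?case by simp
  qed
  from this[of k] xs show ?thesis by simp
qed

text \<open>
  The alternating \<open>k\<close>-linear maps that vanish as soon as one argument lies in \<open>N\<close>, that is, the
  alternating maps on the quotient by \<open>N\<close>.  They are \<open>0\<close> on lists of any other length, which
  makes them a subspace of a function space.
\<close>

definition alt_mod :: "nat \<Rightarrow> 'a::real_vector set \<Rightarrow> ('a list \<Rightarrow> 'b::real_vector) set" where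
  "alt_mod k N = {f. (\<forall>xs. length xs \<noteq> k \<longrightarrow> f xs = 0) \<and> multilinear k f \<and>
     (\<forall>xs i j. length xs = k \<longrightarrow> i < k \<longrightarrow> j < k \<longrightarrow> i \<noteq> j \<longrightarrow> xs ! i = xs ! j \<longrightarrow> f xs = 0) \<and>
     (\<forall>xs i. length xs = k \<longrightarrow> i < k \<longrightarrow> xs ! i \<in> N \<longrightarrow> f xs = 0)}"

lemma alt_modI:
  assumes "\<And>xs. length xs \<noteq> k \<Longrightarrow> f xs = 0"
    and "\<And>xs i. length xs = k \<Longrightarrow> i < k \<Longrightarrow> linear (\<lambda>x. f (xs[i := x]))"
    and "\<And>xs i j. length xs = k \<Longrightarrow> i < k \<Longrightarrow> j < k \<Longrightarrow> i \<noteq> j \<Longrightarrow> xs ! i = xs ! j \<Longrightarrow> f xs = 0"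
    and "\<And>xs i. length xs = k \<Longrightarrow> i < k \<Longrightarrow> xs ! i \<in> N \<Longrightarrow> f xs = 0"
  shows "f \<in> alt_mod k N"
  unfolding alt_mod_def multilinear_def using assms by blast

lemma alt_modD:
  assumes "f \<in> alt_mod k N"
  shows "length xs \<noteq> k \<Longrightarrow> f xs = 0"
    and "multilinear k f"
    and "length xs = k \<Longrightarrow> i < k \<Longrightarrow> linear (\<lambda>x. f (xs[i := x]))"
    and "length xs = k \<Longrightarrow> i < k \<Longrightarrow> j < k \<Longrightarrow> i \<noteq> j \<Longrightarrow> xs ! i = xs ! j \<Longrightarrow> f xs = 0"
    and "length xs = k \<Longrightarrow> i < k \<Longrightarrow> xs ! i \<in> N \<Longrightarrow> f xs = 0"
proof -
  note f = assms[unfolded alt_mod_def multilinear_def mem_Collect_eq]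
  show "length xs \<noteq> k \<Longrightarrow> f xs = 0" using f by simp
  show "multilinear k f" using f by (simp add: multilinear_def)
  show "length xs = k \<Longrightarrow> i < k \<Longrightarrow> linear (\<lambda>x. f (xs[i := x]))" using f by simp
  show "length xs = k \<Longrightarrow> i < k \<Longrightarrow> j < k \<Longrightarrow> i \<noteq> j \<Longrightarrow> xs ! i = xs ! j \<Longrightarrow> f xs = 0"
    using f by metis
  show "length xs = k \<Longrightarrow> i < k \<Longrightarrow> xs ! i \<in> N \<Longrightarrow> f xs = 0"
    using f by metis
qed

lemma subspace_alt_mod: "subspace (alt_mod k N)"
proof (rule subspaceI)
  show "0 \<in> alt_mod k N" by (rule alt_modI) (auto simp: linear_iff_comb)
next
  fix f g :: "'a list \<Rightarrow> 'b" assume "f \<in> alt_mod k N" "g \<in> alt_mod k N"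
  note f = alt_modD[OF this(1)] and g = alt_modD[OF this(2)]
  show "f + g \<in> alt_mod k N"
  proof (rule alt_modI)
    show "linear (\<lambda>x. (f + g) (xs[i := x]))" if "length xs = k" "i < k" for xs i
      using f(3)[OF that] g(3)[OF that] by (simp add: linear_compose_add)
    show "(f + g) xs = 0" if "length xs = k" "i < k" "j < k" "i \<noteq> j" "xs ! i = xs ! j" for xs i j
      using f(4)[OF that] g(4)[OF that] by simp
    show "(f + g) xs = 0" if "length xs = k" "i < k" "xs ! i \<in> N" for xs i
      using f(5)[OF that] g(5)[OF that] by simp
  qed (use f(1) g(1) in auto)
next
  fix r and f :: "'a list \<Rightarrow> 'b" assume "f \<in> alt_mod k N"
  note f = alt_modD[OF this(1)]
  show "r *\<^sub>R f \<in> alt_mod k N"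
  proof (rule alt_modI)
    show "linear (\<lambda>x. (r *\<^sub>R f) (xs[i := x]))" if "length xs = k" "i < k" for xs i
      using f(3)[OF that] by (simp add: linear_compose_scale_right)
    show "(r *\<^sub>R f) xs = 0" if "length xs = k" "i < k" "j < k" "i \<noteq> j" "xs ! i = xs ! j" for xs i j
      using f(4)[OF that] by simp
    show "(r *\<^sub>R f) xs = 0" if "length xs = k" "i < k" "xs ! i \<in> N" for xs i
      using f(5)[OF that] by simp
  qed (use f(1) in auto)
qed

lemma alt_mod_cong:
  assumes f: "f \<in> alt_mod k N" and len: "length xs = k" "length ys = k"
    and N: "\<And>i. i < k \<Longrightarrow> xs ! i - ys ! i \<in> N"
  shows "f xs = f ys"
proof -
  have "f (take m ys @ drop m xs) = f xs" if "m \<le> k" for m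
    using that
  proof (induction m)
    case (Suc m)
    let ?zs = "take m ys @ drop m xs"
    have zs: "length ?zs = k" using Suc.prems len by simp
    have lin: "linear (\<lambda>x. f (?zs[m := x]))" using alt_modD(3)[OF f zs] Suc.prems by simp
    have "f (?zs[m := xs ! m - ys ! m]) = 0"
      using N[of m] Suc.prems zs by (intro alt_modD(5)[OF f, of _ m]) auto
    then have "f (?zs[m := xs ! m]) = f (?zs[m := ys ! m])" by (simp add: linear_diff[OF lin])
    moreover have "?zs[m := xs ! m] = ?zs" using Suc.prems len
      by (intro nth_equalityI) (auto simp: nth_append nth_list_update)
    moreover have "?zs[m := ys ! m] = take (Suc m) ys @ drop (Suc m) xs" using Suc.prems len
      by (intro nth_equalityI) (auto simp: nth_append nth_list_update)
    ultimately show ?case using Suc by simp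
  qed simp
  from this[of k] show ?thesis using len by simp
qed

lemma alt_mod_eqI:
  assumes "f \<in> alt_mod k N" "g \<in> alt_mod k N" "\<And>xs. length xs = k \<Longrightarrow> f xs = g xs"
  shows "f = g"
proof
  fix xs show "f xs = g xs"
    using assms(3)[of xs] alt_modD(1)[OF assms(1), of xs] alt_modD(1)[OF assms(2), of xs]
    by (cases "length xs = k") auto
qed

text \<open>An alternating map is determined by its values on lists of vectors from a finite spanning set.\<close>

lemma fin_gen_alt_mod:
  fixes K :: "'a::real_vector set" and K' :: "'b::real_vector set"
  assumes K: "finite K" "span K = UNIV" and K': "finite K'" "span K' = UNIV"
  shows "fin_gen (alt_mod k N :: ('a list \<Rightarrow> 'b) set)"
proof (rule fin_gen_inj_image)
  define L where "L = {xs. length xs = k \<and> set xs \<subseteq> K}"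
  have L: "finite L" unfolding L_def using finite_lists_length_eq[OF K(1), of k] by (simp add: conj_commute)
  define r :: "('a list \<Rightarrow> 'b) \<Rightarrow> ('a list \<Rightarrow> 'b)" where "r f = (\<lambda>xs. if xs \<in> L then f xs else 0)" for f
  show r_lin: "linear r" by (rule linearI) (auto simp: r_def fun_eq_iff)
  show "subspace (alt_mod k N :: ('a list \<Rightarrow> 'b) set)" by (rule subspace_alt_mod)
  show "inj_on r (alt_mod k N)"
  proof (rule inj_onI)
    fix f g assume fg: "f \<in> alt_mod k N" "g \<in> alt_mod k N" "r f = r g"
    have "f - g \<in> alt_mod k N" using fg subspace_alt_mod subspace_diff by blast
    note h = alt_modD(2)[OF this]
    show "f = g"
    proof (rule alt_mod_eqI[OF fg(1,2)])
      fix xs :: "'a list" assume "length xs = k"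
      then have "(f - g) xs \<in> {0}"
      proof (rule multilinear_span[OF h, rotated 2])
        show "(f - g) xs \<in> {0}" if "length xs = k" "\<And>i. i < k \<Longrightarrow> xs ! i \<in> K" for xs
        proof -
          have "xs \<in> L" using that by (auto simp: L_def in_set_conv_nth)
          then show ?thesis using fun_cong[OF fg(3), of xs] by (simp add: r_def)
        qed
      qed (auto simp: K(2) subspace_0)
      then show "f xs = g xs" by simp
    qed
  qed
  define \<delta> :: "'a list \<Rightarrow> 'b \<Rightarrow> ('a list \<Rightarrow> 'b)" where "\<delta> ys v = (\<lambda>xs. if xs = ys then v else 0)" for ys v
  have \<delta>_lin: "linear (\<delta> ys)" for ys by (rule linearI) (auto simp: \<delta>_def fun_eq_iff)
  have "r f \<in> span (\<Union>ys\<in>L. \<delta> ys ` K')" for f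
  proof -
    have "r f = (\<Sum>ys\<in>L. \<delta> ys (f ys))"
      using L by (auto simp: r_def \<delta>_def sum_fun_apply fun_eq_iff)
    also have "\<dots> \<in> span (\<Union>ys\<in>L. \<delta> ys ` K')"
    proof (rule span_sum)
      fix ys assume "ys \<in> L"
      have "\<delta> ys (f ys) \<in> span (\<delta> ys ` K')"
        using linear_span_image[OF \<delta>_lin, of ys K'] K'(2) by blast
      then show "\<delta> ys (f ys) \<in> span (\<Union>ys\<in>L. \<delta> ys ` K')"
        using span_mono[of "\<delta> ys ` K'" "\<Union>ys\<in>L. \<delta> ys ` K'"] \<open>ys \<in> L\<close> by blast
    qed
    finally show ?thesis .
  qed
  then show "fin_gen (r ` alt_mod k N)"
    unfolding fin_gen_def using L K'(1) by (intro exI[of _ "\<Union>ys\<in>L. \<delta> ys ` K'"]) auto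
qed

section \<open>Coordinates on spaces of alternating maps\<close>

text \<open>
  A linear map \<open>q\<close> onto \<open>V\<close> with kernel \<open>N\<close>, and coordinates on \<open>W\<close>.  Pulling back along \<open>q\<close>
  identifies alternating maps from \<open>V\<close> to \<open>W\<close> with \<^const>\<open>alt_mod\<close>.
\<close>

locale quotient_coords = W: lin_coords W UNIV eW
  for W :: "(real, 'w) module" and eW :: "'w \<Rightarrow> 'b::real_vector" +
  fixes V :: "(real, 'v) module" and q :: "'a::real_vector \<Rightarrow> 'v" and N :: "'a set"
  assumes q_range: "range q = carrier V"
    and q_comb: "q (r *\<^sub>R x + s *\<^sub>R y) = r \<odot>\<^bsub>V\<^esub> q x \<oplus>\<^bsub>V\<^esub> s \<odot>\<^bsub>V\<^esub> q y"
    and q_eq_iff: "q x = q y \<longleftrightarrow> x - y \<in> N"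
begin

definition pull :: "nat \<Rightarrow> ('v list \<Rightarrow> 'w) \<Rightarrow> ('a list \<Rightarrow> 'b)" where
  "pull k \<phi> = (\<lambda>xs. if length xs = k then eW (\<phi> (map q xs)) else 0)"

lemma map_q_tuples: "length xs = k \<Longrightarrow> map q xs \<in> tuples k V"
  using q_range by (auto simp: tuples_def)

lemma tuples_cases: assumes "Cs \<in> tuples k V" obtains xs where "length xs = k" "Cs = map q xs"
proof -
  have "set Cs \<subseteq> range q" using assms q_range by (auto simp: tuples_def)
  then have "Cs \<in> lists (range q)" by (auto simp: lists_eq_set)
  then obtain xs where "Cs = map q xs" by (metis imageE lists_image lists_UNIV)
  then show ?thesis using assms that[of xs] by (simp add: tuples_def)
qed

lemma q_closed: "q x \<in> carrier V" using q_range by blast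

lemma pull_alt_mod:
  assumes "\<phi> \<in> alt_maps k V W"
  shows "pull k \<phi> \<in> alt_mod k N"
proof -
  have val: "\<phi> Cs \<in> carrier W" if "Cs \<in> tuples k V" for Cs
    using assms that by (auto simp: alt_maps_def)
  have lin: "linear (\<lambda>x. pull k \<phi> (xs[i := x]))" if "length xs = k" "i < k" for xs i
    unfolding linear_iff_comb
  proof (intro allI)
    fix x y r s
    have upd: "map q (xs[i := z]) = (map q xs)[i := q z]" for z by (simp add: map_update)
    have "\<phi> ((map q xs)[i := r \<odot>\<^bsub>V\<^esub> q x \<oplus>\<^bsub>V\<^esub> s \<odot>\<^bsub>V\<^esub> q y])
          = r \<odot>\<^bsub>W\<^esub> \<phi> ((map q xs)[i := q x]) \<oplus>\<^bsub>W\<^esub> s \<odot>\<^bsub>W\<^esub> \<phi> ((map q xs)[i := q y])"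
      using assms map_q_tuples[OF that(1)] that(2) q_closed unfolding alt_maps_def by blast
    moreover have "\<phi> ((map q xs)[i := q z]) \<in> carrier W" for z
      using val map_q_tuples[of "xs[i := z]" k] that by (simp add: upd)
    ultimately show "pull k \<phi> (xs[i := r *\<^sub>R x + s *\<^sub>R y]) =
        r *\<^sub>R pull k \<phi> (xs[i := x]) + s *\<^sub>R pull k \<phi> (xs[i := y])"
      using that by (simp add: pull_def upd q_comb W.e_add W.e_smult W.closed)
  qed
  show ?thesis
  proof (rule alt_modI)
    show "pull k \<phi> xs = 0" if "length xs = k" "i < k" "j < k" "i \<noteq> j" "xs ! i = xs ! j" for xs i j
    proof -
      have "\<phi> (map q xs) = \<zero>\<^bsub>W\<^esub>"
        using assms map_q_tuples[OF that(1)] that unfolding alt_maps_def by fastforce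
      then show ?thesis using that W.e_zero by (simp add: pull_def)
    qed
    show "pull k \<phi> xs = 0" if "length xs = k" "i < k" "xs ! i \<in> N" for xs i
    proof -
      have "q (xs ! i) = q 0" using that q_eq_iff by simp
      then have "map q (xs[i := 0]) = map q xs"
        using that by (metis list_update_id map_update)
      then have "pull k \<phi> xs = pull k \<phi> (xs[i := 0])" using that by (simp add: pull_def)
      then show ?thesis using linear_0[OF lin[OF that(1,2)]] by simp
    qed
  qed (use lin in \<open>auto simp: pull_def\<close>)
qed

lemma pull_inj:
  assumes "\<phi> \<in> tuples k V \<rightarrow>\<^sub>E carrier W" "\<psi> \<in> tuples k V \<rightarrow>\<^sub>E carrier W" "pull k \<phi> = pull k \<psi>"
  shows "\<phi> = \<psi>"
proof (rule PiE_ext[OF assms(1,2)])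
  fix Cs assume Cs: "Cs \<in> tuples k V"
  then obtain xs where xs: "length xs = k" "Cs = map q xs" by (rule tuples_cases)
  have "eW (\<phi> Cs) = eW (\<psi> Cs)" using fun_cong[OF assms(3), of xs] xs by (simp add: pull_def)
  then show "\<phi> Cs = \<psi> Cs" using Cs assms(1,2) W.e_eq_iff by blast
qed

lemma pull_surj:
  assumes f: "f \<in> alt_mod k N"
  obtains \<phi> where "\<phi> \<in> alt_maps k V W" "pull k \<phi> = f"
proof -
  define eW' where "eW' = inv_into (carrier W) eW"
  have e1: "eW (eW' v) = v" "eW' v \<in> carrier W" for v
    using W.bij by (simp_all add: eW'_def bij_betw_def f_inv_into_f inv_into_into)
  define \<phi> where "\<phi> = (\<lambda>Cs\<in>tuples k V. eW' (f (map (inv_into UNIV q) Cs)))"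
  have \<phi>_q: "\<phi> (map q xs) = eW' (f xs)" if "length xs = k" for xs
  proof -
    have "f (map (inv_into UNIV q) (map q xs)) = f xs"
    proof (rule alt_mod_cong[OF f])
      fix i assume "i < k"
      then show "map (inv_into UNIV q) (map q xs) ! i - xs ! i \<in> N"
        using that q_eq_iff by (simp add: f_inv_into_f flip: q_eq_iff)
    qed (use that in auto)
    then show ?thesis using map_q_tuples[OF that] by (simp add: \<phi>_def del: map_map)
  qed
  have "\<phi> \<in> alt_maps k V W"
    unfolding alt_maps_def
  proof (intro CollectI conjI ballI allI impI)
    show "\<phi> \<in> tuples k V \<rightarrow>\<^sub>E carrier W" using e1 by (auto simp: \<phi>_def)
  next
    fix Cs i C D r s
    assume "Cs \<in> tuples k V" and i: "i < k" and CD: "C \<in> carrier V" "D \<in> carrier V"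
    then obtain xs where xs: "length xs = k" "Cs = map q xs" by (metis tuples_cases)
    obtain x y where xy: "C = q x" "D = q y" using CD q_range by (metis imageE)
    have upd: "(map q xs)[i := q z] = map q (xs[i := z])" for z by (simp add: map_update)
    show "\<phi> (Cs[i := r \<odot>\<^bsub>V\<^esub> C \<oplus>\<^bsub>V\<^esub> s \<odot>\<^bsub>V\<^esub> D]) = r \<odot>\<^bsub>W\<^esub> \<phi> (Cs[i := C]) \<oplus>\<^bsub>W\<^esub> s \<odot>\<^bsub>W\<^esub> \<phi> (Cs[i := D])"
      unfolding xs xy q_comb[symmetric] upd
      using xs alt_modD(3)[OF f xs(1) i, unfolded linear_iff_comb, rule_format, of r x s y]
      by (simp add: \<phi>_q W.e_eq_iff[symmetric] W.closed e1 W.e_add W.e_smult)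
  next
    fix Cs i j
    assume Cs: "Cs \<in> tuples k V" and ij: "i < k" "j < k" "i \<noteq> j \<and> Cs ! i = Cs ! j"
    obtain xs where xs: "length xs = k" "Cs = map q xs" using Cs by (rule tuples_cases)
    have lin: "linear (\<lambda>x. f (xs[j := x]))" by (rule alt_modD(3)[OF f xs(1) ij(2)])
    have "xs ! j - xs ! i \<in> N" using ij xs by (simp flip: q_eq_iff)
    then have "f (xs[j := xs ! j - xs ! i]) = 0"
      using xs ij by (intro alt_modD(5)[OF f, of _ j]) auto
    moreover have "f (xs[j := xs ! i]) = 0"
      using xs ij by (intro alt_modD(4)[OF f, of _ i j]) auto
    ultimately have "f xs = 0" by (simp add: linear_diff[OF lin])
    then show "\<phi> Cs = \<zero>\<^bsub>W\<^esub>" using xs e1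
      by (simp add: \<phi>_q W.e_eq_zero_iff[symmetric])
  qed
  moreover have "pull k \<phi> = f"
    using alt_modD(1)[OF f] by (auto simp: pull_def \<phi>_q e1 fun_eq_iff)
  ultimately show ?thesis using that by blast
qed

lemma pull_mem_iff:
  assumes "\<phi> \<in> tuples k V \<rightarrow>\<^sub>E carrier W"
  shows "\<phi> \<in> alt_maps k V W \<longleftrightarrow> pull k \<phi> \<in> alt_mod k N"
proof
  assume "pull k \<phi> \<in> alt_mod k N"
  then obtain \<psi> where \<psi>: "\<psi> \<in> alt_maps k V W" "pull k \<psi> = pull k \<phi>" by (rule pull_surj)
  then have "\<psi> = \<phi>" using assms by (intro pull_inj[where k = k]) (auto simp: alt_maps_def)
  then show "\<phi> \<in> alt_maps k V W" using \<psi>(1) by simp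
qed (rule pull_alt_mod)

lemma alt_space_simps [simp]: "carrier (alt_space k V W) = alt_maps k V W"
    "\<zero>\<^bsub>alt_space k V W\<^esub> = (\<lambda>xs\<in>tuples k V. \<zero>\<^bsub>W\<^esub>)"
    "f \<oplus>\<^bsub>alt_space k V W\<^esub> g = (\<lambda>xs\<in>tuples k V. f xs \<oplus>\<^bsub>W\<^esub> g xs)"
    "r \<odot>\<^bsub>alt_space k V W\<^esub> f = (\<lambda>xs\<in>tuples k V. r \<odot>\<^bsub>W\<^esub> f xs)"
  by (simp_all add: alt_space_def)

lemma lin_coords_alt_space: "lin_coords (alt_space k V W) (alt_mod k N) (pull k)"
proof
  have ext: "alt_maps k V W \<subseteq> tuples k V \<rightarrow>\<^sub>E carrier W" by (auto simp: alt_maps_def)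
  show "bij_betw (pull k) (carrier (alt_space k V W)) (alt_mod k N)"
    unfolding bij_betw_def
  proof (intro conjI inj_onI subset_antisym)
    show "x = y" if "x \<in> carrier (alt_space k V W)" "y \<in> carrier (alt_space k V W)" "pull k x = pull k y" for x y
      using that ext by (intro pull_inj[where k = k]) auto
    show "alt_mod k N \<subseteq> pull k ` carrier (alt_space k V W)"
      using pull_surj by (metis alt_space_simps(1) imageI subsetI)
  qed (auto simp: pull_alt_mod)
  show "subspace (alt_mod k N :: ('a list \<Rightarrow> 'b) set)" by (rule subspace_alt_mod)
  show e0: "pull k \<zero>\<^bsub>alt_space k V W\<^esub> = 0"
    by (auto simp: pull_def map_q_tuples W.e_zero fun_eq_iff)
  show "\<zero>\<^bsub>alt_space k V W\<^esub> \<in> carrier (alt_space k V W)"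
    using pull_mem_iff[of "\<zero>\<^bsub>alt_space k V W\<^esub>" k] e0 subspace_0[OF subspace_alt_mod]
    by (simp add: W.zero_closed)
next
  fix \<phi> \<psi> r
  assume in': "\<phi> \<in> carrier (alt_space k V W)" "\<psi> \<in> carrier (alt_space k V W)"
  have ext: "alt_maps k V W \<subseteq> tuples k V \<rightarrow>\<^sub>E carrier W" by (auto simp: alt_maps_def)
  have val: "\<phi> Cs \<in> carrier W" if "\<phi> \<in> alt_maps k V W" "Cs \<in> tuples k V" for \<phi> Cs
    using ext that by blast
  show e: "pull k (\<phi> \<oplus>\<^bsub>alt_space k V W\<^esub> \<psi>) = pull k \<phi> + pull k \<psi>"
    using in' by (auto simp: pull_def map_q_tuples W.e_add val fun_eq_iff)
  have "pull k \<phi> + pull k \<psi> \<in> alt_mod k N"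
    using in' by (intro subspace_add subspace_alt_mod pull_alt_mod) auto
  then show "\<phi> \<oplus>\<^bsub>alt_space k V W\<^esub> \<psi> \<in> carrier (alt_space k V W)"
    using pull_mem_iff[of "\<phi> \<oplus>\<^bsub>alt_space k V W\<^esub> \<psi>" k] e in' by (simp add: W.add_closed val)
next
  fix \<phi> r
  assume in': "\<phi> \<in> carrier (alt_space k V W)"
  have val: "\<phi> Cs \<in> carrier W" if "\<phi> \<in> alt_maps k V W" "Cs \<in> tuples k V" for \<phi> Cs
    using that by (auto simp: alt_maps_def)
  show e: "pull k (r \<odot>\<^bsub>alt_space k V W\<^esub> \<phi>) = r *\<^sub>R pull k \<phi>"
    using in' by (auto simp: pull_def map_q_tuples W.e_smult val fun_eq_iff)
  have "r *\<^sub>R pull k \<phi> \<in> alt_mod k N"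
    using in' by (intro subspace_scale subspace_alt_mod pull_alt_mod) auto
  then show "r \<odot>\<^bsub>alt_space k V W\<^esub> \<phi> \<in> carrier (alt_space k V W)"
    using pull_mem_iff[of "r \<odot>\<^bsub>alt_space k V W\<^esub> \<phi>" k] e in' by (simp add: W.smult_closed val)
qed

end

section \<open>Homogeneous components of alternating maps\<close>

lemma sum_list_strict_mono:
  fixes xs ys :: "int list"
  assumes "length xs = length ys" "\<And>i. i < length xs \<Longrightarrow> xs ! i \<le> ys ! i" "xs \<noteq> ys"
  shows "sum_list xs < sum_list ys"
proof -
  obtain i where "i < length xs" "xs ! i \<noteq> ys ! i" using assms(1,3) nth_equalityI by blast
  then have "xs ! i < ys ! i" using assms(2)[of i] by simp
  then have "(\<Sum>i<length xs. xs ! i) < (\<Sum>i<length xs. ys ! i)"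
    using assms(2) \<open>i < length xs\<close> by (intro sum_strict_mono_ex1) auto
  then show ?thesis using assms(1) by (simp add: sum_list_sum_nth atLeast0LessThan)
qed

lemma alt_mod_swap:
  assumes f: "f \<in> alt_mod k N" and zs: "length zs = k" "i < k" "j < k" "i \<noteq> j"
  shows "f (zs[i := zs ! j, j := zs ! i]) = - f zs"
proof -
  define B where "B a b = f (zs[i := a, j := b])" for a b
  have zero: "B a a = 0" for a
    unfolding B_def using zs by (intro alt_modD(4)[OF f, of _ i j]) auto
  have swap: "zs[i := a, j := b] = zs[j := b, i := a]" for a b
    using zs(4) by (rule list_update_swap)
  have "linear (B a)" for a
    unfolding B_def using alt_modD(3)[OF f, of "zs[i := a]" j] zs by simp
  then have r: "B a (b + c) = B a b + B a c" for a b c by (rule linear_add)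
  have "linear (\<lambda>a. B a b)" for b
    unfolding B_def swap using alt_modD(3)[OF f, of "zs[j := b]" i] zs by simp
  then have l: "B (a + c) b = B a b + B c b" for a b c by (rule linear_add)
  have "B (zs ! i + zs ! j) (zs ! i + zs ! j) = B (zs ! i) (zs ! j) + B (zs ! j) (zs ! i)"
    unfolding r l by (simp add: zero)
  then have "B (zs ! j) (zs ! i) = - B (zs ! i) (zs ! j)"
    by (simp add: zero eq_neg_iff_add_eq_0 add.commute)
  then show ?thesis by (simp add: B_def)
qed

lemma eq_neg_self_imp_zero: "(x::'a::real_vector) = - x \<Longrightarrow> x = 0"
  by (metis add.right_inverse scaleR_2 scaleR_eq_0_iff zero_neq_numeral)

context graded_splitting
begin

text \<open>
  Both \<open>maps \<gg> k\<close> and \<open>cochains \<gg> k\<close> are identified below with the following space of alternating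
  maps from \<open>\<gg> / fil \<gg> 0\<close> to \<open>\<gg>\<close>.
\<close>

abbreviation forms :: "nat \<Rightarrow> ('g list \<Rightarrow> 'g) set" where
  "forms k \<equiv> alt_mod k (fil \<gg> 0)"

text \<open>The lists of degrees of \<open>k\<close> arguments of negative degree.\<close>

definition neg_degs :: "nat \<Rightarrow> int list set" where
  "neg_degs k = {is. set is \<subseteq> degs \<inter> {..<0} \<and> length is = k}"

text \<open>
  The homogeneous component of degree \<open>l\<close>: arguments are split into their homogeneous parts, and of
  the value on parts of degrees \<open>is\<close> the part of degree \<open>sum_list is + l\<close> is kept.
\<close>

definition hcomp :: "nat \<Rightarrow> int \<Rightarrow> ('g list \<Rightarrow> 'g) \<Rightarrow> ('g list \<Rightarrow> 'g)" where
  "hcomp k l f = (\<lambda>xs. if length xs = k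
     then \<Sum>is\<in>neg_degs k. pr (sum_list is + l) (f (map2 pr is xs)) else 0)"

text \<open>
  The maps of homogeneity at least \<open>l\<close>, and those homogeneous of degree \<open>l\<close>.
\<close>

definition forms_fil :: "nat \<Rightarrow> int \<Rightarrow> ('g list \<Rightarrow> 'g) set" where
  "forms_fil k l = {f \<in> forms k. \<forall>is xs. length is = k \<and> length xs = k \<and>
     (\<forall>j<k. is ! j < 0 \<and> xs ! j \<in> fil \<gg> (is ! j)) \<longrightarrow> f xs \<in> fil \<gg> (sum_list is + l)}"

definition forms_deg :: "nat \<Rightarrow> int \<Rightarrow> ('g list \<Rightarrow> 'g) set" where
  "forms_deg k l = {f \<in> forms k. \<forall>is xs. length is = k \<and> length xs = k \<and>
     (\<forall>j<k. is ! j < 0 \<and> pr (is ! j) (xs ! j) = xs ! j) \<longrightarrow> pr (sum_list is + l) (f xs) = f xs}"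

lemmas formsI = alt_modI[where N = "fil \<gg> 0"]
lemmas formsD = alt_modD[where N = "fil \<gg> 0"]

lemma subspace_forms: "subspace (forms k)"
  by (rule subspace_alt_mod)

lemma forms_eqI: "f \<in> forms k \<Longrightarrow> g \<in> forms k \<Longrightarrow> (\<And>xs. length xs = k \<Longrightarrow> f xs = g xs) \<Longrightarrow> f = g"
  by (rule alt_mod_eqI)

lemma finite_neg_degs [simp]: "finite (neg_degs k)"
  unfolding neg_degs_def by (rule finite_lists_length_eq) simp

lemma neg_degs_iff: "is \<in> neg_degs k \<longleftrightarrow> length is = k \<and> (\<forall>j<k. is ! j \<in> degs \<and> is ! j < 0)"
  by (auto simp: neg_degs_def all_set_conv_all_nth subset_iff in_set_conv_nth)

lemma span_homog: "span {y. \<exists>i\<ge>d. pr i y = y} = fil \<gg> d"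
proof
  have "pr i y = y \<Longrightarrow> d \<le> i \<Longrightarrow> y \<in> fil \<gg> d" for i y
    using pr_in_fil[of i y] fil_antimono[of d i] by auto
  then show "span {y. \<exists>i\<ge>d. pr i y = y} \<subseteq> fil \<gg> d"
    by (intro span_minimal fil_subspace) auto
  show "fil \<gg> d \<subseteq> span {y. \<exists>i\<ge>d. pr i y = y}"
  proof
    fix x assume x: "x \<in> fil \<gg> d"
    have "pr i x \<in> span {y. \<exists>i\<ge>d. pr i y = y}" for i
    proof (cases "i < d")
      case True
      then show ?thesis using x by (simp add: fil_iff span_zero)
    qed (auto intro!: span_base exI[of _ i])
    then have "(\<Sum>i\<in>degs. pr i x) \<in> span {y. \<exists>i\<ge>d. pr i y = y}" by (intro span_sum)
    then show "x \<in> span {y. \<exists>i\<ge>d. pr i y = y}" by (simp add: pr_sum_degs)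
  qed
qed

text \<open>
  To locate the value of a multilinear map on arguments from given filtration components, it
  suffices to consider homogeneous arguments of negative degree in these components.
\<close>

lemma homog_neg_induct:
  assumes g: "multilinear k g" and zero: "\<And>xs i. length xs = k \<Longrightarrow> i < k \<Longrightarrow> xs ! i \<in> fil \<gg> 0 \<Longrightarrow> g xs = 0"
    and W: "subspace W"
    and homog: "\<And>is ys. length is = k \<Longrightarrow> length ys = k \<Longrightarrow>
      (\<And>j. j < k \<Longrightarrow> is ! j < 0 \<and> ds j \<le> is ! j \<and> pr (is ! j) (ys ! j) = ys ! j) \<Longrightarrow> g ys \<in> W"
    and xs: "length xs = k" "\<And>j. j < k \<Longrightarrow> xs ! j \<in> fil \<gg> (ds j)"
  shows "g xs \<in> W"
proof (rule multilinear_span[OF g W _ xs(1)])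
  show "xs ! i \<in> span {y. \<exists>d\<ge>ds i. pr d y = y}" if "i < k" for i
    using xs(2)[OF that] by (simp add: span_homog)
  fix ys assume ys: "length ys = k" "\<And>i. i < k \<Longrightarrow> ys ! i \<in> {y. \<exists>d\<ge>ds i. pr d y = y}"
  then have "\<forall>i. \<exists>d. i < k \<longrightarrow> d \<ge> ds i \<and> pr d (ys ! i) = ys ! i" by blast
  then obtain D where D: "\<And>i. i < k \<Longrightarrow> D i \<ge> ds i \<and> pr (D i) (ys ! i) = ys ! i" by metis
  show "g ys \<in> W"
  proof (cases "\<forall>i<k. D i < 0")
    case True
    then show ?thesis using D ys(1) by (intro homog[of "map D [0..<k]"]) auto
  next
    case False
    then obtain i where i: "i < k" "D i \<ge> 0" by force
    then have "ys ! i \<in> fil \<gg> 0"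
      using D[OF i(1)] pr_in_fil[of "D i" "ys ! i"] fil_antimono[OF i(2)] by auto
    then show ?thesis using zero[OF ys(1) i(1)] W by (simp add: subspace_0)
  qed
qed

lemma forms_homog_eqI:
  assumes f: "f \<in> forms k" and g: "g \<in> forms k"
    and eq: "\<And>is ys. length is = k \<Longrightarrow> length ys = k \<Longrightarrow>
      (\<And>j. j < k \<Longrightarrow> is ! j < 0 \<and> pr (is ! j) (ys ! j) = ys ! j) \<Longrightarrow> f ys = g ys"
  shows "f = g"
proof (rule forms_eqI[OF f g])
  have h: "f - g \<in> forms k" using f g subspace_forms subspace_diff by blast
  fix xs :: "'g list" assume xs: "length xs = k"
  have "(f - g) xs \<in> {0}"
  proof (rule homog_neg_induct[OF formsD(2)[OF h], where ds = "\<lambda>_. - int (depth \<gg>)"])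
    show "xs ! j \<in> fil \<gg> (- int (depth \<gg>))" for j by (simp add: fil_bottom)
    show "(f - g) ys \<in> {0}" if "length is = k" "length ys = k"
      "\<And>j. j < k \<Longrightarrow> is ! j < 0 \<and> - int (depth \<gg>) \<le> is ! j \<and> pr (is ! j) (ys ! j) = ys ! j" for "is" ys
      using eq[OF that(1,2)] that(3) by simp
  qed (use xs formsD(5)[OF h] in \<open>auto simp: subspace_0\<close>)
  then show "f xs = g xs" by simp
qed

lemma hcomp_homog:
  assumes f: "f \<in> forms k" and len: "length is = k" "length xs = k"
    and homog: "\<And>j. j < k \<Longrightarrow> is ! j < 0 \<and> pr (is ! j) (xs ! j) = xs ! j"
  shows "hcomp k l f xs = pr (sum_list is + l) (f xs)"
proof -
  have eq: "f (map2 pr js xs) = (if js = is then f xs else 0)" if js: "js \<in> neg_degs k" for js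
  proof (cases "js = is")
    case True
    have "map2 pr is xs = xs" using len homog by (intro nth_equalityI) auto
    then show ?thesis using True by simp
  next
    case False
    have lenj: "length js = k" using js by (simp add: neg_degs_def)
    then obtain j where j: "j < k" "js ! j \<noteq> is ! j" using len False nth_equalityI by metis
    have "map2 pr js xs ! j = pr (js ! j) (pr (is ! j) (xs ! j))"
      using j lenj len homog by simp
    also have "\<dots> = 0" using j(2) by (simp add: pr_pr)
    finally have "f (map2 pr js xs) = 0"
      using j lenj len subspace_0[OF fil_subspace] by (intro formsD(5)[OF f, of _ j]) auto
    then show ?thesis using False by simp
  qed
  have "hcomp k l f xs = (\<Sum>js\<in>neg_degs k. if js = is then pr (sum_list is + l) (f xs) else 0)"
  proof -
    have "pr (sum_list js + l) (f (map2 pr js xs)) = (if js = is then pr (sum_list is + l) (f xs) else 0)"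
      if "js \<in> neg_degs k" for js using eq[OF that] by simp
    then show ?thesis using len by (simp add: hcomp_def)
  qed
  also have "\<dots> = (if is \<in> neg_degs k then pr (sum_list is + l) (f xs) else 0)" by simp
  also have "\<dots> = pr (sum_list is + l) (f xs)"
  proof (cases "is \<in> neg_degs k")
    case False
    then obtain j where j: "j < k" "is ! j \<notin> degs"
      using len homog by (auto simp: neg_degs_iff)
    then have "xs ! j = 0" using homog[OF j(1)] pr_outside by metis
    then have "f xs = 0" using j len subspace_0[OF fil_subspace] by (intro formsD(5)[OF f, of _ j]) auto
    then show ?thesis by simp
  qed simp
  finally show ?thesis .
qed

lemma hcomp_forms:
  assumes f: "f \<in> forms k"
  shows "hcomp k l f \<in> forms k"
proof (rule formsI)
  fix xs :: "'g list" and i assume xs: "length xs = k" and i: "i < k"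
  have "linear (\<lambda>x. pr n (f (map2 pr js (xs[i := x]))))" if "js \<in> neg_degs k" for js n
  proof -
    have js: "length js = k" using that by (simp add: neg_degs_def)
    have upd: "map2 pr js (xs[i := x]) = (map2 pr js xs)[i := pr (js ! i) x]" for x
      using js xs i by (intro nth_equalityI) (auto simp: nth_list_update)
    have "linear (\<lambda>x. f ((map2 pr js xs)[i := x]))"
      using formsD(3)[OF f, of "map2 pr js xs" i] js xs i by simp
    then have "linear (pr n \<circ> ((\<lambda>x. f ((map2 pr js xs)[i := x])) \<circ> pr (js ! i)))"
      by (intro linear_compose pr_linear)
    then show ?thesis by (simp add: upd o_def)
  qed
  then show "linear (\<lambda>x. hcomp k l f (xs[i := x]))"
    using xs unfolding hcomp_def by (simp add: linear_compose_sum)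
next
  fix xs :: "'g list" and i assume xs: "length xs = k" and i: "i < k" and 0: "xs ! i \<in> fil \<gg> 0"
  have "f (map2 pr js xs) = 0" if "js \<in> neg_degs k" for js
  proof (rule formsD(5)[OF f _ i])
    have js: "length js = k" "js ! i < 0" using that i by (auto simp: neg_degs_iff)
    then show "length (map2 pr js xs) = k" using xs by simp
    show "map2 pr js xs ! i \<in> fil \<gg> 0" using js xs i 0 by (simp add: pr_fil_zero subspace_0 fil_subspace)
  qed
  then show "hcomp k l f xs = 0" by (simp add: hcomp_def)
next
  fix xs :: "'g list" and i j
  assume xs: "length xs = k" and ij: "i < k" "j < k" "i \<noteq> j" "xs ! i = xs ! j"
  \<comment> \<open>exchanging the degrees of the two equal arguments is an involution changing the sign of
      each summand\<close>
  define \<sigma> where "\<sigma> js = js[i := js ! j, j := js ! i]" for js :: "int list"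
  define T where "T js = pr (sum_list js + l) (f (map2 pr js xs))" for js
  have \<sigma>: "\<sigma> js \<in> neg_degs k" "\<sigma> (\<sigma> js) = js" "T (\<sigma> js) = - T js" if "js \<in> neg_degs k" for js
  proof -
    have js: "length js = k" using that by (simp add: neg_degs_def)
    have "mset (\<sigma> js) = mset js" unfolding \<sigma>_def using js ij by (intro mset_swap) auto
    then have s: "set (\<sigma> js) = set js" "sum_list (\<sigma> js) = sum_list js"
      by (metis set_mset_mset, metis sum_mset_sum_list)
    show "\<sigma> js \<in> neg_degs k" using that s by (simp add: neg_degs_def \<sigma>_def)
    show "\<sigma> (\<sigma> js) = js" unfolding \<sigma>_def using js ij
      by (intro nth_equalityI) (auto simp: nth_list_update)
    let ?zs = "map2 pr js xs"
    have "map2 pr (\<sigma> js) xs = ?zs[i := ?zs ! j, j := ?zs ! i]"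
      unfolding \<sigma>_def using js ij xs by (intro nth_equalityI) (auto simp: nth_list_update)
    then have "f (map2 pr (\<sigma> js) xs) = - f ?zs"
      using alt_mod_swap[of f k "fil \<gg> 0" ?zs i j] f js xs ij by simp
    then show "T (\<sigma> js) = - T js" by (simp add: T_def s)
  qed
  have "(\<Sum>js\<in>neg_degs k. T js) = (\<Sum>js\<in>neg_degs k. T (\<sigma> js))"
    by (rule sum.reindex_bij_witness[of _ \<sigma> \<sigma>]) (use \<sigma> in auto)
  also have "\<dots> = - (\<Sum>js\<in>neg_degs k. T js)" by (simp add: \<sigma> sum_negf)
  finally have "(\<Sum>js\<in>neg_degs k. T js) = 0" by (rule eq_neg_self_imp_zero)
  then show "hcomp k l f xs = 0" by (simp add: hcomp_def T_def)
qed (simp add: hcomp_def)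

lemma linear_hcomp: "linear (hcomp k l)"
  by (rule linearI) (auto simp: hcomp_def fun_eq_iff sum.distrib scaleR_sum_right)

lemma subspace_forms_fil: "subspace (forms_fil k l)"
  using subspace_forms[of k] fil_subspace
  by (intro subspaceI) (auto simp: forms_fil_def subspace_0 subspace_add subspace_scale)

lemma subspace_forms_deg: "subspace (forms_deg k l)"
  using subspace_forms[of k]
  by (intro subspaceI) (auto simp: forms_deg_def subspace_0 subspace_add subspace_scale)

lemma hcomp_deg: assumes "f \<in> forms k" shows "hcomp k l f \<in> forms_deg k l"
  unfolding forms_deg_def using hcomp_forms[OF assms] hcomp_homog[OF assms] by auto

lemma hcomp_of_deg: assumes "f \<in> forms_deg k l" shows "hcomp k l f = f"
proof (rule forms_homog_eqI)
  show f: "f \<in> forms k" using assms by (simp add: forms_deg_def)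
  then show "hcomp k l f \<in> forms k" by (rule hcomp_forms)
  show "hcomp k l f ys = f ys" if "length is = k" "length ys = k"
    "\<And>j. j < k \<Longrightarrow> is ! j < 0 \<and> pr (is ! j) (ys ! j) = ys ! j" for "is" ys
    using hcomp_homog[OF f that] assms that by (auto simp: forms_deg_def)
qed

lemma hcomp_of_other_deg: assumes "f \<in> forms_deg k m" "l \<noteq> m" shows "hcomp k l f = 0"
proof (rule forms_homog_eqI)
  have f: "f \<in> forms k" using assms by (simp add: forms_deg_def)
  then show "hcomp k l f \<in> forms k" by (rule hcomp_forms)
  show "0 \<in> forms k" by (simp add: subspace_0 subspace_forms)
  show "hcomp k l f ys = 0 ys" if "length is = k" "length ys = k"
    "\<And>j. j < k \<Longrightarrow> is ! j < 0 \<and> pr (is ! j) (ys ! j) = ys ! j" for "is" ys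
  proof -
    have "f ys = pr (sum_list is + m) (f ys)" using assms that by (auto simp: forms_deg_def)
    then have "pr (sum_list is + l) (f ys) = 0"
      using assms(2) pr_pr[of "sum_list is + l" "sum_list is + m" "f ys"] by simp
    then show ?thesis using hcomp_homog[OF f that] by simp
  qed
qed

lemma hcomp_hcomp: assumes "f \<in> forms k"
  shows "hcomp k l (hcomp k m f) = (if l = m then hcomp k m f else 0)"
  using hcomp_of_deg[OF hcomp_deg[OF assms]] hcomp_of_other_deg[OF hcomp_deg[OF assms]] by auto

text \<open>
  A finite range of degrees outside of which homogeneous components vanish: \<open>k\<close> arguments of
  negative degree have total degree between \<open>- k * depth \<gg>\<close> and \<open>0\<close>.
\<close>

definition form_degs :: "nat \<Rightarrow> int set" where
  "form_degs k = {- int (depth \<gg>)..int (height \<gg>) + int k * int (depth \<gg>)}"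

lemma forms_decomp: assumes f: "f \<in> forms k"
  shows "(\<Sum>l\<in>form_degs k. hcomp k l f) = f"
proof (rule forms_homog_eqI)
  show "(\<Sum>l\<in>form_degs k. hcomp k l f) \<in> forms k"
    by (intro subspace_sum subspace_forms hcomp_forms f)
  fix "is" and ys :: "'g list" assume len: "length is = k" "length ys = k"
    and homog: "\<And>j. j < k \<Longrightarrow> is ! j < 0 \<and> pr (is ! j) (ys ! j) = ys ! j"
  have "(\<Sum>l\<in>form_degs k. pr (sum_list is + l) (f ys)) = f ys"
  proof (cases "\<forall>j<k. is ! j \<in> degs")
    case True
    have "\<forall>i\<in>set is. - int (depth \<gg>) \<le> i \<and> i \<le> 0"
      using True homog len by (force simp: in_set_conv_nth degs_def)
    then have "sum_list (map (\<lambda>_. - int (depth \<gg>)) is) \<le> sum_list (map (\<lambda>i. i) is)"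
      "sum_list (map (\<lambda>i. i) is) \<le> sum_list (map (\<lambda>_. 0) is)"
      by (intro sum_list_mono; simp)+
    then have bnd: "- (int k * int (depth \<gg>)) \<le> sum_list is" "sum_list is \<le> 0"
      by (simp_all add: len sum_list_triv)
    have "(\<Sum>l\<in>form_degs k. pr (sum_list is + l) (f ys)) =
        (\<Sum>i\<in>(\<lambda>l. sum_list is + l) ` form_degs k. pr i (f ys))"
      by (simp add: sum.reindex)
    also have "\<dots> = (\<Sum>i\<in>degs. pr i (f ys))"
    proof (rule sum.mono_neutral_right)
      show "degs \<subseteq> (\<lambda>l. sum_list is + l) ` form_degs k"
        using bnd by (auto simp: degs_def form_degs_def)
    qed (auto simp: pr_outside form_degs_def)
    finally show ?thesis by (simp add: pr_sum_degs)
  next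
    case False
    then obtain j where j: "j < k" "is ! j \<notin> degs" by auto
    then have "ys ! j = 0" using homog[OF j(1)] pr_outside by metis
    then have "f ys = 0" using j len subspace_0[OF fil_subspace] by (intro formsD(5)[OF f, of _ j]) auto
    then show ?thesis by simp
  qed
  then show "(\<Sum>l\<in>form_degs k. hcomp k l f) ys = f ys"
    by (simp add: sum_fun_apply hcomp_homog[OF f len homog])
qed (rule f)

lemma forms_deg_fil: "forms_deg k l \<subseteq> forms_fil k l"
proof
  fix f assume f: "f \<in> forms_deg k l"
  then have ff: "f \<in> forms k" by (simp add: forms_deg_def)
  have "f xs \<in> fil \<gg> (sum_list is + l)" if len: "length is = k" "length xs = k"
    and xs: "\<And>j. j < k \<Longrightarrow> is ! j < 0 \<and> xs ! j \<in> fil \<gg> (is ! j)" for "is" xs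
  proof (rule homog_neg_induct[OF formsD(2,5)[OF ff] fil_subspace _ len(2), where ds = "\<lambda>j. is ! j"])
    show "xs ! j \<in> fil \<gg> (is ! j)" if "j < k" for j using xs[OF that] by simp
    fix js ys assume l: "length js = k" "length ys = k"
      and h: "\<And>j. j < k \<Longrightarrow> js ! j < 0 \<and> is ! j \<le> js ! j \<and> pr (js ! j) (ys ! j) = ys ! j"
    have "f ys = pr (sum_list js + l) (f ys)" using f l h by (auto simp: forms_deg_def)
    then have "f ys \<in> fil \<gg> (sum_list js + l)" using pr_in_fil by metis
    moreover have "sum_list is \<le> sum_list js" using len l h by (intro sum_list_mono2) auto
    ultimately show "f ys \<in> fil \<gg> (sum_list is + l)"
      using fil_antimono[of "sum_list is + l" "sum_list js + l"] by auto
  qed auto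
  then show "f \<in> forms_fil k l" using ff by (auto simp: forms_fil_def)
qed

text \<open>
  Only the leading parts of the arguments contribute to the leading part of the value of a
  map of homogeneity at least \<open>l\<close>.
\<close>

lemma forms_fil_leading:
  assumes f: "f \<in> forms_fil k l" and len: "length is = k" "length xs = k"
    and xs: "\<And>j. j < k \<Longrightarrow> is ! j < 0 \<and> xs ! j \<in> fil \<gg> (is ! j)"
  shows "pr (sum_list is + l) (f (map2 pr is xs)) = pr (sum_list is + l) (f xs)"
proof -
  let ?n = "sum_list is + l"
  have ff: "f \<in> forms k" using f by (simp add: forms_fil_def)
  define g where "g xs = pr ?n (f xs) - pr ?n (f (map2 pr is xs))" for xs
  have "g xs \<in> {0}"
  proof (rule homog_neg_induct[OF _ _ _ _ len(2), where ds = "\<lambda>j. is ! j"])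
    show "multilinear k g"
      unfolding multilinear_def
    proof (intro allI impI)
      fix xs :: "'g list" and i assume xs: "length xs = k" and i: "i < k"
      have upd: "map2 pr is (xs[i := x]) = (map2 pr is xs)[i := pr (is ! i) x]" for x
        using len xs i by (intro nth_equalityI) (auto simp: nth_list_update)
      have "linear (pr ?n \<circ> (\<lambda>x. f (xs[i := x])))"
        by (intro linear_compose pr_linear formsD(3)[OF ff xs i])
      moreover have "linear (pr ?n \<circ> ((\<lambda>x. f ((map2 pr is xs)[i := x])) \<circ> pr (is ! i)))"
        using formsD(3)[OF ff, of "map2 pr is xs" i] len xs i
        by (intro linear_compose pr_linear) simp
      ultimately show "linear (\<lambda>x. g (xs[i := x]))"
        unfolding g_def upd by (simp add: o_def linear_compose_sub)
    qed
    show "g xs = 0" if "length xs = k" "i < k" "xs ! i \<in> fil \<gg> 0" for xs i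
    proof -
      have "f xs = 0" by (rule formsD(5)[OF ff that])
      moreover have "is ! i < 0" using xs that by blast
      then have "f (map2 pr is xs) = 0"
        using that len subspace_0[OF fil_subspace]
        by (intro formsD(5)[OF ff, of _ i]) (auto simp: pr_fil_zero)
      ultimately show ?thesis by (simp add: g_def)
    qed
    show "xs ! j \<in> fil \<gg> (is ! j)" if "j < k" for j using xs[OF that] by simp
    fix js ys assume l: "length js = k" "length ys = k"
      and h: "\<And>j. j < k \<Longrightarrow> js ! j < 0 \<and> is ! j \<le> js ! j \<and> pr (js ! j) (ys ! j) = ys ! j"
    show "g ys \<in> {0}"
    proof (cases "js = is")
      case True
      then have "map2 pr is ys = ys" using l h by (intro nth_equalityI) auto
      then show ?thesis by (simp add: g_def)
    next
      case False
      then obtain j where j: "j < k" "js ! j \<noteq> is ! j" using len l nth_equalityI by metis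
      have "map2 pr is ys ! j = pr (is ! j) (pr (js ! j) (ys ! j))" using j l len h by simp
      also have "\<dots> = 0" using j(2) by (simp add: pr_pr)
      finally have 0: "f (map2 pr is ys) = 0"
        using j len l subspace_0[OF fil_subspace] by (intro formsD(5)[OF ff, of _ j]) auto
      have "sum_list is < sum_list js"
        using len l h False by (intro sum_list_strict_mono) auto
      moreover have "ys ! j \<in> fil \<gg> (js ! j)" if "j < k" for j
        using h[OF that] pr_in_fil[of "js ! j" "ys ! j"] by simp
      then have "f ys \<in> fil \<gg> (sum_list js + l)" using f l h by (auto simp: forms_fil_def)
      ultimately have "pr ?n (f ys) = 0" by (intro pr_fil_zero) auto
      then show ?thesis by (simp add: g_def 0)
    qed
  qed (auto simp: subspace_0)
  then show ?thesis by (simp add: g_def)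
qed

lemma hcomp_leading:
  assumes f: "f \<in> forms_fil k l" and len: "length is = k" "length xs = k"
    and xs: "\<And>j. j < k \<Longrightarrow> is ! j < 0 \<and> xs ! j \<in> fil \<gg> (is ! j)"
  shows "hcomp k l f (map2 pr is xs) = pr (sum_list is + l) (f xs)"
proof -
  have ff: "f \<in> forms k" using f by (simp add: forms_fil_def)
  have "hcomp k l f (map2 pr is xs) = pr (sum_list is + l) (f (map2 pr is xs))"
    using len xs by (intro hcomp_homog[OF ff]) auto
  then show ?thesis using forms_fil_leading[OF assms] by simp
qed

lemma hcomp_zero_iff:
  assumes f: "f \<in> forms_fil k l"
  shows "hcomp k l f = 0 \<longleftrightarrow> f \<in> forms_fil k (l + 1)"
proof
  have ff: "f \<in> forms k" using f by (simp add: forms_fil_def)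
  assume 0: "hcomp k l f = 0"
  have "f xs \<in> fil \<gg> (sum_list is + l + 1)" if "length is = k" "length xs = k"
    "\<forall>j<k. is ! j < 0 \<and> xs ! j \<in> fil \<gg> (is ! j)" for "is" xs
  proof -
    have "f xs \<in> fil \<gg> (sum_list is + l)" using f that by (auto simp: forms_fil_def)
    moreover have "pr (sum_list is + l) (f xs) = 0"
      using hcomp_leading[OF f that(1,2)] that(3) 0 by simp
    ultimately show ?thesis using pr_fil_eq by fastforce
  qed
  then show "f \<in> forms_fil k (l + 1)" using ff by (auto simp: forms_fil_def add.assoc)
next
  assume f': "f \<in> forms_fil k (l + 1)"
  then have ff: "f \<in> forms k" by (simp add: forms_fil_def)
  show "hcomp k l f = 0"
  proof (rule forms_homog_eqI)
    show "hcomp k l f \<in> forms k" by (rule hcomp_forms[OF ff])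
    show "0 \<in> forms k" by (simp add: subspace_0 subspace_forms)
    fix "is" ys assume l: "length is = k" "length ys = k"
      and h: "\<And>j. j < k \<Longrightarrow> is ! j < 0 \<and> pr (is ! j) (ys ! j) = ys ! j"
    have "ys ! j \<in> fil \<gg> (is ! j)" if "j < k" for j
      using h[OF that] pr_in_fil[of "is ! j" "ys ! j"] by simp
    then have "f ys \<in> fil \<gg> (sum_list is + (l + 1))" using f' l h by (auto simp: forms_fil_def)
    then have "pr (sum_list is + l) (f ys) = 0" by (intro pr_fil_zero) auto
    then show "hcomp k l f ys = 0 ys" using hcomp_homog[OF ff l h] by simp
  qed
qed

end

context graded_splitting
begin

section \<open>Filtered multilinear maps and cochains in coordinates\<close>

lemma neg_space_simps [simp]:
  "\<zero>\<^bsub>neg_space \<gg>\<^esub> = \<zero>\<^bsub>gr_space \<gg>\<^esub>" "a \<oplus>\<^bsub>neg_space \<gg>\<^esub> b = a \<oplus>\<^bsub>gr_space \<gg>\<^esub> b"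
  "r \<odot>\<^bsub>neg_space \<gg>\<^esub> a = r \<odot>\<^bsub>gr_space \<gg>\<^esub> a"
  by (simp_all add: neg_space_def)

text \<open>
  Coordinates on \<open>maps \<gg> k\<close> and on \<open>cochains \<gg> k\<close>: in the first case \<open>\<gg>\<close> is projected to
  \<open>\<gg> / fil \<gg> 0\<close>, in the second one to the negative part of the associated graded space.
\<close>

sublocale Mp: quotient_coords type_space id "quot_space UNIV (fil \<gg> 0)" "\<lambda>x. x +o fil \<gg> 0" "fil \<gg> 0"
proof (rule quotient_coords.intro[OF lin_coords_type_space], rule quotient_coords_axioms.intro)
  show "range (\<lambda>x. x +o fil \<gg> 0) = carrier (quot_space UNIV (fil \<gg> 0))" by auto
qed (simp_all add: coset_add coset_scale coset_eq_iff fil_subspace)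

sublocale Cp: quotient_coords "gr_space \<gg>" of_gr "neg_space \<gg>" "\<lambda>x. to_gr (neg x)" "fil \<gg> 0"
proof (rule quotient_coords.intro[OF lin_coords_gr_space], rule quotient_coords_axioms.intro)
  show "range (\<lambda>x. to_gr (neg x)) = carrier (neg_space \<gg>)"
    using neg_space_cases to_gr_neg_space_iff by (metis (no_types, lifting) neg_neg rangeI image_subsetI subsetI subset_antisym)
  show "to_gr (neg (r *\<^sub>R x + s *\<^sub>R y)) =
      r \<odot>\<^bsub>neg_space \<gg>\<^esub> to_gr (neg x) \<oplus>\<^bsub>neg_space \<gg>\<^esub> s \<odot>\<^bsub>neg_space \<gg>\<^esub> to_gr (neg y)" for r x s y
    by (simp only: neg_space_simps to_gr_add to_gr_smult linear_add[OF neg_linear] linear_scale[OF neg_linear])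
  show "to_gr (neg x) = to_gr (neg y) \<longleftrightarrow> x - y \<in> fil \<gg> 0" for x y
    by (simp add: neg_eq_iff)
qed

lemma coords_maps: "lin_coords (maps \<gg> k) (forms k) (Mp.pull k)"
  unfolding maps_def by (rule Mp.lin_coords_alt_space)

lemma coords_cochains: "lin_coords (cochains \<gg> k) (forms k) (Cp.pull k)"
  unfolding cochains_def by (rule Cp.lin_coords_alt_space)

lemma maps_fil_iff:
  assumes "\<alpha> \<in> carrier (maps \<gg> k)"
  shows "\<alpha> \<in> maps_fil \<gg> k l \<longleftrightarrow> Mp.pull k \<alpha> \<in> forms_fil k l"
  using assms lin_coords.e_closed[OF coords_maps assms]
  unfolding maps_fil_def forms_fil_def mem_Collect_eq by (auto simp: Mp.pull_def)

lemma maps_fil_carrier: "maps_fil \<gg> k l \<subseteq> carrier (maps \<gg> k)"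
  by (auto simp: maps_fil_def)

lemma cochain_apply:
  assumes "\<phi> \<in> carrier (cochains \<gg> k)" "length xs = k"
  shows "\<phi> (map (\<lambda>x. to_gr (neg x)) xs) = to_gr (Cp.pull k \<phi> xs)"
proof -
  have "\<phi> (map (\<lambda>x. to_gr (neg x)) xs) \<in> carrier (gr_space \<gg>)"
    using assms Cp.map_q_tuples[OF assms(2)] unfolding cochains_def Cp.alt_space_simps alt_maps_def
    by blast
  then show ?thesis using assms(2) by (simp add: Cp.pull_def to_gr_of_gr del: gr_space_simps)
qed

lemma homog_neg: assumes "pr i x = x" "i < 0" shows "neg x = x"
  unfolding neg_fixed_iff
proof (intro allI impI)
  fix j :: int assume "0 \<le> j"
  then have "pr j (pr i x) = 0" using assms(2) by (simp add: pr_pr)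
  then show "pr j x = 0" by (simp add: assms(1))
qed

lemma cochains_deg_iff:
  assumes \<phi>: "\<phi> \<in> carrier (cochains \<gg> k)"
  shows "\<phi> \<in> carrier (cochains_deg \<gg> k l) \<longleftrightarrow> Cp.pull k \<phi> \<in> forms_deg k l"
proof -
  have "\<phi> \<in> carrier (cochains_deg \<gg> k l) \<longleftrightarrow> (\<forall>is as. length is = k \<and> length as = k \<and>
      (\<forall>j<k. is ! j < 0 \<and> as ! j \<in> gr_homog \<gg> (is ! j)) \<longrightarrow> \<phi> as \<in> gr_homog \<gg> (sum_list is + l))"
    using \<phi> by (simp add: cochains_deg_def)
  also have "\<dots> \<longleftrightarrow> (\<forall>is xs. length is = k \<and> length xs = k \<and>
     (\<forall>j<k. is ! j < 0 \<and> pr (is ! j) (xs ! j) = xs ! j) \<longrightarrow>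
       pr (sum_list is + l) (Cp.pull k \<phi> xs) = Cp.pull k \<phi> xs)" (is "?L \<longleftrightarrow> ?R")
  proof (intro iffI allI impI)
    fix "is" xs
    assume L: ?L and h: "length is = k \<and> length xs = k \<and> (\<forall>j<k. is ! j < 0 \<and> pr (is ! j) (xs ! j) = xs ! j)"
    have eq: "map to_gr xs = map (\<lambda>x. to_gr (neg x)) xs"
      using h homog_neg by (intro nth_equalityI) auto
    have "\<phi> (map to_gr xs) \<in> gr_homog \<gg> (sum_list is + l)"
      using L h by (auto simp: to_gr_homog_iff)
    then show "pr (sum_list is + l) (Cp.pull k \<phi> xs) = Cp.pull k \<phi> xs"
      using h by (simp add: eq cochain_apply[OF \<phi>] to_gr_homog_iff)
  next
    fix "is" as
    assume R: ?R and h: "length is = k \<and> length as = k \<and> (\<forall>j<k. is ! j < 0 \<and> as ! j \<in> gr_homog \<gg> (is ! j))"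
    define xs where "xs = map of_gr as"
    have as: "as ! j = to_gr (xs ! j)" if "j < k" for j
      using h that to_gr_of_gr[of "as ! j"] by (simp add: xs_def gr_homog_def)
    have xs: "length xs = k" using h by (simp add: xs_def)
    have hom: "is ! j < 0 \<and> pr (is ! j) (xs ! j) = xs ! j" if "j < k" for j
      using h that as[OF that] by (metis to_gr_homog_iff)
    have "neg (xs ! j) = xs ! j" if "j < k" for j using hom[OF that] homog_neg by blast
    then have eq: "as = map (\<lambda>x. to_gr (neg x)) xs"
      using h xs as by (intro nth_equalityI) auto
    have "pr (sum_list is + l) (Cp.pull k \<phi> xs) = Cp.pull k \<phi> xs" using R h xs hom by blast
    then show "\<phi> as \<in> gr_homog \<gg> (sum_list is + l)"
      using xs by (simp add: eq cochain_apply[OF \<phi>] to_gr_homog_iff)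
  qed
  finally show ?thesis
    using lin_coords.e_closed[OF coords_cochains \<phi>] by (simp add: forms_deg_def)
qed

lemma cochains_deg_carrier: "carrier (cochains_deg \<gg> k l) \<subseteq> carrier (cochains \<gg> k)"
  by (auto simp: cochains_deg_def)

lemma cochains_deg_record:
  "cochains_deg \<gg> k l = (cochains \<gg> k)\<lparr>carrier := carrier (cochains_deg \<gg> k l)\<rparr>"
  by (simp add: cochains_deg_def)

lemma cochains_deg_simps [simp]:
  "\<zero>\<^bsub>cochains_deg \<gg> k l\<^esub> = \<zero>\<^bsub>cochains \<gg> k\<^esub>"
  by (simp add: cochains_deg_def)

lemma coords_cochains_deg: "lin_coords (cochains_deg \<gg> k l) (forms_deg k l) (Cp.pull k)"
  by (subst cochains_deg_record, rule lin_coords.restrict[OF coords_cochains])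
    (use cochains_deg_carrier cochains_deg_iff subspace_forms_deg in \<open>auto simp: forms_deg_def\<close>)

section \<open>Passing from filtered maps to graded cochains\<close>

text \<open>
  In coordinates \<^const>\<open>gr_map\<close> is the homogeneous component.  This includes existence and
  uniqueness of the cochain in its definition; uniqueness holds since a cochain is determined by
  its values on homogeneous arguments.
\<close>

lemma gr_map_hcomp:
  assumes \<alpha>: "\<alpha> \<in> maps_fil \<gg> k l"
  shows "gr_map \<gg> k l \<alpha> \<in> carrier (cochains_deg \<gg> k l)"
    and "Cp.pull k (gr_map \<gg> k l \<alpha>) = hcomp k l (Mp.pull k \<alpha>)"
proof -
  interpret C: lin_coords "cochains_deg \<gg> k l" "forms_deg k l" "Cp.pull k"
    by (rule coords_cochains_deg)
  define f where "f = Mp.pull k \<alpha>"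
  have \<alpha>': "\<alpha> \<in> carrier (maps \<gg> k)" using \<alpha> maps_fil_carrier by blast
  have f: "f \<in> forms_fil k l" using \<alpha> \<alpha>' maps_fil_iff by (simp add: f_def)
  then have ff: "f \<in> forms k" by (simp add: forms_fil_def)
  define \<phi> where "\<phi> = C.e_inv (hcomp k l f)"
  have \<phi>: "\<phi> \<in> carrier (cochains_deg \<gg> k l)" "Cp.pull k \<phi> = hcomp k l f"
    using C.e_inv_closed C.e_e_inv hcomp_deg[OF ff] by (simp_all add: \<phi>_def)
  have classes: "map2 (gr_class \<gg>) is xs = map (\<lambda>x. to_gr (neg x)) (map2 pr is xs)"
    if "length is = k" "length xs = k" "\<forall>j<k. is ! j < 0 \<and> xs ! j \<in> fil \<gg> (is ! j)" for "is" xs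
    using that homog_neg[OF pr_idem] by (intro nth_equalityI) (auto simp: gr_class_eq)
  have "gr_map \<gg> k l \<alpha> = \<phi>"
    unfolding gr_map_def
  proof (rule the_equality, intro conjI allI impI)
    fix "is" xs
    assume h: "length is = k \<and> length xs = k \<and> (\<forall>j<k. is ! j < 0 \<and> xs ! j \<in> fil \<gg> (is ! j))"
    have "f xs \<in> fil \<gg> (sum_list is + l)" using f h by (auto simp: forms_fil_def)
    moreover have "Cp.pull k \<phi> (map2 pr is xs) = pr (sum_list is + l) (f xs)"
      unfolding \<phi>(2) using h by (intro hcomp_leading f) auto
    moreover have "\<phi> (map2 (gr_class \<gg>) is xs) = to_gr (Cp.pull k \<phi> (map2 pr is xs))"
      unfolding classes[OF h[THEN conjunct1] h[THEN conjunct2, THEN conjunct1] h[THEN conjunct2, THEN conjunct2]]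
      by (rule cochain_apply) (use h \<phi>(1) cochains_deg_carrier in auto)
    ultimately show "\<phi> (map2 (gr_class \<gg>) is xs)
        = gr_class \<gg> (sum_list is + l) (\<alpha> (map (\<lambda>X. X +o fil \<gg> 0) xs))"
      using h by (simp add: gr_class_eq f_def Mp.pull_def)
  next
    fix \<psi>
    assume \<psi>: "\<psi> \<in> carrier (cochains_deg \<gg> k l) \<and>
      (\<forall>is Xs. length is = k \<and> length Xs = k \<and> (\<forall>j<k. is ! j < 0 \<and> Xs ! j \<in> fil \<gg> (is ! j))
        \<longrightarrow> \<psi> (map2 (gr_class \<gg>) is Xs)
            = gr_class \<gg> (sum_list is + l) (\<alpha> (map (\<lambda>X. X +o fil \<gg> 0) Xs)))"
    have "Cp.pull k \<psi> = Cp.pull k \<phi>"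
    proof (rule forms_homog_eqI)
      show "Cp.pull k \<psi> \<in> forms k" "Cp.pull k \<phi> \<in> forms k"
        using \<psi> \<phi>(1) C.e_closed by (auto simp: forms_deg_def)
      fix "is" ys assume l: "length is = k" "length ys = k"
        and h: "\<And>j. j < k \<Longrightarrow> is ! j < 0 \<and> pr (is ! j) (ys ! j) = ys ! j"
      have h': "\<forall>j<k. is ! j < 0 \<and> ys ! j \<in> fil \<gg> (is ! j)"
        using h pr_in_fil by metis
      have "map2 pr is ys = ys" using l h by (intro nth_equalityI) auto
      then have "map2 (gr_class \<gg>) is ys = map (\<lambda>x. to_gr (neg x)) ys"
        using classes[OF l h'] by (simp only:)
      moreover have "\<psi> \<in> carrier (cochains \<gg> k)" using \<psi> cochains_deg_carrier by blast
      ultimately have "to_gr (Cp.pull k \<psi> ys) = \<psi> (map2 (gr_class \<gg>) is ys)"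
        using cochain_apply[of \<psi> k ys] l(2) by (simp only:)
      also have "\<dots> = gr_class \<gg> (sum_list is + l) (f ys)"
        using \<psi> l h' by (auto simp: f_def Mp.pull_def)
      also have "\<dots> = to_gr (pr (sum_list is + l) (f ys))"
        using f l h' by (intro gr_class_eq) (auto simp: forms_fil_def)
      finally have "Cp.pull k \<psi> ys = pr (sum_list is + l) (f ys)" by simp
      then show "Cp.pull k \<psi> ys = Cp.pull k \<phi> ys"
        using \<phi>(2) hcomp_homog[OF ff l h] by simp
    qed
    then show "\<psi> = \<phi>" using \<psi> \<phi>(1) C.e_eq_iff by blast
  qed (rule \<phi>(1))
  then show "gr_map \<gg> k l \<alpha> \<in> carrier (cochains_deg \<gg> k l)"
    "Cp.pull k (gr_map \<gg> k l \<alpha>) = hcomp k l (Mp.pull k \<alpha>)" using \<phi> by (simp_all add: f_def)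
qed

lemma gr_map_surj:
  assumes \<phi>: "\<phi> \<in> carrier (cochains_deg \<gg> k l)"
  obtains \<alpha> where "\<alpha> \<in> maps_fil \<gg> k l" "gr_map \<gg> k l \<alpha> = \<phi>"
proof -
  interpret C: lin_coords "cochains_deg \<gg> k l" "forms_deg k l" "Cp.pull k"
    by (rule coords_cochains_deg)
  interpret M: lin_coords "maps \<gg> k" "forms k" "Mp.pull k" by (rule coords_maps)
  have deg: "Cp.pull k \<phi> \<in> forms_deg k l" using C.e_closed[OF \<phi>] .
  then have form: "Cp.pull k \<phi> \<in> forms k" by (simp add: forms_deg_def)
  define \<alpha> where "\<alpha> = M.e_inv (Cp.pull k \<phi>)"
  have \<alpha>: "\<alpha> \<in> carrier (maps \<gg> k)" "Mp.pull k \<alpha> = Cp.pull k \<phi>"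
    using form by (simp_all add: \<alpha>_def M.e_inv_closed M.e_e_inv)
  then have \<alpha>': "\<alpha> \<in> maps_fil \<gg> k l" using deg forms_deg_fil maps_fil_iff by auto
  have "Cp.pull k (gr_map \<gg> k l \<alpha>) = Cp.pull k \<phi>"
    using gr_map_hcomp(2)[OF \<alpha>'] \<alpha>(2) hcomp_of_deg[OF deg] by simp
  then show ?thesis using that[OF \<alpha>'] gr_map_hcomp(1)[OF \<alpha>'] \<phi> C.e_eq_iff by blast
qed

lemma gr_map_eq_zero_iff:
  assumes \<alpha>: "\<alpha> \<in> maps_fil \<gg> k l"
  shows "gr_map \<gg> k l \<alpha> = \<zero>\<^bsub>cochains \<gg> k\<^esub> \<longleftrightarrow> \<alpha> \<in> maps_fil \<gg> k (l + 1)"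
proof -
  interpret C: lin_coords "cochains \<gg> k" "forms k" "Cp.pull k" by (rule coords_cochains)
  have \<alpha>': "\<alpha> \<in> carrier (maps \<gg> k)" using \<alpha> maps_fil_carrier by blast
  have "gr_map \<gg> k l \<alpha> = \<zero>\<^bsub>cochains \<gg> k\<^esub> \<longleftrightarrow> hcomp k l (Mp.pull k \<alpha>) = 0"
    using C.e_eq_zero_iff[OF subsetD[OF cochains_deg_carrier gr_map_hcomp(1)[OF \<alpha>]]]
      gr_map_hcomp(2)[OF \<alpha>] by simp
  also have "\<dots> \<longleftrightarrow> Mp.pull k \<alpha> \<in> forms_fil k (l + 1)"
    using \<alpha> \<alpha>' maps_fil_iff by (intro hcomp_zero_iff) simp
  finally show ?thesis using \<alpha>' maps_fil_iff by simp
qed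

text \<open>
  Terms of higher homogeneity do not affect the image under \<^const>\<open>gr_map\<close>.
\<close>

lemma gr_map_minus_higher:
  assumes \<alpha>: "\<alpha> \<in> maps_fil \<gg> k l" and \<beta>: "\<beta> \<in> maps_fil \<gg> k (l + 1)"
  shows "\<alpha> \<ominus>\<^bsub>maps \<gg> k\<^esub> \<beta> \<in> maps_fil \<gg> k l" and "gr_map \<gg> k l (\<alpha> \<ominus>\<^bsub>maps \<gg> k\<^esub> \<beta>) = gr_map \<gg> k l \<alpha>"
proof -
  interpret M: lin_coords "maps \<gg> k" "forms k" "Mp.pull k" by (rule coords_maps)
  interpret M': module real_ring "maps \<gg> k" by (rule M.module)
  interpret C: lin_coords "cochains_deg \<gg> k l" "forms_deg k l" "Cp.pull k"
    by (rule coords_cochains_deg)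
  have c: "\<alpha> \<in> carrier (maps \<gg> k)" "\<beta> \<in> carrier (maps \<gg> k)" using \<alpha> \<beta> maps_fil_carrier by blast+
  have f: "Mp.pull k \<alpha> \<in> forms_fil k l" "Mp.pull k \<beta> \<in> forms_fil k (l + 1)"
    using \<alpha> \<beta> c maps_fil_iff by auto
  have f': "Mp.pull k \<beta> \<in> forms_fil k l"
  proof -
    have "fil \<gg> (i + (l + 1)) \<subseteq> fil \<gg> (i + l)" for i by (rule fil_antimono) simp
    then show ?thesis using f(2) unfolding forms_fil_def by blast
  qed
  have pull: "Mp.pull k (\<alpha> \<ominus>\<^bsub>maps \<gg> k\<^esub> \<beta>) = Mp.pull k \<alpha> - Mp.pull k \<beta>" using c by (rule M.e_minus)
  show *: "\<alpha> \<ominus>\<^bsub>maps \<gg> k\<^esub> \<beta> \<in> maps_fil \<gg> k l"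
    using c f(1) f' subspace_forms_fil by (simp add: maps_fil_iff pull subspace_diff)
  have "hcomp k l (Mp.pull k \<beta>) = 0" using hcomp_zero_iff[OF f'] f(2) by simp
  then have "Cp.pull k (gr_map \<gg> k l (\<alpha> \<ominus>\<^bsub>maps \<gg> k\<^esub> \<beta>)) = Cp.pull k (gr_map \<gg> k l \<alpha>)"
    using gr_map_hcomp(2)[OF *] gr_map_hcomp(2)[OF \<alpha>] by (simp add: pull linear_diff[OF linear_hcomp])
  then show "gr_map \<gg> k l (\<alpha> \<ominus>\<^bsub>maps \<gg> k\<^esub> \<beta>) = gr_map \<gg> k l \<alpha>"
    using gr_map_hcomp(1)[OF *] gr_map_hcomp(1)[OF \<alpha>] C.e_eq_iff by blast
qed

lemma linear_maps_cochains_eqI: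
  assumes \<Psi>: "\<Psi> \<in> linear_maps (cochains \<gg> k) (cochains \<gg> k')" "\<Psi>' \<in> linear_maps (cochains \<gg> k) (cochains \<gg> k')"
    and eq: "\<And>l \<phi>. \<phi> \<in> carrier (cochains_deg \<gg> k l) \<Longrightarrow> \<Psi> \<phi> = \<Psi>' \<phi>"
  shows "\<Psi> = \<Psi>'"
proof -
  interpret C: lin_coords "cochains \<gg> k" "forms k" "Cp.pull k" by (rule coords_cochains)
  interpret C': lin_coords "cochains \<gg> k'" "forms k'" "Cp.pull k'" by (rule coords_cochains)
  interpret CC': lin_coords_pair "cochains \<gg> k" "forms k" "Cp.pull k" "cochains \<gg> k'" "forms k'" "Cp.pull k'" ..
  have lin: "linear_between (cochains \<gg> k) (cochains \<gg> k') \<Psi>" "linear_between (cochains \<gg> k) (cochains \<gg> k') \<Psi>'"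
    using \<Psi> linear_maps_linear_between by auto
  have "\<Psi> \<phi> = \<Psi>' \<phi>" if \<phi>: "\<phi> \<in> carrier (cochains \<gg> k)" for \<phi>
  proof -
    let ?f = "Cp.pull k \<phi>"
    have f: "?f \<in> forms k" using C.e_closed[OF \<phi>] .
    let ?\<phi> = "\<lambda>l. C.e_inv (hcomp k l ?f)"
    have deg: "?\<phi> l \<in> carrier (cochains_deg \<gg> k l)" for l
      using hcomp_deg[OF f] hcomp_forms[OF f] C.e_inv_closed C.e_e_inv by (simp add: cochains_deg_iff)
    have "Cp.pull k' (\<Xi> \<phi>) = (\<Sum>l\<in>form_degs k. Cp.pull k' (\<Xi> (?\<phi> l)))"
      if "linear_between (cochains \<gg> k) (cochains \<gg> k') \<Xi>" for \<Xi>
    proof -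
      have "Cp.pull k' (\<Xi> \<phi>) = Cp.pull k' (\<Xi> (C.e_inv (\<Sum>l\<in>form_degs k. hcomp k l ?f)))"
        using \<phi> by (simp only: forms_decomp[OF f] C.e_inv_e)
      then show ?thesis
        using lin_on_sum[OF CC'.lin_on_coords[OF that] subspace_forms, of "form_degs k" "\<lambda>l. hcomp k l ?f"]
          hcomp_forms[OF f] by simp
    qed
    from this[OF lin(1)] this[OF lin(2)] have "Cp.pull k' (\<Psi> \<phi>) = Cp.pull k' (\<Psi>' \<phi>)"
      using eq[OF deg] by simp
    then show ?thesis using \<phi> lin by (simp add: C'.e_eq_iff linear_betweenD(1))
  qed
  then show ?thesis using \<Psi> unfolding linear_maps_def by (metis (no_types, lifting) PiE_ext mem_Collect_eq)
qed

text \<open>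
  Existence and uniqueness of the map in the definition of \<^const>\<open>gr0\<close>.  In coordinates it is
  \<open>\<Sum>l. hcomp l \<circ> \<Phi> \<circ> hcomp l\<close>.
\<close>

lemma gr0_maps:
  assumes \<Phi>: "\<Phi> \<in> linear_maps (maps \<gg> k) (maps \<gg> k')"
    and fil: "\<And>l. \<Phi> ` maps_fil \<gg> k l \<subseteq> maps_fil \<gg> k' l"
  shows "gr0 \<gg> k k' \<Phi> \<in> linear_maps (cochains \<gg> k) (cochains \<gg> k')"
    and "\<alpha> \<in> maps_fil \<gg> k l \<Longrightarrow> gr0 \<gg> k k' \<Phi> (gr_map \<gg> k l \<alpha>) = gr_map \<gg> k' l (\<Phi> \<alpha>)"
proof -
  interpret C: lin_coords "cochains \<gg> k" "forms k" "Cp.pull k" by (rule coords_cochains)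
  interpret C': lin_coords "cochains \<gg> k'" "forms k'" "Cp.pull k'" by (rule coords_cochains)
  interpret M: lin_coords "maps \<gg> k" "forms k" "Mp.pull k" by (rule coords_maps)
  interpret M': lin_coords "maps \<gg> k'" "forms k'" "Mp.pull k'" by (rule coords_maps)
  interpret CC': lin_coords_pair "cochains \<gg> k" "forms k" "Cp.pull k" "cochains \<gg> k'" "forms k'" "Cp.pull k'" ..
  interpret MM': lin_coords_pair "maps \<gg> k" "forms k" "Mp.pull k" "maps \<gg> k'" "forms k'" "Mp.pull k'" ..
  have \<Phi>l: "linear_between (maps \<gg> k) (maps \<gg> k') \<Phi>" by (rule linear_maps_linear_between[OF \<Phi>])
  define \<Phi>' where "\<Phi>' f = Mp.pull k' (\<Phi> (M.e_inv f))" for f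
  have \<Phi>'l: "lin_on (forms k) \<Phi>'" unfolding \<Phi>'_def by (rule MM'.lin_on_coords[OF \<Phi>l])
  have \<Phi>'c: "\<Phi>' f \<in> forms k'" if "f \<in> forms k" for f
    using that by (simp add: \<Phi>'_def M'.e_closed linear_betweenD(1)[OF \<Phi>l] M.e_inv_closed)
  have \<Phi>'f: "\<Phi>' f \<in> forms_fil k' l" if "f \<in> forms_fil k l" for f l
  proof -
    have f: "f \<in> forms k" using that by (simp add: forms_fil_def)
    then have "M.e_inv f \<in> maps_fil \<gg> k l"
      using that maps_fil_iff[OF M.e_inv_closed[OF f]] M.e_e_inv[OF f] by simp
    then have "\<Phi> (M.e_inv f) \<in> maps_fil \<gg> k' l" using fil by blast
    then show ?thesis using maps_fil_iff maps_fil_carrier unfolding \<Phi>'_def by blast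
  qed
  \<comment> \<open>the sum of the degree-preserving components of \<open>\<Phi>'\<close>\<close>
  define \<Psi>' where "\<Psi>' f = (\<Sum>l\<in>form_degs k. hcomp k' l (\<Phi>' (hcomp k l f)))" for f
  have h\<Phi>l: "lin_on (forms k) (\<lambda>f. hcomp k' l (\<Phi>' (hcomp k l f)))" for l
    unfolding lin_on_def using hcomp_forms lin_onD[OF \<Phi>'l]
    by (simp add: linear_add[OF linear_hcomp] linear_scale[OF linear_hcomp])
  then have \<Psi>'l: "lin_on (forms k) \<Psi>'"
    unfolding lin_on_def \<Psi>'_def by (simp add: sum.distrib scaleR_sum_right)
  have \<Psi>'c: "\<Psi>' ` forms k \<subseteq> forms k'"
    unfolding \<Psi>'_def by (auto intro!: subspace_sum subspace_forms hcomp_forms \<Phi>'c)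
  define \<Psi> where "\<Psi> = (\<lambda>\<phi>\<in>carrier (cochains \<gg> k). C'.e_inv (\<Psi>' (Cp.pull k \<phi>)))"
  have \<Psi>: "\<Psi> \<in> linear_maps (cochains \<gg> k) (cochains \<gg> k')"
    using CC'.linear_between_coords[OF \<Psi>'l \<Psi>'c]
    unfolding linear_maps_def linear_between_def \<Psi>_def by (auto simp: C.closed)
  have \<Psi>_gr: "\<Psi> (gr_map \<gg> k l \<alpha>) = gr_map \<gg> k' l (\<Phi> \<alpha>)" if \<alpha>: "\<alpha> \<in> maps_fil \<gg> k l" for \<alpha> l
  proof -
    have \<alpha>c: "\<alpha> \<in> carrier (maps \<gg> k)" using \<alpha> maps_fil_carrier by blast
    have \<Phi>\<alpha>: "\<Phi> \<alpha> \<in> maps_fil \<gg> k' l" using \<alpha> fil by blast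
    define f where "f = Mp.pull k \<alpha>"
    have f: "f \<in> forms_fil k l" using \<alpha> \<alpha>c maps_fil_iff by (simp add: f_def)
    then have ff: "f \<in> forms k" by (simp add: forms_fil_def)
    let ?g = "hcomp k l f"
    have g: "?g \<in> forms k" by (rule hcomp_forms[OF ff])
    \<comment> \<open>\<open>f\<close> and its leading component \<open>?g\<close> differ by a map of higher homogeneity\<close>
    have "f - ?g \<in> forms_fil k l"
      using f hcomp_deg[OF ff] forms_deg_fil subspace_forms_fil by (intro subspace_diff) auto
    moreover have "hcomp k l (f - ?g) = 0"
      by (simp add: linear_diff[OF linear_hcomp] hcomp_hcomp[OF ff])
    ultimately have "f - ?g \<in> forms_fil k (l + 1)" using hcomp_zero_iff by blast
    then have d1: "\<Phi>' (f - ?g) \<in> forms_fil k' (l + 1)" by (rule \<Phi>'f)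
    have dd: "\<Phi>' (f - ?g) = \<Phi>' f - \<Phi>' ?g" by (rule lin_on_diff[OF \<Phi>'l ff g])
    have d0: "\<Phi>' (f - ?g) \<in> forms_fil k' l" by (rule \<Phi>'f) fact
    have "hcomp k' l (\<Phi>' (f - ?g)) = 0" using hcomp_zero_iff[OF d0] d1 by simp
    then have lead: "hcomp k' l (\<Phi>' ?g) = hcomp k' l (\<Phi>' f)"
      by (simp add: dd linear_diff[OF linear_hcomp])
    have "\<Psi>' ?g = (\<Sum>m\<in>form_degs k. if m = l then hcomp k' l (\<Phi>' ?g) else 0)"
      unfolding \<Psi>'_def using lin_on_zero[OF \<Phi>'l subspace_forms]
      by (auto intro!: sum.cong simp: hcomp_hcomp[OF ff] linear_0[OF linear_hcomp])
    also have "\<dots> = hcomp k' l (\<Phi>' ?g)"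
    proof (cases "l \<in> form_degs k")
      case False
      have "(\<Sum>m\<in>form_degs k. hcomp k m ?g) = (\<Sum>m\<in>form_degs k. 0)"
        using False by (intro sum.cong) (auto simp: hcomp_hcomp[OF ff])
      then have "?g = 0" using forms_decomp[OF g] by simp
      then have "hcomp k' l (\<Phi>' ?g) = 0"
        by (simp add: lin_on_zero[OF \<Phi>'l subspace_forms] linear_0[OF linear_hcomp])
      then show ?thesis using False by (simp add: form_degs_def)
    qed (simp add: form_degs_def)
    finally have "\<Psi>' ?g = hcomp k' l (\<Phi>' f)" using lead by simp
    moreover have "\<Phi>' f = Mp.pull k' (\<Phi> \<alpha>)" by (simp add: \<Phi>'_def f_def M.e_inv_e[OF \<alpha>c])
    ultimately have "\<Psi>' (Cp.pull k (gr_map \<gg> k l \<alpha>)) = Cp.pull k' (gr_map \<gg> k' l (\<Phi> \<alpha>))"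
      using gr_map_hcomp(2)[OF \<alpha>] gr_map_hcomp(2)[OF \<Phi>\<alpha>] by (simp add: f_def)
    then show ?thesis
      using gr_map_hcomp(1)[OF \<alpha>] gr_map_hcomp(1)[OF \<Phi>\<alpha>] cochains_deg_carrier
      by (simp add: \<Psi>_def subset_iff C'.e_inv_e)
  qed
  have "gr0 \<gg> k k' \<Phi> = \<Psi>"
    unfolding gr0_def
  proof (rule the_equality)
    show "\<Psi> \<in> linear_maps (cochains \<gg> k) (cochains \<gg> k') \<and>
      (\<forall>l. \<forall>\<alpha>\<in>maps_fil \<gg> k l. \<Psi> (gr_map \<gg> k l \<alpha>) = gr_map \<gg> k' l (\<Phi> \<alpha>))"
      using \<Psi> \<Psi>_gr by blast
    fix \<Xi> assume \<Xi>: "\<Xi> \<in> linear_maps (cochains \<gg> k) (cochains \<gg> k') \<and>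
      (\<forall>l. \<forall>\<alpha>\<in>maps_fil \<gg> k l. \<Xi> (gr_map \<gg> k l \<alpha>) = gr_map \<gg> k' l (\<Phi> \<alpha>))"
    show "\<Xi> = \<Psi>"
    proof (rule linear_maps_cochains_eqI)
      fix l \<phi> assume "\<phi> \<in> carrier (cochains_deg \<gg> k l)"
      then obtain \<alpha> where "\<alpha> \<in> maps_fil \<gg> k l" "gr_map \<gg> k l \<alpha> = \<phi>" by (rule gr_map_surj)
      then show "\<Xi> \<phi> = \<Psi> \<phi>" using \<Xi> \<Psi>_gr by metis
    qed (use \<Xi> \<Psi> in auto)
  qed
  then show "gr0 \<gg> k k' \<Phi> \<in> linear_maps (cochains \<gg> k) (cochains \<gg> k')"
    "\<alpha> \<in> maps_fil \<gg> k l \<Longrightarrow> gr0 \<gg> k k' \<Phi> (gr_map \<gg> k l \<alpha>) = gr_map \<gg> k' l (\<Phi> \<alpha>)"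
    using \<Psi> \<Psi>_gr by simp_all
qed

end

context graded_splitting
begin

section \<open>The differential in coordinates\<close>

text \<open>
  The differential in coordinates.  That it preserves the spaces of alternating maps is shown for
  \<open>k = 1\<close> and \<open>k = 2\<close>, by explicit formulas.
\<close>

definition cobd :: "nat \<Rightarrow> ('g list \<Rightarrow> 'g) \<Rightarrow> ('g list \<Rightarrow> 'g)" where
  "cobd k f = (\<lambda>xs. if length xs = Suc k
     then (\<Sum>i\<le>k. (-1) ^ i *\<^sub>R grb (neg (xs ! i)) (f (omit i xs)))
        + (\<Sum>(i, j)\<in>{(i, j). i < j \<and> j \<le> k}.
             (-1) ^ (i + j) *\<^sub>R f (grb (neg (xs ! i)) (neg (xs ! j)) # omit i (omit j xs)))
     else 0)"

lemma neg_grb: "neg (grb (neg x) (neg y)) = grb (neg x) (neg y)"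
  unfolding neg_fixed_iff
proof (intro allI impI)
  fix n :: int assume "0 \<le> n"
  then have "pr n (bracket \<gg> (pr i (neg x)) (pr (n - i) (neg y))) = 0" for i
    by (cases "i < 0") (auto simp: pr_neg)
  then show "pr n (grb (neg x) (neg y)) = 0" by (simp add: pr_grb)
qed

lemma omit_map: "omit i (map h xs) = map h (omit i xs)"
  by (simp add: omit_def take_map drop_map)

lemma length_omit: "i < length xs \<Longrightarrow> length (omit i xs) = length xs - 1"
  by (simp add: omit_def)

lemma finite_pairs: "finite {(i, j). i < j \<and> j \<le> (k::nat)}"
  by (rule finite_subset[of _ "{..k} \<times> {..k}"]) auto

lemma differential_apply:
  assumes \<phi>: "\<phi> \<in> carrier (cochains \<gg> k)" and xs: "length xs = Suc k"
  shows "differential \<gg> k \<phi> (map (\<lambda>x. to_gr (neg x)) xs) = to_gr (cobd k (Cp.pull k \<phi>) xs)"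
proof -
  interpret G': module real_ring "gr_space \<gg>" by (rule Cp.W.module)
  let ?q = "\<lambda>x. to_gr (neg x)" and ?f = "Cp.pull k \<phi>"
  let ?as = "map ?q xs"
  have t1: "(-1) ^ i \<odot>\<^bsub>gr_space \<gg>\<^esub> gr_bracket \<gg> (?as ! i) (\<phi> (omit i ?as))
      = to_gr ((-1) ^ i *\<^sub>R grb (neg (xs ! i)) (?f (omit i xs)))" if "i \<in> {..k}" for i
  proof -
    have "\<phi> (omit i ?as) = to_gr (?f (omit i xs))"
      unfolding omit_map using that xs by (intro cochain_apply[OF \<phi>]) (simp add: length_omit)
    moreover have "?as ! i = to_gr (neg (xs ! i))" using that xs by simp
    ultimately show ?thesis by (simp only: gr_bracket_to_gr to_gr_smult)
  qed
  have t2: "(case p of (i, j) \<Rightarrow> (-1) ^ (i + j) \<odot>\<^bsub>gr_space \<gg>\<^esub>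
          \<phi> (gr_bracket \<gg> (?as ! i) (?as ! j) # omit i (omit j ?as)))
      = to_gr (case p of (i, j) \<Rightarrow>
          (-1) ^ (i + j) *\<^sub>R ?f (grb (neg (xs ! i)) (neg (xs ! j)) # omit i (omit j xs)))"
    if pair: "p \<in> {(i, j). i < j \<and> j \<le> k}" for p
  proof -
    obtain i j where p: "p = (i, j)" and ij: "i < j" "j \<le> k" using pair by auto
    let ?ys = "grb (neg (xs ! i)) (neg (xs ! j)) # omit i (omit j xs)"
    have "?as ! i = to_gr (neg (xs ! i))" "?as ! j = to_gr (neg (xs ! j))" using ij xs by simp_all
    then have "gr_bracket \<gg> (?as ! i) (?as ! j) # omit i (omit j ?as) = map ?q ?ys"
      by (simp only: gr_bracket_to_gr omit_map list.map neg_grb)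
    moreover have "\<phi> (map ?q ?ys) = to_gr (?f ?ys)"
      using ij xs by (intro cochain_apply[OF \<phi>]) (simp add: length_omit)
    ultimately show ?thesis by (simp only: p prod.case to_gr_smult)
  qed
  have fin: "finsum (gr_space \<gg>) (\<lambda>i. to_gr (h i)) I = to_gr (\<Sum>i\<in>I. h i)"
    if "finite I" for h :: "'i \<Rightarrow> 'g" and I
  proof -
    have c: "(\<lambda>i. to_gr (h i)) \<in> I \<rightarrow> carrier (gr_space \<gg>)" using to_gr_closed by blast
    have "of_gr (finsum (gr_space \<gg>) (\<lambda>i. to_gr (h i)) I) = of_gr (to_gr (\<Sum>i\<in>I. h i))"
      by (simp only: Cp.W.e_finsum[OF that c] of_gr_to_gr)
    then show ?thesis using Cp.W.e_eq_iff G'.finsum_closed[OF c] to_gr_closed by blast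
  qed
  have s1: "finsum (gr_space \<gg>) (\<lambda>i. (-1) ^ i \<odot>\<^bsub>gr_space \<gg>\<^esub> gr_bracket \<gg> (?as ! i) (\<phi> (omit i ?as))) {..k}
      = to_gr (\<Sum>i\<le>k. (-1) ^ i *\<^sub>R grb (neg (xs ! i)) (?f (omit i xs)))"
    by (subst fin[symmetric], simp, rule G'.finsum_cong'[OF refl]) (use to_gr_closed t1 in blast)+
  have s2: "finsum (gr_space \<gg>) (\<lambda>(i, j). (-1) ^ (i + j) \<odot>\<^bsub>gr_space \<gg>\<^esub>
          \<phi> (gr_bracket \<gg> (?as ! i) (?as ! j) # omit i (omit j ?as))) {(i, j). i < j \<and> j \<le> k}
      = to_gr (\<Sum>(i, j)\<in>{(i, j). i < j \<and> j \<le> k}.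
             (-1) ^ (i + j) *\<^sub>R ?f (grb (neg (xs ! i)) (neg (xs ! j)) # omit i (omit j xs)))"
    by (subst fin[symmetric], rule finite_pairs, rule G'.finsum_cong'[OF refl])
      (use to_gr_closed t2 in blast)+
  have "?as \<in> tuples (Suc k) (neg_space \<gg>)" using Cp.map_q_tuples[OF xs] .
  then show ?thesis
    unfolding differential_def restrict_apply s1 s2 to_gr_add cobd_def using xs by simp
qed

lemma differential_ext:
  assumes "\<phi> \<in> carrier (cochains \<gg> k)"
  shows "differential \<gg> k \<phi> \<in> tuples (Suc k) (neg_space \<gg>) \<rightarrow>\<^sub>E carrier (gr_space \<gg>)"
proof (rule PiE_I)
  fix as assume "as \<in> tuples (Suc k) (neg_space \<gg>)"
  then obtain xs where "length xs = Suc k" "as = map (\<lambda>x. to_gr (neg x)) xs"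
    by (rule Cp.tuples_cases)
  then show "differential \<gg> k \<phi> as \<in> carrier (gr_space \<gg>)"
    using differential_apply[OF assms] to_gr_closed by metis
qed (simp add: differential_def)

lemma pull_differential:
  assumes "\<phi> \<in> carrier (cochains \<gg> k)"
  shows "Cp.pull (Suc k) (differential \<gg> k \<phi>) = cobd k (Cp.pull k \<phi>)"
proof
  fix xs :: "'g list"
  show "Cp.pull (Suc k) (differential \<gg> k \<phi>) xs = cobd k (Cp.pull k \<phi>) xs"
  proof (cases "length xs = Suc k")
    case True
    then show ?thesis
      unfolding Cp.pull_def[of "Suc k"]
      by (simp only: differential_apply[OF assms] of_gr_to_gr simp_thms if_True)
  qed (simp add: Cp.pull_def[of "Suc k"] cobd_def[of k])
qed

lemma neg_simps [simp]: "neg (x + y) = neg x + neg y" "neg (r *\<^sub>R x) = r *\<^sub>R neg x" "neg 0 = 0"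
  using neg_linear by (simp_all add: linear_add linear_scale linear_0)

lemma neg_fil: "x \<in> fil \<gg> 0 \<Longrightarrow> neg x = 0"
  using neg_eq_iff[of x 0] by simp

lemma cobd_1: "cobd (Suc 0) f [x, y] = grb (neg x) (f [y]) - grb (neg y) (f [x]) - f [grb (neg x) (neg y)]"
proof -
  have "{(i, j). i < j \<and> j \<le> (1::nat)} = {(0, 1)}" by auto
  then show ?thesis by (simp add: cobd_def omit_def)
qed

lemma cobd_2: "cobd 2 f [x, y, z] =
    grb (neg x) (f [y, z]) - grb (neg y) (f [x, z]) + grb (neg z) (f [x, y])
    - f [grb (neg x) (neg y), z] + f [grb (neg x) (neg z), y] - f [grb (neg y) (neg z), x]"
proof -
  have "{(i, j). i < j \<and> j \<le> (2::nat)} = {(0, 1), (0, 2), (1, 2)}" by auto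
  then show ?thesis by (simp add: cobd_def omit_def numeral_2_eq_2)
qed

lemma cobd_length: "length xs \<noteq> Suc k \<Longrightarrow> cobd k f xs = 0"
  by (simp add: cobd_def)

lemma cobd_comb: "cobd k (r *\<^sub>R f + s *\<^sub>R g) = r *\<^sub>R cobd k f + s *\<^sub>R cobd k g"
proof
  fix xs show "cobd k (r *\<^sub>R f + s *\<^sub>R g) xs = (r *\<^sub>R cobd k f + s *\<^sub>R cobd k g) xs"
    by (simp add: cobd_def scaleR_sum_right sum.distrib split_def scaleR_add_right mult.commute
        add.assoc add.left_commute)
qed

lemma length_2_cases: assumes "length xs = 2" obtains x y where "xs = [x, y]"
  using assms by (auto simp: numeral_2_eq_2 length_Suc_conv)

lemma length_3_cases: assumes "length xs = 3" obtains x y z where "xs = [x, y, z]"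
  using assms by (auto simp: numeral_3_eq_3 length_Suc_conv)

lemma forms_1:
  assumes f: "f \<in> forms 1"
  shows "f [x + x'] = f [x] + f [x']" "f [r *\<^sub>R x] = r *\<^sub>R f [x]" "f [0] = 0"
    "x \<in> fil \<gg> 0 \<Longrightarrow> f [x] = 0"
proof -
  have "linear (\<lambda>x. f [x])" using formsD(3)[OF f, of "[0]" 0] by simp
  from linear_add[OF this] linear_scale[OF this] linear_0[OF this]
  show "f [x + x'] = f [x] + f [x']" "f [r *\<^sub>R x] = r *\<^sub>R f [x]" "f [0] = 0" by simp_all
  show "x \<in> fil \<gg> 0 \<Longrightarrow> f [x] = 0" using formsD(5)[OF f, of "[x]" 0] by simp
qed

lemma forms_2:
  assumes f: "f \<in> forms 2"
  shows "f [x + x', y] = f [x, y] + f [x', y]" "f [r *\<^sub>R x, y] = r *\<^sub>R f [x, y]" "f [0, y] = 0"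
    "f [x, y + y'] = f [x, y] + f [x, y']" "f [x, r *\<^sub>R y] = r *\<^sub>R f [x, y]" "f [x, 0] = 0"
    "f [x, x] = 0" "f [y, x] = - f [x, y]" "f [- x, y] = - f [x, y]"
    "x \<in> fil \<gg> 0 \<Longrightarrow> f [x, y] = 0" "y \<in> fil \<gg> 0 \<Longrightarrow> f [x, y] = 0"
proof -
  have "linear (\<lambda>x. f [x, y])" for y using formsD(3)[OF f, of "[0, y]" 0] by simp
  from linear_add[OF this] linear_scale[OF this] linear_0[OF this] linear_neg[OF this]
  show "f [x + x', y] = f [x, y] + f [x', y]" "f [r *\<^sub>R x, y] = r *\<^sub>R f [x, y]" "f [0, y] = 0"
    "f [- x, y] = - f [x, y]" by simp_all
  have "linear (\<lambda>y. f [x, y])" for x using formsD(3)[OF f, of "[x, 0]" 1] by simp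
  from linear_add[OF this] linear_scale[OF this] linear_0[OF this]
  show "f [x, y + y'] = f [x, y] + f [x, y']" "f [x, r *\<^sub>R y] = r *\<^sub>R f [x, y]" "f [x, 0] = 0"
    by simp_all
  show "f [x, x] = 0" using formsD(4)[OF f, of "[x, x]" 0 1] by simp
  show "f [y, x] = - f [x, y]" using alt_mod_swap[OF f, of "[x, y]" 0 1] by simp
  show "x \<in> fil \<gg> 0 \<Longrightarrow> f [x, y] = 0" using formsD(5)[OF f, of "[x, y]" 0] by simp
  show "y \<in> fil \<gg> 0 \<Longrightarrow> f [x, y] = 0" using formsD(5)[OF f, of "[x, y]" 1] by simp
qed

lemma cobd_1_forms: assumes f: "f \<in> forms 1" shows "cobd 1 f \<in> forms 2"
proof (rule formsI)
  note [simp] = forms_1[OF f]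
  show "cobd 1 f xs = 0" if "length xs \<noteq> 2" for xs using that by (simp add: cobd_length)
  fix xs :: "'g list" assume "length xs = 2"
  then obtain x y where xs: "xs = [x, y]" by (rule length_2_cases)
  have two: "i < 2 \<longleftrightarrow> i = 0 \<or> i = 1" for i :: nat by auto
  show "linear (\<lambda>x. cobd 1 f (xs[i := x]))" if "i < 2" for i
    using that unfolding two xs
    by (elim disjE; simp add: cobd_1; intro linearI; simp add: algebra_simps)
  show "cobd 1 f xs = 0" if "i < 2" "j < 2" "i \<noteq> j" "xs ! i = xs ! j" for i j
    using that unfolding two xs by (elim disjE) (simp_all add: cobd_1)
  show "cobd 1 f xs = 0" if "i < 2" "xs ! i \<in> fil \<gg> 0" for i
    using that unfolding two xs by (elim disjE) (simp_all add: cobd_1 neg_fil)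
qed

lemma cobd_2_forms: assumes f: "f \<in> forms 2" shows "cobd 2 f \<in> forms 3"
proof (rule formsI)
  note [simp] = forms_2(1-7,9-11)[OF f]
  show "cobd 2 f xs = 0" if "length xs \<noteq> 3" for xs using that by (simp add: cobd_length)
  fix xs :: "'g list" assume "length xs = 3"
  then obtain x y z where xs: "xs = [x, y, z]" by (rule length_3_cases)
  have three: "i < 3 \<longleftrightarrow> i = 0 \<or> i = 1 \<or> i = 2" for i :: nat by auto
  have skew: "f [grb a b, c] = - f [grb b a, c]" for a b c
    using grb_skew[of a b] by simp
  show "linear (\<lambda>x. cobd 2 f (xs[i := x]))" if "i < 3" for i
    using that unfolding three xs
    by (elim disjE; simp add: cobd_2; intro linearI; simp add: algebra_simps)
  have a1: "cobd 2 f [x, x, z] = 0" for x z by (simp add: cobd_2)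
  have a2: "cobd 2 f [x, y, y] = 0" for x y by (simp add: cobd_2)
  have a3: "cobd 2 f [x, y, x] = 0" for x y
  proof -
    have "grb (neg x) (f [y, x]) = - grb (neg x) (f [x, y])"
      using forms_2(8)[OF f, of y x] grb_simps(4)[of "neg x" "-1" "f [x, y]"] by simp
    then show ?thesis using skew[of "neg y" "neg x" x] by (simp add: cobd_2)
  qed
  show "cobd 2 f xs = 0" if "i < 3" "j < 3" "i \<noteq> j" "xs ! i = xs ! j" for i j
    using that unfolding three xs by (elim disjE) (simp_all add: a1 a2 a3)
  show "cobd 2 f xs = 0" if "i < 3" "xs ! i \<in> fil \<gg> 0" for i
    using that unfolding three xs by (elim disjE) (simp_all add: cobd_2 neg_fil)
qed

lemma forms_deg_1:
  assumes "f \<in> forms_deg 1 l" "pr i x = x" "i < 0"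
  shows "pr (i + l) (f [x]) = f [x]"
  using assms unfolding forms_deg_def
  by (auto dest!: spec[of _ "[i]"] spec[of _ "[x]"])

lemma forms_deg_2:
  assumes "f \<in> forms_deg 2 l" "pr i x = x" "i < 0" "pr j y = y" "j < 0"
  shows "pr (i + j + l) (f [x, y]) = f [x, y]"
proof -
  have "\<forall>n<2. [i, j] ! n < 0 \<and> pr ([i, j] ! n) ([x, y] ! n) = [x, y] ! n"
    using assms by (auto simp: less_2_cases_iff)
  moreover have "length [i, j] = 2" "length [x, y] = 2" by simp_all
  ultimately have "pr (sum_list [i, j] + l) (f [x, y]) = f [x, y]"
    using assms(1) unfolding forms_deg_def by blast
  then show ?thesis by (simp add: add.assoc)
qed

lemma cobd_1_deg: assumes f: "f \<in> forms_deg 1 l" shows "cobd 1 f \<in> forms_deg 2 l"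
  unfolding forms_deg_def
proof (intro CollectI conjI allI impI)
  show "cobd 1 f \<in> forms 2" using f by (intro cobd_1_forms) (simp add: forms_deg_def)
  fix "is" :: "int list" and xs :: "'g list"
  assume h: "length is = 2 \<and> length xs = 2 \<and> (\<forall>j<2. is ! j < 0 \<and> pr (is ! j) (xs ! j) = xs ! j)"
  obtain i j where ds: "is = [i, j]" using h length_2_cases by metis
  obtain x y where xs: "xs = [x, y]" using h length_2_cases by metis
  have hom: "i < 0" "pr i x = x" "j < 0" "pr j y = y"
    using h[THEN conjunct2, THEN conjunct2, rule_format, of 0]
      h[THEN conjunct2, THEN conjunct2, rule_format, of 1] by (simp_all add: ds xs)
  have n: "neg x = x" "neg y = y" using hom homog_neg by auto
  have "pr (i + j + l) (grb x (f [y])) = grb x (f [y])"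
    using grb_homog[OF hom(2) forms_deg_1[OF f hom(4,3)]] by (simp add: ac_simps)
  moreover have "pr (i + j + l) (grb y (f [x])) = grb y (f [x])"
    using grb_homog[OF hom(4) forms_deg_1[OF f hom(2,1)]] by (simp add: ac_simps)
  moreover have "pr (i + j + l) (f [grb x y]) = f [grb x y]"
    using hom by (intro forms_deg_1[OF f] grb_homog) auto
  ultimately show "pr (sum_list is + l) (cobd 1 f xs) = cobd 1 f xs"
    by (simp add: ds xs cobd_1 n)
qed

lemma cobd_2_deg: assumes f: "f \<in> forms_deg 2 l" shows "cobd 2 f \<in> forms_deg 3 l"
  unfolding forms_deg_def
proof (intro CollectI conjI allI impI)
  show "cobd 2 f \<in> forms 3" using f by (intro cobd_2_forms) (simp add: forms_deg_def)
  fix "is" :: "int list" and xs :: "'g list"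
  assume h: "length is = 3 \<and> length xs = 3 \<and> (\<forall>j<3. is ! j < 0 \<and> pr (is ! j) (xs ! j) = xs ! j)"
  obtain i j m where ds: "is = [i, j, m]" using h length_3_cases by metis
  obtain x y z where xs: "xs = [x, y, z]" using h length_3_cases by metis
  have hom: "i < 0" "pr i x = x" "j < 0" "pr j y = y" "m < 0" "pr m z = z"
    using h[THEN conjunct2, THEN conjunct2, rule_format, of 0]
      h[THEN conjunct2, THEN conjunct2, rule_format, of 1]
      h[THEN conjunct2, THEN conjunct2, rule_format, of 2] by (simp_all add: ds xs)
  have n: "neg x = x" "neg y = y" "neg z = z" using hom homog_neg by auto
  have t1: "pr (i + j + m + l) (grb a (f [b, c])) = grb a (f [b, c])"
    if "pr p a = a" "pr q b = b" "q < 0" "pr r c = c" "r < 0" "p + q + r = i + j + m" for a b c p q r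
    using grb_homog[OF that(1) forms_deg_2[OF f that(2-5)]] that(6) by (simp add: add.assoc[symmetric])
  have t2: "pr (i + j + m + l) (f [grb a b, c]) = f [grb a b, c]"
    if "pr p a = a" "p < 0" "pr q b = b" "q < 0" "pr r c = c" "r < 0" "p + q + r = i + j + m" for a b c p q r
    using forms_deg_2[OF f grb_homog[OF that(1,3)] _ that(5,6)] that(2,4,7) by simp
  show "pr (sum_list is + l) (cobd 2 f xs) = cobd 2 f xs"
    using t1[OF hom(2) hom(4,3) hom(6,5)] t1[OF hom(4) hom(2,1) hom(6,5)] t1[OF hom(6) hom(2,1) hom(4,3)]
      t2[OF hom(2,1) hom(4,3) hom(6,5)] t2[OF hom(2,1) hom(6,5) hom(4,3)] t2[OF hom(4,3) hom(6,5) hom(2,1)]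
    by (simp add: ds xs cobd_2 n add.assoc)
qed

lemma cobd_forms: "k \<in> {1, 2} \<Longrightarrow> f \<in> forms k \<Longrightarrow> cobd k f \<in> forms (Suc k)"
  using cobd_1_forms[of f] cobd_2_forms[of f] by (auto simp: numeral_2_eq_2 numeral_3_eq_3)

lemma cobd_deg: "k \<in> {1, 2} \<Longrightarrow> f \<in> forms_deg k l \<Longrightarrow> cobd k f \<in> forms_deg (Suc k) l"
  using cobd_1_deg[of f l] cobd_2_deg[of f l] by (auto simp: numeral_2_eq_2 numeral_3_eq_3)

lemma differential_closed:
  assumes "k \<in> {1, 2}" "\<phi> \<in> carrier (cochains \<gg> k)"
  shows "differential \<gg> k \<phi> \<in> carrier (cochains \<gg> (Suc k))"
proof -
  have "Cp.pull (Suc k) (differential \<gg> k \<phi>) \<in> forms (Suc k)"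
    unfolding pull_differential[OF assms(2)]
    by (rule cobd_forms[OF assms(1) lin_coords.e_closed[OF coords_cochains assms(2)]])
  then show ?thesis
    unfolding cochains_def Cp.alt_space_simps using Cp.pull_mem_iff[OF differential_ext[OF assms(2)]] by simp
qed

lemma differential_linear:
  assumes k: "k \<in> {1, 2}"
  shows "linear_between (cochains \<gg> k) (cochains \<gg> (Suc k)) (differential \<gg> k)"
  unfolding linear_between_def
proof (intro conjI ballI allI)
  interpret C: lin_coords "cochains \<gg> k" "forms k" "Cp.pull k" by (rule coords_cochains)
  interpret C': lin_coords "cochains \<gg> (Suc k)" "forms (Suc k)" "Cp.pull (Suc k)" by (rule coords_cochains)
  show "differential \<gg> k ` carrier (cochains \<gg> k) \<subseteq> carrier (cochains \<gg> (Suc k))"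
    using differential_closed[OF k] by blast
  fix \<phi> \<psi> r s assume c: "\<phi> \<in> carrier (cochains \<gg> k)" "\<psi> \<in> carrier (cochains \<gg> k)"
  note d = differential_closed[OF k]
  have "Cp.pull (Suc k) (differential \<gg> k (r \<odot>\<^bsub>cochains \<gg> k\<^esub> \<phi> \<oplus>\<^bsub>cochains \<gg> k\<^esub> s \<odot>\<^bsub>cochains \<gg> k\<^esub> \<psi>))
      = cobd k (r *\<^sub>R Cp.pull k \<phi> + s *\<^sub>R Cp.pull k \<psi>)"
    using c by (simp add: pull_differential C.closed C.e_add C.e_smult)
  also have "\<dots> = Cp.pull (Suc k) (r \<odot>\<^bsub>cochains \<gg> (Suc k)\<^esub> differential \<gg> k \<phi>
      \<oplus>\<^bsub>cochains \<gg> (Suc k)\<^esub> s \<odot>\<^bsub>cochains \<gg> (Suc k)\<^esub> differential \<gg> k \<psi>)"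
    using c d by (simp add: cobd_comb pull_differential C'.closed C'.e_add C'.e_smult)
  finally show "differential \<gg> k (r \<odot>\<^bsub>cochains \<gg> k\<^esub> \<phi> \<oplus>\<^bsub>cochains \<gg> k\<^esub> s \<odot>\<^bsub>cochains \<gg> k\<^esub> \<psi>) =
      r \<odot>\<^bsub>cochains \<gg> (Suc k)\<^esub> differential \<gg> k \<phi>
      \<oplus>\<^bsub>cochains \<gg> (Suc k)\<^esub> s \<odot>\<^bsub>cochains \<gg> (Suc k)\<^esub> differential \<gg> k \<psi>"
    using c d by (subst (asm) C'.e_eq_iff) (simp_all add: C.closed C'.closed)
qed

lemma differential_linear_deg:
  assumes k: "k \<in> {1, 2}"
  shows "linear_between (cochains_deg \<gg> k l) (cochains_deg \<gg> (Suc k) l) (differential \<gg> k)"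
proof -
  have "differential \<gg> k \<phi> \<in> carrier (cochains_deg \<gg> (Suc k) l)"
    if "\<phi> \<in> carrier (cochains_deg \<gg> k l)" for \<phi>
  proof -
    have c: "\<phi> \<in> carrier (cochains \<gg> k)" using that cochains_deg_carrier by blast
    then have "cobd k (Cp.pull k \<phi>) \<in> forms_deg (Suc k) l"
      using that by (intro cobd_deg[OF k]) (simp add: cochains_deg_iff)
    then show ?thesis
      using cochains_deg_iff[OF differential_closed[OF k c]] pull_differential[OF c] by simp
  qed
  then show ?thesis
    by (subst (1 2) cochains_deg_record)
      (intro linear_between_restrict[OF differential_linear[OF k]] cochains_deg_carrier, blast)
qed

section \<open>Graded images and kernels of image-homogeneous maps\<close>

lemma gr0_linear_deg:
  assumes \<Phi>: "\<Phi> \<in> linear_maps (maps \<gg> k) (maps \<gg> k')"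
    and fil: "\<And>l. \<Phi> ` maps_fil \<gg> k l \<subseteq> maps_fil \<gg> k' l"
  shows "linear_between (cochains_deg \<gg> k l) (cochains_deg \<gg> k' l) (gr0 \<gg> k k' \<Phi>)"
proof -
  have "gr0 \<gg> k k' \<Phi> \<phi> \<in> carrier (cochains_deg \<gg> k' l)" if \<phi>: "\<phi> \<in> carrier (cochains_deg \<gg> k l)" for \<phi>
  proof -
    obtain \<alpha> where \<alpha>: "\<alpha> \<in> maps_fil \<gg> k l" "gr_map \<gg> k l \<alpha> = \<phi>" using \<phi> by (rule gr_map_surj)
    then have "\<Phi> \<alpha> \<in> maps_fil \<gg> k' l" using fil by blast
    then show ?thesis using gr0_maps(2)[OF \<Phi> fil \<alpha>(1)] gr_map_hcomp(1) \<alpha>(2) by simp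
  qed
  then show ?thesis
    by (subst (1 2) cochains_deg_record)
      (intro linear_between_restrict[OF linear_maps_linear_between[OF gr0_maps(1)[OF \<Phi> fil]]]
        cochains_deg_carrier, blast)
qed

lemma gr_sub_image:
  assumes \<Phi>: "\<Phi> \<in> linear_maps (maps \<gg> k) (maps \<gg> k')"
    and fil: "\<And>l. \<Phi> ` maps_fil \<gg> k l \<subseteq> maps_fil \<gg> k' l"
    and img: "\<And>l. \<Phi> ` carrier (maps \<gg> k) \<inter> maps_fil \<gg> k' l = \<Phi> ` maps_fil \<gg> k l"
  shows "gr_sub \<gg> k' l (\<Phi> ` carrier (maps \<gg> k)) = gr0 \<gg> k k' \<Phi> ` carrier (cochains_deg \<gg> k l)"
proof -
  have "carrier (cochains_deg \<gg> k l) = gr_map \<gg> k l ` maps_fil \<gg> k l"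
  proof
    show "carrier (cochains_deg \<gg> k l) \<subseteq> gr_map \<gg> k l ` maps_fil \<gg> k l"
    proof
      fix \<phi> assume "\<phi> \<in> carrier (cochains_deg \<gg> k l)"
      then obtain \<alpha> where "\<alpha> \<in> maps_fil \<gg> k l" "gr_map \<gg> k l \<alpha> = \<phi>" by (rule gr_map_surj)
      then show "\<phi> \<in> gr_map \<gg> k l ` maps_fil \<gg> k l" by blast
    qed
  qed (use gr_map_hcomp(1) in blast)
  then show ?thesis
    unfolding gr_sub_def img by (simp add: image_image gr0_maps(2)[OF \<Phi> fil])
qed

text \<open>
  If \<open>\<Phi> \<alpha>\<close> has homogeneity at least \<open>l + 1\<close>, then by image-homogeneity \<open>\<Phi> \<alpha> = \<Phi> \<beta>\<close> for some \<open>\<beta>\<close>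
  of homogeneity at least \<open>l + 1\<close>, and \<open>\<alpha> - \<beta>\<close> is an element of the kernel with the same image in
  the associated graded space as \<open>\<alpha>\<close>.
\<close>

lemma gr_sub_kernel:
  assumes \<Phi>: "\<Phi> \<in> linear_maps (maps \<gg> k) (maps \<gg> k')"
    and fil: "\<And>l. \<Phi> ` maps_fil \<gg> k l \<subseteq> maps_fil \<gg> k' l"
    and img: "\<And>l. \<Phi> ` carrier (maps \<gg> k) \<inter> maps_fil \<gg> k' l = \<Phi> ` maps_fil \<gg> k l"
  shows "gr_sub \<gg> k l (a_kernel (maps \<gg> k) (maps \<gg> k') \<Phi>)
    = a_kernel (cochains_deg \<gg> k l) (cochains_deg \<gg> k' l) (gr0 \<gg> k k' \<Phi>)"
proof (intro subset_antisym subsetI)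
  interpret M: lin_coords "maps \<gg> k" "forms k" "Mp.pull k" by (rule coords_maps)
  interpret M': lin_coords "maps \<gg> k'" "forms k'" "Mp.pull k'" by (rule coords_maps)
  interpret MM': lin_coords_pair "maps \<gg> k" "forms k" "Mp.pull k" "maps \<gg> k'" "forms k'" "Mp.pull k'" ..
  have \<Phi>l: "linear_between (maps \<gg> k) (maps \<gg> k') \<Phi>" by (rule linear_maps_linear_between[OF \<Phi>])
  fix \<phi>
  {
    assume "\<phi> \<in> gr_sub \<gg> k l (a_kernel (maps \<gg> k) (maps \<gg> k') \<Phi>)"
    then obtain \<alpha> where \<alpha>: "\<alpha> \<in> maps_fil \<gg> k l" "\<Phi> \<alpha> = \<zero>\<^bsub>maps \<gg> k'\<^esub>" "\<phi> = gr_map \<gg> k l \<alpha>"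
      by (auto simp: gr_sub_def a_kernel_def')
    have z: "\<zero>\<^bsub>maps \<gg> k'\<^esub> \<in> maps_fil \<gg> k' m" for m
      using subspace_0[OF subspace_forms_fil] by (simp add: maps_fil_iff M'.zero_closed M'.e_zero)
    have "gr_map \<gg> k' l \<zero>\<^bsub>maps \<gg> k'\<^esub> = \<zero>\<^bsub>cochains \<gg> k'\<^esub>"
      using gr_map_eq_zero_iff[OF z] z by blast
    then show "\<phi> \<in> a_kernel (cochains_deg \<gg> k l) (cochains_deg \<gg> k' l) (gr0 \<gg> k k' \<Phi>)"
      using \<alpha> gr0_maps(2)[OF \<Phi> fil \<alpha>(1)] gr_map_hcomp(1)[OF \<alpha>(1)] by (simp add: a_kernel_def')
  next
    assume "\<phi> \<in> a_kernel (cochains_deg \<gg> k l) (cochains_deg \<gg> k' l) (gr0 \<gg> k k' \<Phi>)"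
    then have \<phi>: "\<phi> \<in> carrier (cochains_deg \<gg> k l)" "gr0 \<gg> k k' \<Phi> \<phi> = \<zero>\<^bsub>cochains \<gg> k'\<^esub>"
      by (auto simp: a_kernel_def')
    obtain \<alpha> where \<alpha>: "\<alpha> \<in> maps_fil \<gg> k l" "gr_map \<gg> k l \<alpha> = \<phi>" using \<phi>(1) by (rule gr_map_surj)
    have \<Phi>\<alpha>: "\<Phi> \<alpha> \<in> maps_fil \<gg> k' l" using \<alpha> fil by blast
    have c: "\<alpha> \<in> carrier (maps \<gg> k)" using \<alpha> maps_fil_carrier by blast
    have "\<Phi> \<alpha> \<in> maps_fil \<gg> k' (l + 1)"
      using gr_map_eq_zero_iff[OF \<Phi>\<alpha>] gr0_maps(2)[OF \<Phi> fil \<alpha>(1)] \<alpha>(2) \<phi>(2) by simp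
    then have "\<Phi> \<alpha> \<in> \<Phi> ` maps_fil \<gg> k (l + 1)" using c img[of "l + 1"] by blast
    then obtain \<beta> where \<beta>: "\<beta> \<in> maps_fil \<gg> k (l + 1)" "\<Phi> \<alpha> = \<Phi> \<beta>" by blast
    have c': "\<beta> \<in> carrier (maps \<gg> k)" using \<beta> maps_fil_carrier by blast
    have "\<Phi> (\<alpha> \<ominus>\<^bsub>maps \<gg> k\<^esub> \<beta>) = \<Phi> \<beta> \<ominus>\<^bsub>maps \<gg> k'\<^esub> \<Phi> \<beta>"
      using MM'.linear_minus[OF \<Phi>l c c'] \<beta>(2) by simp
    also have "\<dots> = \<zero>\<^bsub>maps \<gg> k'\<^esub>"
    proof -
      interpret M'': module real_ring "maps \<gg> k'" by (rule M'.module)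
      show ?thesis using linear_betweenD(1)[OF \<Phi>l c'] by (simp add: a_minus_def M''.r_neg)
    qed
    finally have "\<alpha> \<ominus>\<^bsub>maps \<gg> k\<^esub> \<beta> \<in> a_kernel (maps \<gg> k) (maps \<gg> k') \<Phi> \<inter> maps_fil \<gg> k l"
      using gr_map_minus_higher(1)[OF \<alpha>(1) \<beta>(1)] maps_fil_carrier by (auto simp: a_kernel_def')
    then show "\<phi> \<in> gr_sub \<gg> k l (a_kernel (maps \<gg> k) (maps \<gg> k') \<Phi>)"
      using gr_map_minus_higher(2)[OF \<alpha>(1) \<beta>(1)] \<alpha>(2) unfolding gr_sub_def by (metis imageI)
  }
qed

section \<open>Complementary subspaces in each degree\<close>

lemma fin_gen_forms_deg: "fin_gen (forms_deg k l)"
proof -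
  obtain K :: "'g set" where K: "finite K" "span K = UNIV" using finite_dim by blast
  have "fin_gen (forms k)" by (rule fin_gen_alt_mod[OF K K])
  then show ?thesis by (rule fin_gen_subset) (auto simp: forms_deg_def)
qed

lemma a_kernel_deg_subset:
  "a_kernel (cochains_deg \<gg> k l) (cochains_deg \<gg> k' l) D \<subseteq> a_kernel (cochains \<gg> k) (cochains \<gg> k') D"
  using cochains_deg_carrier by (auto simp: a_kernel_def')

lemma complementary_deg:
  assumes D: "linear_between (cochains_deg \<gg> k l) (cochains_deg \<gg> k' l) D"
    and D': "linear_between (cochains_deg \<gg> k' l) (cochains_deg \<gg> k l) D'"
    and disj: "D' ` carrier (cochains \<gg> k') \<inter> a_kernel (cochains \<gg> k) (cochains \<gg> k') D = {\<zero>\<^bsub>cochains \<gg> k\<^esub>}"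
    and disj': "D ` carrier (cochains \<gg> k) \<inter> a_kernel (cochains \<gg> k') (cochains \<gg> k) D' = {\<zero>\<^bsub>cochains \<gg> k'\<^esub>}"
  shows "complementary (cochains_deg \<gg> k l) (D' ` carrier (cochains_deg \<gg> k' l))
    (a_kernel (cochains_deg \<gg> k l) (cochains_deg \<gg> k' l) D)"
proof (rule complementary_image_kernel[OF coords_cochains_deg coords_cochains_deg fin_gen_forms_deg D D'])
  interpret C: lin_coords "cochains_deg \<gg> k l" "forms_deg k l" "Cp.pull k" by (rule coords_cochains_deg)
  interpret C': lin_coords "cochains_deg \<gg> k' l" "forms_deg k' l" "Cp.pull k'" by (rule coords_cochains_deg)
  interpret CC': lin_coords_pair "cochains_deg \<gg> k l" "forms_deg k l" "Cp.pull k" "cochains_deg \<gg> k' l" "forms_deg k' l" "Cp.pull k'" ..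
  interpret C'C: lin_coords_pair "cochains_deg \<gg> k' l" "forms_deg k' l" "Cp.pull k'" "cochains_deg \<gg> k l" "forms_deg k l" "Cp.pull k" ..
  note z = CC'.linear_zero[OF D] C'C.linear_zero[OF D'] C.zero_closed C'.zero_closed
  show "D' ` carrier (cochains_deg \<gg> k' l) \<inter> a_kernel (cochains_deg \<gg> k l) (cochains_deg \<gg> k' l) D
      = {\<zero>\<^bsub>cochains_deg \<gg> k l\<^esub>}"
  proof
    show "D' ` carrier (cochains_deg \<gg> k' l) \<inter> a_kernel (cochains_deg \<gg> k l) (cochains_deg \<gg> k' l) D
      \<subseteq> {\<zero>\<^bsub>cochains_deg \<gg> k l\<^esub>}"
      using disj a_kernel_deg_subset cochains_deg_carrier unfolding cochains_deg_simps by blast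
    show "{\<zero>\<^bsub>cochains_deg \<gg> k l\<^esub>} \<subseteq>
        D' ` carrier (cochains_deg \<gg> k' l) \<inter> a_kernel (cochains_deg \<gg> k l) (cochains_deg \<gg> k' l) D"
      using z unfolding a_kernel_def' by (auto intro: rev_image_eqI)
  qed
  show "D ` carrier (cochains_deg \<gg> k l) \<inter> a_kernel (cochains_deg \<gg> k' l) (cochains_deg \<gg> k l) D'
      = {\<zero>\<^bsub>cochains_deg \<gg> k' l\<^esub>}"
  proof
    show "D ` carrier (cochains_deg \<gg> k l) \<inter> a_kernel (cochains_deg \<gg> k' l) (cochains_deg \<gg> k l) D'
      \<subseteq> {\<zero>\<^bsub>cochains_deg \<gg> k' l\<^esub>}"
      using disj' a_kernel_deg_subset cochains_deg_carrier unfolding cochains_deg_simps by blast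
    show "{\<zero>\<^bsub>cochains_deg \<gg> k' l\<^esub>} \<subseteq>
        D ` carrier (cochains_deg \<gg> k l) \<inter> a_kernel (cochains_deg \<gg> k' l) (cochains_deg \<gg> k l) D'"
      using z unfolding a_kernel_def' by (auto intro: rev_image_eqI)
  qed
qed

end

section \<open>The group action\<close>

lemma (in graded_splitting) P_act_maps:
  assumes g: "linear (Ad p)" "linear (Ad (m_inv P p))" "Ad (m_inv P p) ` fil \<gg> 0 = fil \<gg> 0"
  shows "\<alpha> \<in> carrier (maps \<gg> k) \<Longrightarrow> P_act \<gg> P Ad k p \<alpha> \<in> carrier (maps \<gg> k)"
    and "P_act \<gg> P Ad k p \<zero>\<^bsub>maps \<gg> k\<^esub> = \<zero>\<^bsub>maps \<gg> k\<^esub>"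
proof -
  let ?g = "Ad p" and ?h = "Ad (m_inv P p)" and ?q = "\<lambda>x. x +o fil \<gg> 0"
  have h_coset: "?h ` ?q x = ?q (?h x)" for x
  proof -
    have "?h ` ?q x = ?h x +o ?h ` fil \<gg> 0"
      by (force simp: elt_set_plus_def linear_add[OF g(2)])
    then show ?thesis using g(3) by simp
  qed
  have h_map: "map (\<lambda>C. ?h ` C) (map ?q xs) = map ?q (map ?h xs)" for xs
    by (simp add: h_coset)
  have act: "P_act \<gg> P Ad k p \<alpha> (map ?q xs) = ?g (\<alpha> (map ?q (map ?h xs)))" if "length xs = k" for \<alpha> xs
    unfolding P_act_def using Mp.map_q_tuples[OF that] by (simp only: restrict_apply if_True h_map)
  have ext: "P_act \<gg> P Ad k p \<alpha> \<in> tuples k (quot_space UNIV (fil \<gg> 0)) \<rightarrow>\<^sub>E carrier type_space" for \<alpha>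
    by (simp add: P_act_def)
  show "P_act \<gg> P Ad k p \<alpha> \<in> carrier (maps \<gg> k)" if \<alpha>: "\<alpha> \<in> carrier (maps \<gg> k)" for \<alpha>
  proof -
    have f: "Mp.pull k \<alpha> \<in> forms k" by (rule lin_coords.e_closed[OF coords_maps \<alpha>])
    have pull: "Mp.pull k (P_act \<gg> P Ad k p \<alpha>) xs = ?g (Mp.pull k \<alpha> (map ?h xs))" if "length xs = k" for xs
      using that act[OF that] by (simp add: Mp.pull_def)
    have "Mp.pull k (P_act \<gg> P Ad k p \<alpha>) \<in> forms k"
    proof (rule formsI)
      show "Mp.pull k (P_act \<gg> P Ad k p \<alpha>) xs = 0" if "length xs \<noteq> k" for xs
        using that by (simp add: Mp.pull_def)
      fix xs :: "'g list" assume xs: "length xs = k"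
      show "linear (\<lambda>x. Mp.pull k (P_act \<gg> P Ad k p \<alpha>) (xs[i := x]))" if "i < k" for i
      proof -
        have "linear (?g \<circ> ((\<lambda>x. Mp.pull k \<alpha> ((map ?h xs)[i := x])) \<circ> ?h))"
          using formsD(3)[OF f, of "map ?h xs" i] that xs by (intro linear_compose g) simp
        then show ?thesis using xs by (simp add: pull o_def map_update)
      qed
      show "Mp.pull k (P_act \<gg> P Ad k p \<alpha>) xs = 0" if "i < k" "j < k" "i \<noteq> j" "xs ! i = xs ! j" for i j
        using formsD(4)[OF f, of "map ?h xs" i j] that xs by (simp add: pull linear_0[OF g(1)])
      show "Mp.pull k (P_act \<gg> P Ad k p \<alpha>) xs = 0" if "i < k" "xs ! i \<in> fil \<gg> 0" for i
      proof -
        have "?h (xs ! i) \<in> fil \<gg> 0" using that(2) g(3) by blast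
        then show ?thesis
          using formsD(5)[OF f, of "map ?h xs" i] that(1) xs by (simp add: pull linear_0[OF g(1)])
      qed
    qed
    then show ?thesis unfolding maps_def Mp.alt_space_simps using Mp.pull_mem_iff[OF ext] by simp
  qed
  show "P_act \<gg> P Ad k p \<zero>\<^bsub>maps \<gg> k\<^esub> = \<zero>\<^bsub>maps \<gg> k\<^esub>"
  proof (rule Mp.pull_inj[where k = k, OF ext])
    show "\<zero>\<^bsub>maps \<gg> k\<^esub> \<in> tuples k (quot_space UNIV (fil \<gg> 0)) \<rightarrow>\<^sub>E carrier type_space"
      by (simp add: maps_def)
    show "Mp.pull k (P_act \<gg> P Ad k p \<zero>\<^bsub>maps \<gg> k\<^esub>) = Mp.pull k \<zero>\<^bsub>maps \<gg> k\<^esub>"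
    proof
      fix xs :: "'g list"
      show "Mp.pull k (P_act \<gg> P Ad k p \<zero>\<^bsub>maps \<gg> k\<^esub>) xs = Mp.pull k \<zero>\<^bsub>maps \<gg> k\<^esub> xs"
      proof (cases "length xs = k")
        case True
        have "\<zero>\<^bsub>maps \<gg> k\<^esub> (map ?q ys) = 0" if "length ys = k" for ys
          using Mp.map_q_tuples[OF that] by (simp add: maps_def)
        then show ?thesis using True act[OF True] by (simp add: Mp.pull_def linear_0[OF g(1)] del: map_map)
      qed (simp add: Mp.pull_def)
    qed
  qed
qed

lemma (in admissible_pair) Ad_props:
  assumes p: "p \<in> carrier P"
  shows "linear (Ad p)" "linear (Ad (m_inv P p))" "Ad (m_inv P p) ` fil \<gg> 0 = fil \<gg> 0"
proof -
  have ip: "m_inv P p \<in> carrier P" using p by simp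
  have aut: "linear (Ad x)" "bij (Ad x)" "Ad x ` fil \<gg> 0 \<subseteq> fil \<gg> 0" if "x \<in> carrier P" for x
  proof -
    have "Ad x \<in> carrier (aut_f \<gg>)" using Ad_hom that by (auto simp: hom_def)
    then show "linear (Ad x)" "bij (Ad x)" "Ad x ` fil \<gg> 0 \<subseteq> fil \<gg> 0" by (simp_all add: aut_f_def)
  qed
  have mult: "Ad (x \<otimes>\<^bsub>P\<^esub> y) = Ad x \<circ> Ad y" if "x \<in> carrier P" "y \<in> carrier P" for x y
    using Ad_hom that by (auto simp: hom_def aut_f_def)
  show "linear (Ad p)" "linear (Ad (m_inv P p))" using aut p ip by auto
  have "Ad \<one>\<^bsub>P\<^esub> \<circ> Ad \<one>\<^bsub>P\<^esub> = Ad \<one>\<^bsub>P\<^esub>" using mult[of "\<one>\<^bsub>P\<^esub>" "\<one>\<^bsub>P\<^esub>"] by simp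
  then have "Ad \<one>\<^bsub>P\<^esub> x = x" for x
    using bij_is_inj[OF aut(2)[OF one_closed]] by (metis comp_apply injD)
  then have inv: "Ad (m_inv P p) (Ad p x) = x" for x
    using mult[OF ip p] p by (metis comp_apply l_inv)
  show "Ad (m_inv P p) ` fil \<gg> 0 = fil \<gg> 0"
  proof
    show "fil \<gg> 0 \<subseteq> Ad (m_inv P p) ` fil \<gg> 0"
      using inv aut(3)[OF p] by (metis image_subset_iff rev_image_eqI subsetI)
  qed (rule aut(3)[OF ip])
qed

section \<open>Kernel and image of a codifferential\<close>

theorem proposition3p10:
  fixes \<gg> :: "'g::real_normed_vector filtered_lie"
    and P :: "('p, 'g) lie_grp"
    and \<iota> :: "'g \<Rightarrow> ('p \<Rightarrow> real) \<Rightarrow> ('p \<Rightarrow> real)"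
    and Ad :: "'p \<Rightarrow> 'g \<Rightarrow> 'g"
    and \<delta> :: "nat \<Rightarrow> 'g multimap \<Rightarrow> 'g multimap"
  assumes "admissible_pair \<gg> P \<iota> Ad"
    and "codifferential \<gg> P Ad \<delta>"
  shows "normalization_condition \<gg> P Ad (a_kernel (maps \<gg> 2) (maps \<gg> 1) (\<delta> 2)) \<and>
    maximal_negligible_submodule \<gg> P Ad (a_kernel (maps \<gg> 2) (maps \<gg> 1) (\<delta> 2))
      (\<delta> 3 ` carrier (maps \<gg> 3))"
proof -
  interpret A: admissible_pair \<gg> P \<iota> Ad by fact
  interpret D: codifferential \<gg> P Ad \<delta> by fact
  obtain pr where "graded_splitting \<gg> pr" using A.graded_splitting_exists by blast
  then interpret G: graded_splitting \<gg> pr .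
  let ?N = "a_kernel (maps \<gg> 2) (maps \<gg> 1) (\<delta> 2)" and ?N' = "\<delta> 3 ` carrier (maps \<gg> 3)"
  have act: "\<alpha> \<in> carrier (maps \<gg> k) \<Longrightarrow> P_act \<gg> P Ad k p \<alpha> \<in> carrier (maps \<gg> k)"
    "P_act \<gg> P Ad k p \<zero>\<^bsub>maps \<gg> k\<^esub> = \<zero>\<^bsub>maps \<gg> k\<^esub>" if "p \<in> carrier P" for p k \<alpha>
    by (rule G.P_act_maps(1)[OF A.Ad_props[OF that]], assumption)
      (rule G.P_act_maps(2)[OF A.Ad_props[OF that]])
  have \<delta>: "\<delta> 2 \<in> linear_maps (maps \<gg> 2) (maps \<gg> 1)" "\<delta> 3 \<in> linear_maps (maps \<gg> 3) (maps \<gg> 2)"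
    using D.codiff_linear[of 2] D.codiff_linear[of 3] by simp_all
  note lin = \<delta>[THEN linear_maps_linear_between]
  have fil: "\<delta> 2 ` maps_fil \<gg> 2 l \<subseteq> maps_fil \<gg> 1 l" "\<delta> 3 ` maps_fil \<gg> 3 l \<subseteq> maps_fil \<gg> 2 l" for l
    using D.filtration_preserving[of 2] D.filtration_preserving[of 3] by simp_all
  have img: "\<delta> 2 ` carrier (maps \<gg> 2) \<inter> maps_fil \<gg> 1 l = \<delta> 2 ` maps_fil \<gg> 2 l"
    "\<delta> 3 ` carrier (maps \<gg> 3) \<inter> maps_fil \<gg> 2 l = \<delta> 3 ` maps_fil \<gg> 3 l" for l
    using D.image_homogeneous[of 2] D.image_homogeneous[of 3] by simp_all
  interpret M21: lin_coords_pair "maps \<gg> 2" "G.forms 2" "G.Mp.pull 2" "maps \<gg> 1" "G.forms 1" "G.Mp.pull 1"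
    by (intro lin_coords_pair.intro G.coords_maps)
  interpret M32: lin_coords_pair "maps \<gg> 3" "G.forms 3" "G.Mp.pull 3" "maps \<gg> 2" "G.forms 2" "G.Mp.pull 2"
    by (intro lin_coords_pair.intro G.coords_maps)
  have subN: "P_submodule \<gg> P Ad 2 ?N"
    unfolding P_submodule_def
  proof (intro conjI ballI)
    show "submodule ?N real_ring (maps \<gg> 2)" by (rule M21.submodule_kernel[OF lin(1)])
    fix p \<alpha> assume p: "p \<in> carrier P" and "\<alpha> \<in> ?N"
    then have \<alpha>: "\<alpha> \<in> carrier (maps \<gg> 2)" "\<delta> 2 \<alpha> = \<zero>\<^bsub>maps \<gg> 1\<^esub>" by (auto simp: a_kernel_def')
    have "\<delta> 2 (P_act \<gg> P Ad 2 p \<alpha>) = \<zero>\<^bsub>maps \<gg> 1\<^esub>"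
      using D.equivariant[of 2 p \<alpha>] p \<alpha> act(2)[OF p] by simp
    then show "P_act \<gg> P Ad 2 p \<alpha> \<in> ?N" using act(1)[OF p \<alpha>(1)] by (simp add: a_kernel_def')
  qed
  have subN': "P_submodule \<gg> P Ad 2 ?N'"
    unfolding P_submodule_def
  proof (intro conjI ballI)
    show "submodule ?N' real_ring (maps \<gg> 2)" by (rule M32.submodule_image[OF lin(2)])
    fix p \<beta> assume p: "p \<in> carrier P" and "\<beta> \<in> ?N'"
    then obtain \<alpha> where \<alpha>: "\<alpha> \<in> carrier (maps \<gg> 3)" "\<beta> = \<delta> 3 \<alpha>" by blast
    have "P_act \<gg> P Ad 2 p \<beta> = \<delta> 3 (P_act \<gg> P Ad 3 p \<alpha>)"
      using D.equivariant[of 3 p \<alpha>] p \<alpha> by simp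
    then show "P_act \<gg> P Ad 2 p \<beta> \<in> ?N'" using act(1)[OF p \<alpha>(1)] by blast
  qed
  have N'N: "?N' \<subseteq> ?N"
    using D.codiff_codiff linear_mapsD(1)[OF \<delta>(2)] by (auto simp: a_kernel_def')
  let ?\<Delta>2 = "gr0 \<gg> 2 1 (\<delta> 2)" and ?\<Delta>3 = "gr0 \<gg> 3 2 (\<delta> 3)"
  have comp1: "complementary (cochains_deg \<gg> 2 l) (gr_sub \<gg> 2 l ?N)
      (differential \<gg> 1 ` carrier (cochains_deg \<gg> 1 l))" for l
  proof -
    have "complementary (cochains_deg \<gg> 2 l) (differential \<gg> 1 ` carrier (cochains_deg \<gg> 1 l))
        (a_kernel (cochains_deg \<gg> 2 l) (cochains_deg \<gg> 1 l) ?\<Delta>2)"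
    proof (rule G.complementary_deg)
      show "linear_between (cochains_deg \<gg> 2 l) (cochains_deg \<gg> 1 l) ?\<Delta>2"
        by (rule G.gr0_linear_deg[OF \<delta>(1) fil(1)])
      show "linear_between (cochains_deg \<gg> 1 l) (cochains_deg \<gg> 2 l) (differential \<gg> 1)"
        using G.differential_linear_deg[of 1 l] by (simp add: numeral_2_eq_2)
      show "differential \<gg> 1 ` carrier (cochains \<gg> 1) \<inter> a_kernel (cochains \<gg> 2) (cochains \<gg> 1) ?\<Delta>2
          = {\<zero>\<^bsub>cochains \<gg> 2\<^esub>}"
        using D.disjoint_ker_im[of 2] by (simp add: Int_commute)
      show "?\<Delta>2 ` carrier (cochains \<gg> 2) \<inter> a_kernel (cochains \<gg> 1) (cochains \<gg> 2) (differential \<gg> 1)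
          = {\<zero>\<^bsub>cochains \<gg> 1\<^esub>}"
        using D.disjoint_im_ker[of 1] by (simp add: numeral_2_eq_2)
    qed
    then show ?thesis
      unfolding G.gr_sub_kernel[OF \<delta>(1) fil(1) img(1)]
      by (rule complementary_commute[OF G.coords_cochains_deg])
  qed
  have comp2: "complementary (cochains_deg \<gg> 2 l) (gr_sub \<gg> 2 l ?N')
      (a_kernel (cochains_deg \<gg> 2 l) (cochains_deg \<gg> 3 l) (differential \<gg> 2))" for l
    unfolding G.gr_sub_image[OF \<delta>(2) fil(2) img(2)]
  proof (rule G.complementary_deg)
    show "linear_between (cochains_deg \<gg> 3 l) (cochains_deg \<gg> 2 l) ?\<Delta>3"
      by (rule G.gr0_linear_deg[OF \<delta>(2) fil(2)])
    show "linear_between (cochains_deg \<gg> 2 l) (cochains_deg \<gg> 3 l) (differential \<gg> 2)"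
      using G.differential_linear_deg[of 2 l] by (simp add: numeral_2_eq_2 numeral_3_eq_3)
    show "?\<Delta>3 ` carrier (cochains \<gg> 3) \<inter> a_kernel (cochains \<gg> 2) (cochains \<gg> 3) (differential \<gg> 2)
        = {\<zero>\<^bsub>cochains \<gg> 2\<^esub>}"
      using D.disjoint_im_ker[of 2] by simp
    show "differential \<gg> 2 ` carrier (cochains \<gg> 2) \<inter> a_kernel (cochains \<gg> 3) (cochains \<gg> 2) ?\<Delta>3
        = {\<zero>\<^bsub>cochains \<gg> 3\<^esub>}"
      using D.disjoint_ker_im[of 3] by (simp add: Int_commute)
  qed
  show ?thesis
    unfolding normalization_condition_def maximal_negligible_submodule_def negligible_submodule_def
    using subN subN' N'N comp1 comp2 by (auto simp: complementary_def)
qed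

end
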